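(* Let $G$ be a countable row-finite directed graph without sinks, with adjacency matrix $A=(A_{vw})_{v,w\in V_G}$, and let $\beta\in\mathbb R$. There is a bijective correspondence between the $\beta$-KMS states $\psi$ for the gauge action on $C^*(G)$ and the non-zero elements $\xi\in\mathbb R^{V_G}$ satisfying a') $\xi_v\ge0$ for all $v\in V_G$, b') $\sum_{w\in V_G}A_{vw}\xi_w=e^\beta\xi_v$ for all $v\in V_G$, and c) $\sum_{v\in V_G}\xi_v=1$; the correspondence is given by $\xi_v=\psi(1_{C_v})$, $v\in V_G$.
   Context: **Graphs.** $G$ is a directed graph with countable vertex set $V_G$ and countable edge set $E_G$; $s(e)$ and $r(e)$ are the source and range of an edge $e$. Row-finite: each vertex emits finitely many edges. No sinks: each vertex emits at least one edge. $A_{vw}=\#\{e\in E_G:s(e)=v,\ r(e)=w\}$. $\mathbb R^{V_G}$ is the space of all functions $V_G\to\mathbb R$. $P(G)$ is the set of infinite paths $p=(p_i)_{i\ge1}\in E_G^{\mathbb N}$, $r(p_i)=s(p_{i+1})$, with $s(p)=s(p_1)$ and the topology having as base the cylinders $Z(e_1\cdots e_n)=\{p:p_i=e_i,\ 1\le i\le n\}$; it is totally disconnected, second countable, locally compact Hausdorff. $C_v=\{p\in P(G):s(p)=v\}$, a compact open set, with characteristic function $1_{C_v}\in C_c(P(G))$. **The algebra $C^*(G)$ and the gauge action.** $\sigma$ is the shift on $P(G)$, $\sigma(p_1p_2p_3\cdots)=p_2p_3\cdots$, a local homeomorphism. $\Gamma_\sigma=\{(p,k,q)\in P(G)\times\mathbb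 Z\times P(G):\exists n,m\in\mathbb N,\ k=n-m,\ \sigma^n(p)=\sigma^m(q)\}$ is a groupoid with $(p,k,q)(q,k',q')=(p,k+k',q')$, $(p,k,q)^{-1}=(q,-k,p)$, $r(p,k,q)=p$, $s(p,k,q)=q$, unit space identified with $P(G)$ via $p\mapsto(p,0,p)$ (so $C_c(P(G))\subseteq C_c(\Gamma_\sigma)$). The set $\Gamma_\sigma(k,n)=\{(p,k,q):\sigma^{k+n}(p)=\sigma^n(q)\}$ has the relative topology from $P(G)\times\mathbb Z\times P(G)$, $\Gamma_\sigma(k)=\bigcup_n\Gamma_\sigma(k,n)$ the inductive limit topology, and each $\Gamma_\sigma(k)$ is open and closed in $\Gamma_\sigma=\bigcup_k\Gamma_\sigma(k)$; this makes $\Gamma_\sigma$ an étale second countable locally compact Hausdorff groupoid. $C^*(G)$ is the reduced groupoid $C^*$-algebra $C^*_r(\Gamma_\sigma)$. The gauge action $\gamma=(\gamma_t)_{t\in\mathbb R}$ is determined by $\gamma_t(f)(p,k,q)=e^{ikt}f(p,k,q)$ for $f\in C_c(\Gamma_\sigma)$. **KMS weights and states.** A weight on a $C^*$-algebra $A$ is a map $\psi:A_+\to[0,\infty]$ with $\psi(a+b)=\psi(a)+\psi(b)$, $\psi(\lambda a)=\lambda\psi(a)$ for $\lambda>0$. It is proper when it is non-zero, densely defined ($\{a\in A_+:\psi(a)<\infty\}$ is dense in $A_+$) and lower semi-continuous ($\{a\in A_+:\psi(a)\le\alpha\}$ is closed for all $\alpha\ge0$). For proper $\psi$ put $\mathcal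 N_\psi=\{a\in A:\psi(a^*a)<\infty\}$; $\psi$ extends uniquely to a linear functional, also denoted $\psi$, on $\mathrm{Span}\{a^*b:a,b\in\mathcal N_\psi\}$. For a point-wise norm-continuous one-parameter group $\alpha$ of automorphisms of $A$ and $\beta\in\mathbb R$, a proper weight $\psi$ is a $\beta$-KMS weight for $\alpha$ when (i) $\psi\circ\alpha_t=\psi$ for all $t\in\mathbb R$, and (ii) for all $a,b\in\mathcal N_\psi\cap\mathcal N_\psi^*$ there is a continuous bounded function $F$ on the closed strip $D_\beta$ of complex numbers with imaginary part between $0$ and $\beta$, holomorphic in its interior, with $F(t)=\psi(a\alpha_t(b))$ and $F(t+i\beta)=\psi(\alpha_t(b)a)$ for all $t\in\mathbb R$. A $\beta$-KMS state is a $\beta$-KMS weight with $\sup\{\psi(a):0\le a\le1\}=1$. *)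

theory Defs
  imports "HOL-Analysis.Analysis" "Graph_Theory.Digraph"
begin

section \<open>The Hilbert space of square summable functions on a type\<close>

typedef 'x ell2 = "{f :: 'x \<Rightarrow> complex. (\<lambda>x. (cmod (f x))\<^sup>2) summable_on UNIV}"
  morphisms ell2_apply Abs_ell2
  by (rule exI [of _ "\<lambda>_. 0"]) simp

lemma ell2_summable: "(\<lambda>x. (cmod (ell2_apply f x))\<^sup>2) summable_on UNIV"
  using ell2_apply [of f] by simp

lemma ell2_eqI: "(\<And>x. ell2_apply f x = ell2_apply g x) \<Longrightarrow> f = g"
  by (metis ell2_apply_inject ext)

lemma ell2_abs_summable_mult:
  "(\<lambda>x. norm (cnj (ell2_apply f x) * ell2_apply g x)) summable_on UNIV"
proof -
  have s: "(\<lambda>x. (cmod (ell2_apply f x))\<^sup>2 + (cmod (ell2_apply g x))\<^sup>2) summable_on UNIV"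
    by (intro summable_on_add ell2_summable)
  have le: "norm (cnj (ell2_apply f x) * ell2_apply g x)
      \<le> (cmod (ell2_apply f x))\<^sup>2 + (cmod (ell2_apply g x))\<^sup>2" for x
  proof -
    let ?a = "cmod (ell2_apply f x)" and ?b = "cmod (ell2_apply g x)"
    have "0 \<le> ?a\<^sup>2 + ?b\<^sup>2 - ?a * ?b"
      using sum_squares_bound [of ?a ?b] mult_nonneg_nonneg [of ?a ?b, OF norm_ge_zero norm_ge_zero]
      unfolding mult.assoc by linarith
    then show ?thesis by (simp add: norm_mult)
  qed
  show ?thesis
    by (rule summable_on_comparison_test [OF s]) (use le in auto)
qed

lemma ell2_add_closed:
  "(\<lambda>x. (cmod (ell2_apply f x + ell2_apply g x))\<^sup>2) summable_on UNIV"
proof -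
  have s: "(\<lambda>x. 2 * (cmod (ell2_apply f x))\<^sup>2 + 2 * (cmod (ell2_apply g x))\<^sup>2) summable_on UNIV"
    by (intro summable_on_add summable_on_cmult_right ell2_summable)
  have le: "(cmod (ell2_apply f x + ell2_apply g x))\<^sup>2
      \<le> 2 * (cmod (ell2_apply f x))\<^sup>2 + 2 * (cmod (ell2_apply g x))\<^sup>2" for x
  proof -
    let ?a = "cmod (ell2_apply f x)" and ?b = "cmod (ell2_apply g x)"
    have "(cmod (ell2_apply f x + ell2_apply g x))\<^sup>2 \<le> (?a + ?b)\<^sup>2"
      by (intro power_mono norm_triangle_ineq) simp
    also have "\<dots> \<le> 2 * ?a\<^sup>2 + 2 * ?b\<^sup>2"
      using sum_squares_bound [of ?a ?b] by (simp add: power2_sum)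
    finally show ?thesis .
  qed
  show ?thesis
    by (rule summable_on_comparison_test [OF s]) (use le in auto)
qed

lemma ell2_scale_closed: "(\<lambda>x. (cmod (c * ell2_apply f x))\<^sup>2) summable_on UNIV"
  by (simp add: norm_mult power_mult_distrib summable_on_cmult_right ell2_summable)

definition ell2_scale :: "complex \<Rightarrow> 'x ell2 \<Rightarrow> 'x ell2" where
  "ell2_scale c f = Abs_ell2 (\<lambda>x. c * ell2_apply f x)"

lemma ell2_apply_scale [simp]: "ell2_apply (ell2_scale c f) x = c * ell2_apply f x"
  by (simp add: ell2_scale_def Abs_ell2_inverse ell2_scale_closed)

definition cinner :: "'x ell2 \<Rightarrow> 'x ell2 \<Rightarrow> complex" where
  "cinner f g = (\<Sum>\<^sub>\<infinity>x. cnj (ell2_apply f x) * ell2_apply g x)"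

instantiation ell2 :: (type) real_inner
begin

definition "0 = Abs_ell2 (\<lambda>_. 0)"
definition "f + g = Abs_ell2 (\<lambda>x. ell2_apply f x + ell2_apply g x)"
definition "- f = ell2_scale (- 1) f"
definition "f - g = f + ell2_scale (- 1) g" for f g :: "'a ell2"
definition "r *\<^sub>R f = ell2_scale (of_real r) f"
definition "inner f g = Re (cinner f g)"
definition "norm f = sqrt (inner f f)" for f :: "'a ell2"
definition "dist f g = norm (f - g)" for f g :: "'a ell2"
definition "sgn f = inverse (norm f) *\<^sub>R f" for f :: "'a ell2"
definition "uniformity = (INF e\<in>{0 <..}. principal {(f, g :: 'a ell2). dist f g < e})"
definition "open U = (\<forall>f\<in>U. eventually (\<lambda>(f', g). f' = f \<longrightarrow> g \<in> U) uniformity)"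
  for U :: "'a ell2 set"

lemma ell2_apply_zero [simp]: "ell2_apply 0 x = 0"
  by (simp add: zero_ell2_def Abs_ell2_inverse)

lemma ell2_apply_add [simp]: "ell2_apply (f + g) x = ell2_apply f x + ell2_apply g x"
  by (simp add: plus_ell2_def Abs_ell2_inverse ell2_add_closed)

lemma ell2_apply_scaleR [simp]: "ell2_apply (r *\<^sub>R f) x = r *\<^sub>R ell2_apply f x"
  unfolding scaleR_ell2_def by (simp add: scaleR_conv_of_real)

lemma ell2_apply_minus [simp]: "ell2_apply (f - g) x = ell2_apply f x - ell2_apply g x"
  by (simp add: minus_ell2_def)

lemma ell2_apply_uminus [simp]: "ell2_apply (- f) x = - ell2_apply f x"
  by (simp add: uminus_ell2_def)

lemma inner_ell2_self: "inner f f = (\<Sum>\<^sub>\<infinity>x. (cmod (ell2_apply f x))\<^sup>2)" for f :: "'a ell2"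
proof -
  have "inner f f = (\<Sum>\<^sub>\<infinity>x. Re (cnj (ell2_apply f x) * ell2_apply f x))"
    unfolding inner_ell2_def cinner_def
    by (rule infsum_Re [symmetric]) (rule abs_summable_summable [OF ell2_abs_summable_mult])
  moreover have "Re (cnj z * z) = (cmod z)\<^sup>2" for z
    by (simp add: cmod_power2 power2_eq_square [symmetric])
  ultimately show ?thesis by simp
qed

instance
proof
  fix f g h :: "'a ell2" and r s :: real
  have sm: "(\<lambda>x. cnj (ell2_apply u x) * ell2_apply v x) summable_on UNIV" for u v :: "'a ell2"
    by (rule abs_summable_summable [OF ell2_abs_summable_mult])
  show "f + g + h = f + (g + h)" "f + g = g + f" "0 + f = f" "- f + f = 0" "f - g = f + - g"
    "r *\<^sub>R (f + g) = r *\<^sub>R f + r *\<^sub>R g" "(r + s) *\<^sub>R f = r *\<^sub>R f + s *\<^sub>R f"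
    "r *\<^sub>R s *\<^sub>R f = (r * s) *\<^sub>R f" "1 *\<^sub>R f = f"
    by (rule ell2_eqI; simp add: algebra_simps)+
  show "dist f g = norm (f - g)" by (rule dist_ell2_def)
  show "sgn f = inverse (norm f) *\<^sub>R f" by (rule sgn_ell2_def)
  show "uniformity = (INF e\<in>{0 <..}. principal {(f, g :: 'a ell2). dist f g < e})"
    by (rule uniformity_ell2_def)
  show "open U = (\<forall>f\<in>U. eventually (\<lambda>(f', g). f' = f \<longrightarrow> g \<in> U) uniformity)"
    for U :: "'a ell2 set" by (rule open_ell2_def)
  show "norm f = sqrt (inner f f)" by (rule norm_ell2_def)
  have "cinner g f = cnj (cinner f g)"
    unfolding cinner_def by (simp add: infsum_cnj [symmetric] mult.commute)
  then show "inner f g = inner g f" by (simp add: inner_ell2_def)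
  have "cinner (f + g) h = cinner f h + cinner g h"
    unfolding cinner_def by (simp add: distrib_right infsum_add [OF sm sm])
  then show "inner (f + g) h = inner f h + inner g h" by (simp add: inner_ell2_def)
  have "cinner (r *\<^sub>R f) g = of_real r * cinner f g"
    unfolding cinner_def by (simp add: scaleR_conv_of_real mult.assoc infsum_cmult_right')
  then show "inner (r *\<^sub>R f) g = r * inner f g" by (simp add: inner_ell2_def)
  show "0 \<le> inner f f" unfolding inner_ell2_self by (rule infsum_nonneg) simp
  show "(inner f f = 0) = (f = 0)"
  proof
    assume "inner f f = 0"
    then have "(cmod (ell2_apply f x))\<^sup>2 = 0" for x
      by (intro nonneg_infsum_le_0D [OF _ ell2_summable]) (auto simp: inner_ell2_self)
    then show "f = 0" by (intro ell2_eqI) simp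
  qed (simp add: inner_ell2_self)
qed

end

section \<open>Concrete C*-algebras of operators\<close>

text \<open>
  A C*-algebra is given by a norm closed *-subalgebra of the bounded operators on
  some \<^typ>\<open>'x ell2\<close>. The type \<^typ>\<open>'x ell2 \<Rightarrow>\<^sub>L 'x ell2\<close> also contains operators
  that are only real-linear; those never belong to the algebras considered here.
\<close>

type_synonym 'x op = "'x ell2 \<Rightarrow>\<^sub>L 'x ell2"

lemma norm_ell2_scale: "norm (ell2_scale c f) = cmod c * norm f"
proof -
  have "inner (ell2_scale c f) (ell2_scale c f) = (cmod c)\<^sup>2 * inner f f"
    by (simp add: inner_ell2_self norm_mult power_mult_distrib infsum_cmult_right')
  then show ?thesis by (simp add: norm_ell2_def real_sqrt_mult)
qed

lemma bounded_linear_ell2_scale: "bounded_linear (ell2_scale c)"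
  by (rule bounded_linear_intro [where K = "cmod c"])
    (auto intro!: ell2_eqI simp: algebra_simps norm_ell2_scale)

definition op_scale :: "complex \<Rightarrow> 'x op \<Rightarrow> 'x op" where
  "op_scale c T = Blinfun (ell2_scale c) o\<^sub>L T"

lemma op_scale_apply [simp]: "op_scale c T f = ell2_scale c (T f)"
  by (simp add: op_scale_def bounded_linear_Blinfun_apply bounded_linear_ell2_scale)

interpretation op: vector_space "op_scale :: complex \<Rightarrow> 'x op \<Rightarrow> 'x op"
  by unfold_locales
    (auto intro!: blinfun_eqI ell2_eqI simp: blinfun.add_left algebra_simps)

text \<open>The inner product \<open>cinner\<close> is conjugate-linear in its first argument.\<close>

definition op_adj :: "'x op \<Rightarrow> 'x op" where
  "op_adj T = (THE S :: 'x op. \<forall>f g. cinner (T f) g = cinner f (S g))"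

definition op_le :: "'x op \<Rightarrow> 'x op \<Rightarrow> bool" where
  "op_le S T \<longleftrightarrow> (\<forall>f. cinner f ((T - S) f) \<in> \<real> \<and> 0 \<le> Re (cinner f ((T - S) f)))"

definition positive_part :: "'x op set \<Rightarrow> 'x op set" where
  "positive_part A = {a \<in> A. op_le 0 a}"

definition star_automorphism :: "'x op set \<Rightarrow> ('x op \<Rightarrow> 'x op) \<Rightarrow> bool" where
  "star_automorphism A \<Phi> \<longleftrightarrow> bij_betw \<Phi> A A \<and>
     (\<forall>a\<in>A. \<forall>b\<in>A. \<Phi> (a + b) = \<Phi> a + \<Phi> b \<and> \<Phi> (a o\<^sub>L b) = \<Phi> a o\<^sub>L \<Phi> b) \<and>
     (\<forall>a\<in>A. \<forall>c. \<Phi> (op_scale c a) = op_scale c (\<Phi> a)) \<and>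
     (\<forall>a\<in>A. \<Phi> (op_adj a) = op_adj (\<Phi> a))"

definition one_parameter_group :: "'x op set \<Rightarrow> (real \<Rightarrow> 'x op \<Rightarrow> 'x op) \<Rightarrow> bool" where
  "one_parameter_group A \<alpha> \<longleftrightarrow> (\<forall>t. star_automorphism A (\<alpha> t)) \<and>
     (\<forall>a\<in>A. \<alpha> 0 a = a \<and> (\<forall>s t. \<alpha> (s + t) a = \<alpha> s (\<alpha> t a)) \<and>
       continuous_on UNIV (\<lambda>t. \<alpha> t a))"

section \<open>KMS weights and states\<close>

text \<open>A weight on \<open>A\<close> is a function of which only the values on the positive part of \<open>A\<close> matter.\<close>

definition weight :: "'x op set \<Rightarrow> ('x op \<Rightarrow> ennreal) \<Rightarrow> bool" where
  "weight A \<psi> \<longleftrightarrow>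
     (\<forall>a\<in>positive_part A. \<forall>b\<in>positive_part A. \<psi> (a + b) = \<psi> a + \<psi> b) \<and>
     (\<forall>a\<in>positive_part A. \<forall>r>0. \<psi> (r *\<^sub>R a) = ennreal r * \<psi> a)"

definition proper_weight :: "'x op set \<Rightarrow> ('x op \<Rightarrow> ennreal) \<Rightarrow> bool" where
  "proper_weight A \<psi> \<longleftrightarrow> weight A \<psi> \<and>
     (\<exists>a\<in>positive_part A. \<psi> a \<noteq> 0) \<and>
     positive_part A \<subseteq> closure {a \<in> positive_part A. \<psi> a < \<infinity>} \<and>
     (\<forall>r\<ge>0. closedin (top_of_set (positive_part A)) {a \<in> positive_part A. \<psi> a \<le> ennreal r})"

definition weight_N :: "'x op set \<Rightarrow> ('x op \<Rightarrow> ennreal) \<Rightarrow> 'x op set" where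
  "weight_N A \<psi> = {a \<in> A. \<psi> (op_adj a o\<^sub>L a) < \<infinity>}"

definition weight_M :: "'x op set \<Rightarrow> ('x op \<Rightarrow> ennreal) \<Rightarrow> 'x op set" where
  "weight_M A \<psi> = op.span {op_adj a o\<^sub>L b | a b. a \<in> weight_N A \<psi> \<and> b \<in> weight_N A \<psi>}"

text \<open>The unique linear extension of \<open>\<psi>\<close>, made total by the value 0 outside its domain.\<close>

definition weight_ext :: "'x op set \<Rightarrow> ('x op \<Rightarrow> ennreal) \<Rightarrow> 'x op \<Rightarrow> complex" where
  "weight_ext A \<psi> = (THE \<Lambda>.
     (\<forall>a\<in>weight_M A \<psi>. \<forall>b\<in>weight_M A \<psi>. \<Lambda> (a + b) = \<Lambda> a + \<Lambda> b) \<and>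
     (\<forall>a\<in>weight_M A \<psi>. \<forall>c. \<Lambda> (op_scale c a) = c * \<Lambda> a) \<and>
     (\<forall>a\<in>positive_part A. \<psi> a < \<infinity> \<longrightarrow> \<Lambda> a = of_real (enn2real (\<psi> a))) \<and>
     (\<forall>a. a \<notin> weight_M A \<psi> \<longrightarrow> \<Lambda> a = 0))"

text \<open>The segment covers either sign of \<open>\<beta>\<close>; for \<open>\<beta> = 0\<close> the strip is the real line.\<close>

definition KMS_strip :: "real \<Rightarrow> complex set" where
  "KMS_strip \<beta> = {z. Im z \<in> closed_segment 0 \<beta>}"

definition KMS_weight ::
  "'x op set \<Rightarrow> (real \<Rightarrow> 'x op \<Rightarrow> 'x op) \<Rightarrow> real \<Rightarrow> ('x op \<Rightarrow> ennreal) \<Rightarrow> bool" where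
  "KMS_weight A \<alpha> \<beta> \<psi> \<longleftrightarrow> proper_weight A \<psi> \<and>
     (\<forall>t. \<forall>a\<in>positive_part A. \<psi> (\<alpha> t a) = \<psi> a) \<and>
     (\<forall>a\<in>weight_N A \<psi> \<inter> op_adj ` weight_N A \<psi>. \<forall>b\<in>weight_N A \<psi> \<inter> op_adj ` weight_N A \<psi>.
        \<exists>F. continuous_on (KMS_strip \<beta>) F \<and> bounded (F ` KMS_strip \<beta>) \<and>
          F holomorphic_on interior (KMS_strip \<beta>) \<and>
          (\<forall>t. F (of_real t) = weight_ext A \<psi> (a o\<^sub>L \<alpha> t b)) \<and>
          (\<forall>t. F (of_real t + \<i> * of_real \<beta>) = weight_ext A \<psi> (\<alpha> t b o\<^sub>L a)))"

text \<open>
  The condition \<open>a \<le> 1\<close> refers to the identity operator, so that it also makes sense for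
  an algebra without unit; if \<open>A\<close> has a unit, comparison with that unit amounts to the same.
\<close>

definition KMS_state ::
  "'x op set \<Rightarrow> (real \<Rightarrow> 'x op \<Rightarrow> 'x op) \<Rightarrow> real \<Rightarrow> ('x op \<Rightarrow> ennreal) \<Rightarrow> bool" where
  "KMS_state A \<alpha> \<beta> \<psi> \<longleftrightarrow> KMS_weight A \<alpha> \<beta> \<psi> \<and>
     (SUP a\<in>{a \<in> A. op_le 0 a \<and> op_le a id_blinfun}. \<psi> a) = 1"

text \<open>As members of this set, weights are defined on the positive part only.\<close>

definition KMS_states ::
  "'x op set \<Rightarrow> (real \<Rightarrow> 'x op \<Rightarrow> 'x op) \<Rightarrow> real \<Rightarrow> ('x op \<Rightarrow> ennreal) set" where
  "KMS_states A \<alpha> \<beta> = {\<psi> \<in> positive_part A \<rightarrow>\<^sub>E UNIV. KMS_state A \<alpha> \<beta> \<psi>}"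

section \<open>Infinite paths of a directed graph\<close>

definition row_finite :: "('v, 'e) pre_digraph \<Rightarrow> bool" where
  "row_finite G \<longleftrightarrow> (\<forall>v\<in>verts G. finite (out_arcs G v))"

definition no_sinks :: "('v, 'e) pre_digraph \<Rightarrow> bool" where
  "no_sinks G \<longleftrightarrow> (\<forall>v\<in>verts G. out_arcs G v \<noteq> {})"

definition adj_matrix :: "('v, 'e) pre_digraph \<Rightarrow> 'v \<Rightarrow> 'v \<Rightarrow> nat" where
  "adj_matrix G v w = card {e \<in> arcs G. tail G e = v \<and> head G e = w}"

text \<open>The edges of an infinite path are numbered from 0.\<close>

type_synonym 'e path = "nat \<Rightarrow> 'e"

definition inf_paths :: "('v, 'e) pre_digraph \<Rightarrow> 'e path set" where
  "inf_paths G = {p. \<forall>i. p i \<in> arcs G \<and> head G (p i) = tail G (p (Suc i))}"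

definition cylinder :: "('v, 'e) pre_digraph \<Rightarrow> 'e list \<Rightarrow> 'e path set" where
  "cylinder G es = {p \<in> inf_paths G. \<forall>i<length es. p i = es ! i}"

definition path_topology :: "('v, 'e) pre_digraph \<Rightarrow> 'e path topology" where
  "path_topology G = topology_generated_by {cylinder G es | es. es \<noteq> []}"

definition paths_from :: "('v, 'e) pre_digraph \<Rightarrow> 'v \<Rightarrow> 'e path set" where
  "paths_from G v = {p \<in> inf_paths G. tail G (p 0) = v}"

definition shift :: "'e path \<Rightarrow> 'e path" where
  "shift p = (\<lambda>i. p (Suc i))"

section \<open>The groupoid of the shift\<close>

type_synonym 'e garrow = "'e path \<times> int \<times> 'e path"

definition groupoid :: "('v, 'e) pre_digraph \<Rightarrow> 'e garrow set" where
  "groupoid G = {(p, k, q). p \<in> inf_paths G \<and> q \<in> inf_paths G \<and>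
     (\<exists>n m. k = int n - int m \<and> (shift ^^ n) p = (shift ^^ m) q)}"

fun grange :: "'e garrow \<Rightarrow> 'e path" where "grange (p, k, q) = p"
fun gsource :: "'e garrow \<Rightarrow> 'e path" where "gsource (p, k, q) = q"
fun ginv :: "'e garrow \<Rightarrow> 'e garrow" where "ginv (p, k, q) = (q, - k, p)"
fun gmult :: "'e garrow \<Rightarrow> 'e garrow \<Rightarrow> 'e garrow" where
  \<comment> \<open>meaningful only if the first arrow's source is the second one's range\<close>
  "gmult (p, k, q) (q', k', r) = (p, k + k', r)"

definition groupoid_piece :: "('v, 'e) pre_digraph \<Rightarrow> int \<Rightarrow> nat \<Rightarrow> 'e garrow set" where
  "groupoid_piece G k n = {(p, k', q). k' = k \<and> p \<in> inf_paths G \<and> q \<in> inf_paths G \<and>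
     0 \<le> k + int n \<and> (shift ^^ nat (k + int n)) p = (shift ^^ n) q}"

text \<open>
  A set is open iff its trace on each piece with parameters \<open>k\<close>, \<open>n\<close> is relatively open: for
  fixed \<open>k\<close> this is the inductive limit topology over \<open>n\<close>, and over \<open>k\<close> it is the topological
  disjoint union.
\<close>

definition groupoid_topology :: "('v, 'e) pre_digraph \<Rightarrow> 'e garrow topology" where
  "groupoid_topology G = topology (\<lambda>U. U \<subseteq> groupoid G \<and>
     (\<forall>k n. openin (subtopology
        (prod_topology (path_topology G) (prod_topology (discrete_topology UNIV) (path_topology G)))
        (groupoid_piece G k n)) (U \<inter> groupoid_piece G k n)))"

lemma openin_groupoid_topology:
  "openin (groupoid_topology G) U \<longleftrightarrow> U \<subseteq> groupoid G \<and>
     (\<forall>k n. openin (subtopology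
        (prod_topology (path_topology G) (prod_topology (discrete_topology UNIV) (path_topology G)))
        (groupoid_piece G k n)) (U \<inter> groupoid_piece G k n))"
proof -
  have *: "istopology (\<lambda>U. U \<subseteq> S \<and> (\<forall>k n. openin (X k n) (U \<inter> B k n)))"
    for S :: "'c set" and X :: "'k \<Rightarrow> 'n \<Rightarrow> 'c topology" and B
    unfolding istopology_def
  proof (rule conjI)
    show "\<forall>U V. (U \<subseteq> S \<and> (\<forall>k n. openin (X k n) (U \<inter> B k n))) \<longrightarrow>
        (V \<subseteq> S \<and> (\<forall>k n. openin (X k n) (V \<inter> B k n))) \<longrightarrow>
        U \<inter> V \<subseteq> S \<and> (\<forall>k n. openin (X k n) (U \<inter> V \<inter> B k n))"
    proof (intro allI impI conjI)
      fix U V k n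
      assume "U \<subseteq> S \<and> (\<forall>k n. openin (X k n) (U \<inter> B k n))"
        and "V \<subseteq> S \<and> (\<forall>k n. openin (X k n) (V \<inter> B k n))"
      then have "openin (X k n) ((U \<inter> B k n) \<inter> (V \<inter> B k n))" by blast
      then show "openin (X k n) (U \<inter> V \<inter> B k n)" by (simp add: Int_ac)
    qed blast
    show "\<forall>\<K>. (\<forall>K\<in>\<K>. K \<subseteq> S \<and> (\<forall>k n. openin (X k n) (K \<inter> B k n))) \<longrightarrow>
        \<Union>\<K> \<subseteq> S \<and> (\<forall>k n. openin (X k n) (\<Union>\<K> \<inter> B k n))"
    proof (intro allI impI conjI)
      fix \<K> k n
      assume "\<forall>K\<in>\<K>. K \<subseteq> S \<and> (\<forall>k n. openin (X k n) (K \<inter> B k n))"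
      then have "openin (X k n) (\<Union>((\<lambda>K. K \<inter> B k n) ` \<K>))" by blast
      moreover have "\<Union>((\<lambda>K. K \<inter> B k n) ` \<K>) = \<Union>\<K> \<inter> B k n" by blast
      ultimately show "openin (X k n) (\<Union>\<K> \<inter> B k n)" by simp
    qed blast
  qed
  show ?thesis unfolding groupoid_topology_def by (subst topology_inverse' [OF *]) (rule refl)
qed

section \<open>The reduced C*-algebra and the gauge action\<close>

text \<open>
  Functions on a topological space are represented by functions on the whole type that vanish
  outside the space.
\<close>

definition Cc :: "'x topology \<Rightarrow> ('x \<Rightarrow> complex) set" where
  "Cc X = {f. continuous_map X euclidean f \<and> (\<forall>x. x \<notin> topspace X \<longrightarrow> f x = 0) \<and>
     compactin X (X closure_of {x \<in> topspace X. f x \<noteq> 0})}"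

text \<open>
  The sum, over all units, of the regular representations on the square summable functions on
  the source fibres. Extended by 0 outside the groupoid, it acts on the square summable functions
  on the type of arrows, and the reduced norm of \<open>f\<close> is the operator norm of \<open>reg_rep G f\<close>.
  For \<open>f\<close> in \<open>Cc (groupoid_topology G)\<close> the sum is finite and the operator is bounded.
\<close>

definition reg_rep :: "('v, 'e) pre_digraph \<Rightarrow> ('e garrow \<Rightarrow> complex) \<Rightarrow> 'e garrow op" where
  "reg_rep G f = Blinfun (\<lambda>\<xi>. Abs_ell2 (\<lambda>g. if g \<in> groupoid G
     then \<Sum>\<^sub>\<infinity>h\<in>{h \<in> groupoid G. grange h = grange g}. f h * ell2_apply \<xi> (gmult (ginv h) g)
     else 0))"

definition graph_Cstar :: "('v, 'e) pre_digraph \<Rightarrow> 'e garrow op set" where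
  "graph_Cstar G = closure (reg_rep G ` Cc (groupoid_topology G))"

definition gauge_action :: "('v, 'e) pre_digraph \<Rightarrow> real \<Rightarrow> 'e garrow op \<Rightarrow> 'e garrow op" where
  "gauge_action G = (THE \<gamma>. one_parameter_group (graph_Cstar G) \<gamma> \<and>
     (\<forall>t. \<gamma> t \<in> extensional (graph_Cstar G)) \<and>
     (\<forall>t. \<forall>f\<in>Cc (groupoid_topology G).
        \<gamma> t (reg_rep G f) = reg_rep G (\<lambda>(p, k, q). exp (\<i> * of_int k * of_real t) * f (p, k, q))))"

text \<open>The inclusion of functions on the path space into functions on the groupoid.\<close>

definition unit_ext :: "('e path \<Rightarrow> complex) \<Rightarrow> 'e garrow \<Rightarrow> complex" where
  "unit_ext f = (\<lambda>(p, k, q). if k = 0 \<and> p = q then f p else 0)"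

definition vertex_proj :: "('v, 'e) pre_digraph \<Rightarrow> 'v \<Rightarrow> 'e garrow op" where
  "vertex_proj G v = reg_rep G (unit_ext (indicator (paths_from G v)))"

end

(*
  C*(G) is the closed span of the operators S_mu P_w S_nu^* for paths mu, nu ending at w, and the gauge
  action multiplies such an operator by exp(i(|mu|-|nu|)t).

  A state on C*(G) is bounded by the norm, so it extends to a bounded functional.  For a gauge
  homogeneous b of degree r, the KMS function of (a, b) is exp(irz) psi(ab), by uniqueness of bounded
  holomorphic functions on a strip; hence psi(ba) = exp(-beta r) psi(ab).  Together with gauge
  invariance this forces psi(S_mu P_w S_nu^* ) = exp(-beta |mu|) xi_w if mu = nu is a path ending at w,
  and 0 otherwise, where xi_w = psi(1_{C_w}).  So psi is determined by xi, the Cuntz-Krieger relation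
  P_v = sum_e S_e S_e^* becomes b'), and the approximate unit of sums of vertex projections yields c).

  Conversely, the formula above defines a state: it is the limit of the vector states given by
  Omega_n = sum_p sqrt(m_n(p)) delta_(p,0,p), where the discrete measures m_n give mass
  exp(-beta n) xi_w to one infinite path in each cylinder of a path of length n ending at w.  The KMS
  condition holds on the generators and passes to limits by the maximum principle on the strip.
*)
theory Submission
  imports Defs "HOL-Complex_Analysis.Conformal_Mappings" "HOL-Real_Asymp.Real_Asymp"
begin

text \<open>\<open>op_adj\<close>, \<open>weight_ext\<close> and \<open>gauge_action\<close> are
  definite descriptions, and \<open>reg_rep\<close> uses \<open>Blinfun\<close> and
  \<open>Abs_ell2\<close>, which mean something only once a bound is known. Each therefore needs
  existence and uniqueness, obtained here without spectral theory. Adjoints are carried by the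
  relation \<open>is_adj\<close>, checked on generators and passed to norm limits. For
  \<open>weight_ext\<close>, every element is factored by a Cohen-type argument, with the vertex
  projections as approximate unit, so that polarization writes it with four positive elements. For
  \<open>gauge_action\<close>, whose defining property has no continuity in the algebra variable,
  automorphisms are shown to be contractive. For \<open>reg_rep\<close>, a compactly supported
  function is cut along disjoint compact open bisections; on each of them convolution is a weighted
  partial bijection, with norm controlled by the supremum. In the converse direction no measure on
  the path space is constructed: positivity comes from the vector states, whose values on a fixed
  generator are constant from some index on.\<close>

section \<open>Inner product and completeness of the space of square summable functions\<close>

lemma ell2_summable_inner:
  "(\<lambda>x. cnj (ell2_apply f x) * ell2_apply g x) summable_on UNIV"
  by (rule abs_summable_summable [OF ell2_abs_summable_mult])

lemma cinner_has_sum: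
  "((\<lambda>x. cnj (ell2_apply f x) * ell2_apply g x) has_sum cinner f g) UNIV"
  unfolding cinner_def using ell2_summable_inner by (rule has_sum_infsum)

lemma cinner_commute: "cinner g f = cnj (cinner f g)"
  unfolding cinner_def by (simp add: infsum_cnj [symmetric] mult.commute)

lemma cinner_add_left: "cinner (f + g) h = cinner f h + cinner g h"
  unfolding cinner_def by (simp add: distrib_right infsum_add ell2_summable_inner)

lemma cinner_add_right: "cinner h (f + g) = cinner h f + cinner h g"
  unfolding cinner_def by (simp add: distrib_left infsum_add ell2_summable_inner)

lemma cinner_scale_right: "cinner f (ell2_scale c g) = c * cinner f g"
  unfolding cinner_def by (simp add: mult.left_commute infsum_cmult_right')

lemma cinner_scale_left: "cinner (ell2_scale c f) g = cnj c * cinner f g"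
  by (subst (1 2) cinner_commute) (simp add: cinner_scale_right)

lemma ell2_scaleR_eq: "r *\<^sub>R f = ell2_scale (of_real r) f"
  by (rule scaleR_ell2_def)

lemma ell2_uminus_eq: "- f = ell2_scale (- 1) f"
  by (rule uminus_ell2_def)

lemma ell2_scale_simps [simp]:
  "ell2_scale c (f + g) = ell2_scale c f + ell2_scale c g"
  "ell2_scale c (f - g) = ell2_scale c f - ell2_scale c g"
  "ell2_scale c (ell2_scale d f) = ell2_scale (c * d) f"
  "ell2_scale 1 f = f" "ell2_scale 0 f = 0" "ell2_scale c 0 = 0"
  by (auto intro!: ell2_eqI simp: algebra_simps)

lemma cinner_simps:
  "cinner (f - g) h = cinner f h - cinner g h"
  "cinner h (f - g) = cinner h f - cinner h g"
  "cinner (- f) h = - cinner f h"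
  "cinner h (- f) = - cinner h f"
  "cinner (r *\<^sub>R f) h = of_real r * cinner f h"
  "cinner h (r *\<^sub>R f) = of_real r * cinner h f"
  by (simp_all add: minus_ell2_def cinner_add_left cinner_add_right ell2_scaleR_eq ell2_uminus_eq
      cinner_scale_left cinner_scale_right)

lemma cinner_zero [simp]: "cinner 0 f = 0" "cinner f 0 = 0"
  unfolding cinner_def by simp_all

lemma cinner_self: "cinner f f = of_real ((norm f)\<^sup>2)"
proof (rule complex_eqI)
  show "Re (cinner f f) = Re (of_real ((norm f)\<^sup>2))"
    by (simp add: dot_square_norm flip: inner_ell2_def)
  have "cinner f f = cnj (cinner f f)" by (rule cinner_commute)
  then have "Im (cinner f f) = Im (cnj (cinner f f))" by (rule arg_cong)
  then show "Im (cinner f f) = Im (of_real ((norm f)\<^sup>2))" by simp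
qed

text \<open>The real Cauchy-Schwarz inequality controls only the real part. The phase
  \<open>u\<close> turns \<open>cinner f g\<close> into its absolute value and leaves the norm of
  \<open>g\<close> unchanged.\<close>

lemma norm_cinner_le: "cmod (cinner f g) \<le> norm f * norm g"
proof -
  define u where "u = (if cinner f g = 0 then 1 else cnj (sgn (cinner f g)))"
  have u: "cmod u = 1" "u * cinner f g = of_real (cmod (cinner f g))"
  proof -
    show "cmod u = 1" by (simp add: u_def norm_sgn)
    show "u * cinner f g = of_real (cmod (cinner f g))"
    proof (cases "cinner f g = 0")
      case False
      have "cnj z * z = of_real ((cmod z)\<^sup>2)" for z :: complex
        by (metis complex_norm_square mult.commute)
      then show ?thesis using False
        by (simp add: u_def sgn_div_norm scaleR_conv_of_real power2_eq_square field_simps)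
    qed simp
  qed
  have "cmod (cinner f g) = Re (cinner f (ell2_scale u g))"
    by (simp add: cinner_scale_right u)
  also have "\<dots> \<le> norm f * norm (ell2_scale u g)"
    using norm_cauchy_schwarz by (simp flip: inner_ell2_def)
  finally show ?thesis by (simp add: norm_ell2_scale u)
qed

lemma cinner_ext: "(\<And>f. cinner f g = cinner f h) \<Longrightarrow> g = h"
proof -
  assume "\<And>f. cinner f g = cinner f h"
  then have "cinner (g - h) (g - h) = 0" by (simp add: cinner_simps)
  then show "g = h" by (simp add: cinner_self)
qed

lemma norm_ell2_sum_le: "finite F \<Longrightarrow> (\<Sum>x\<in>F. (cmod (ell2_apply f x))\<^sup>2) \<le> (norm f)\<^sup>2"
  using finite_sum_le_infsum [OF ell2_summable [of f], of F]
  by (simp add: inner_ell2_self flip: dot_square_norm)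

lemma norm_ell2_apply_le: "cmod (ell2_apply f x) \<le> norm f"
  using norm_ell2_sum_le [of "{x}" f] by (simp add: power2_le_iff_abs_le)

text \<open>Bounds on finite partial sums give membership in \<open>ell2\<close> and the norm
  estimate at once. Completeness, the operators \<open>comp_op\<close> and the vectors
  \<open>\<Omega> n\<close> all rest on this.\<close>

lemma ell2_boundedI:
  assumes "\<And>F. finite F \<Longrightarrow> (\<Sum>x\<in>F. (cmod (h x))\<^sup>2) \<le> C\<^sup>2" "C \<ge> 0"
  shows "ell2_apply (Abs_ell2 h) = h" "norm (Abs_ell2 h) \<le> C"
proof -
  have s: "(\<lambda>x. (cmod (h x))\<^sup>2) summable_on UNIV"
    by (rule nonneg_bounded_partial_sums_imp_summable_on [where C = "C\<^sup>2"])
       (use assms in \<open>auto simp: eventually_finite_subsets_at_top_weakI\<close>)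
  then show a: "ell2_apply (Abs_ell2 h) = h" by (simp add: Abs_ell2_inverse)
  have "(norm (Abs_ell2 h))\<^sup>2 = (\<Sum>\<^sub>\<infinity>x. (cmod (h x))\<^sup>2)"
    by (simp add: inner_ell2_self a flip: dot_square_norm)
  also have "\<dots> \<le> C\<^sup>2" by (rule infsum_le_finite_sums [OF s]) (use assms in auto)
  finally show "norm (Abs_ell2 h) \<le> C" using assms(2) by (simp add: power2_le_iff_abs_le)
qed

instance ell2 :: (type) banach
proof
  fix X :: "nat \<Rightarrow> 'a ell2"
  assume X: "Cauchy X"
  have "Cauchy (\<lambda>n. ell2_apply (X n) x)" for x
  proof (rule CauchyI)
    fix e :: real assume "e > 0"
    then obtain M where M: "\<And>m n. m \<ge> M \<Longrightarrow> n \<ge> M \<Longrightarrow> norm (X m - X n) < e"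
      using CauchyD [OF X] by blast
    have "norm (ell2_apply (X m) x - ell2_apply (X n) x) < e" if "m \<ge> M" "n \<ge> M" for m n
      using norm_ell2_apply_le [of "X m - X n" x] M [OF that] by simp
    then show "\<exists>M. \<forall>m\<ge>M. \<forall>n\<ge>M. norm (ell2_apply (X m) x - ell2_apply (X n) x) < e" by blast
  qed
  then have "\<exists>l. (\<lambda>n. ell2_apply (X n) x) \<longlonglongrightarrow> l" for x
    using Cauchy_convergent_iff convergent_def by blast
  then obtain h where h: "\<And>x. (\<lambda>n. ell2_apply (X n) x) \<longlonglongrightarrow> h x" by metis
  \<comment> \<open>Over a finite set the Cauchy estimate passes to the limit in the second index,
    although nothing is known yet about \<open>h\<close> as a whole.\<close>
  have part: "(\<Sum>x\<in>F. (cmod (ell2_apply (X n) x - h x))\<^sup>2) \<le> e\<^sup>2"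
    if M: "\<And>m. m \<ge> n \<Longrightarrow> norm (X n - X m) < e" and "finite F" for F n e
  proof (rule Lim_bounded [where M = n])
    show "(\<lambda>m. \<Sum>x\<in>F. (cmod (ell2_apply (X n) x - ell2_apply (X m) x))\<^sup>2)
        \<longlonglongrightarrow> (\<Sum>x\<in>F. (cmod (ell2_apply (X n) x - h x))\<^sup>2)"
      by (intro tendsto_intros h)
    show "\<forall>m\<ge>n. (\<Sum>x\<in>F. (cmod (ell2_apply (X n) x - ell2_apply (X m) x))\<^sup>2) \<le> e\<^sup>2"
    proof (intro allI impI)
      fix m assume "m \<ge> n"
      have "(\<Sum>x\<in>F. (cmod (ell2_apply (X n) x - ell2_apply (X m) x))\<^sup>2) \<le> (norm (X n - X m))\<^sup>2"
        using norm_ell2_sum_le [OF \<open>finite F\<close>, of "X n - X m"] by simp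
      also have "\<dots> \<le> e\<^sup>2" by (intro power_mono) (use M [OF \<open>m \<ge> n\<close>] in auto)
      finally show "(\<Sum>x\<in>F. (cmod (ell2_apply (X n) x - ell2_apply (X m) x))\<^sup>2) \<le> e\<^sup>2" .
    qed
  qed
  have conv: "\<exists>N. \<forall>n\<ge>N. \<exists>D. ell2_apply D = (\<lambda>x. ell2_apply (X n) x - h x) \<and> norm D \<le> e"
    if e: "e > 0" for e
  proof -
    obtain N where N: "\<And>m n. m \<ge> N \<Longrightarrow> n \<ge> N \<Longrightarrow> norm (X m - X n) < e"
      using CauchyD [OF X e] by blast
    show ?thesis
    proof (intro exI allI impI)
      fix n assume "n \<ge> N"
      have "\<And>F. finite F \<Longrightarrow> (\<Sum>x\<in>F. (cmod (ell2_apply (X n) x - h x))\<^sup>2) \<le> e\<^sup>2"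
        by (rule part) (use N \<open>n \<ge> N\<close> in auto)
      note * = ell2_boundedI [OF this less_imp_le [OF e]]
      show "ell2_apply (Abs_ell2 (\<lambda>x. ell2_apply (X n) x - h x)) = (\<lambda>x. ell2_apply (X n) x - h x)
          \<and> norm (Abs_ell2 (\<lambda>x. ell2_apply (X n) x - h x)) \<le> e" using * by blast
    qed
  qed
  \<comment> \<open>Only the differences \<open>X n - h\<close> are known to be square summable so
    far; subtracting one of them from \<open>X n0\<close> exhibits \<open>h\<close> as an element of
    the space.\<close>
  obtain n0 D0 where D0: "ell2_apply D0 = (\<lambda>x. ell2_apply (X n0) x - h x)"
    using conv [of 1] by auto
  define L where "L = X n0 - D0"
  have L: "ell2_apply L x = h x" for x by (simp add: L_def D0)
  have "X \<longlonglongrightarrow> L"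
  proof (rule LIMSEQ_I)
    fix r :: real assume "r > 0"
    then obtain N where N: "\<And>n. n \<ge> N \<Longrightarrow> \<exists>D. ell2_apply D = (\<lambda>x. ell2_apply (X n) x - h x) \<and> norm D \<le> r / 2"
      using conv [of "r / 2"] by auto
    have "norm (X n - L) < r" if n: "n \<ge> N" for n
    proof -
      obtain D where D: "ell2_apply D = (\<lambda>x. ell2_apply (X n) x - h x)" "norm D \<le> r / 2"
        using N [OF n] by blast
      have "X n - L = D" by (rule ell2_eqI) (simp add: D L)
      then show ?thesis using D \<open>r > 0\<close> by simp
    qed
    then show "\<exists>N. \<forall>n\<ge>N. norm (X n - L) < r" by blast
  qed
  then show "convergent X" by (rule convergentI)
qed

section \<open>Adjoints\<close>

text \<open>The description \<open>op_adj\<close> is of no use for an operator without adjoint, and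
  bounded operators that are only real-linear have none. The relation carries existence with it, so
  that it can be established on generators and inherited by sums, products and limits.\<close>

definition is_adj :: "'x op \<Rightarrow> 'x op \<Rightarrow> bool" where
  "is_adj T S \<longleftrightarrow> (\<forall>f g. cinner (T f) g = cinner f (S g))"

lemma is_adjD: "is_adj T S \<Longrightarrow> cinner (T f) g = cinner f (S g)"
  by (simp add: is_adj_def)

lemma is_adj_unique: "is_adj T S \<Longrightarrow> is_adj T S' \<Longrightarrow> S = S'"
  by (rule blinfun_eqI, rule cinner_ext) (simp add: is_adj_def)

lemma op_adj_eq: "is_adj T S \<Longrightarrow> op_adj T = S"
  unfolding op_adj_def is_adj_def [symmetric] by (rule the_equality) (auto intro: is_adj_unique)

lemma is_adj_sym: "is_adj T S \<Longrightarrow> is_adj S T"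
  unfolding is_adj_def by (metis cinner_commute)

text \<open>An adjoint forces complex linearity, because \<open>cinner\<close> is complex-linear in
  its second argument.\<close>

lemma is_adj_scale: "is_adj T S \<Longrightarrow> T (ell2_scale c f) = ell2_scale c (T f)"
proof (rule cinner_ext)
  fix h assume "is_adj T S"
  then have "cinner h (T g) = cinner (S h) g" for g using is_adj_sym is_adjD by metis
  then show "cinner h (T (ell2_scale c f)) = cinner h (ell2_scale c (T f))"
    by (simp add: cinner_scale_right)
qed

lemma is_adj_simps:
  "is_adj 0 0"
  "is_adj T S \<Longrightarrow> is_adj T' S' \<Longrightarrow> is_adj (T + T') (S + S')"
  "is_adj T S \<Longrightarrow> is_adj T' S' \<Longrightarrow> is_adj (T - T') (S - S')"
  "is_adj T S \<Longrightarrow> is_adj T' S' \<Longrightarrow> is_adj (T o\<^sub>L T') (S' o\<^sub>L S)"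
  "is_adj T S \<Longrightarrow> is_adj (op_scale c T) (op_scale (cnj c) S)"
  "is_adj T S \<Longrightarrow> is_adj (r *\<^sub>R T) (r *\<^sub>R S)"
  "is_adj id_blinfun id_blinfun"
  by (simp_all add: is_adj_def blinfun.add_left blinfun.diff_left blinfun.scaleR_left
      cinner_add_left cinner_add_right cinner_simps cinner_scale_left cinner_scale_right)

text \<open>The square of \<open>norm (S g)\<close> equals \<open>cinner (T (S g)) g\<close>;
  Cauchy-Schwarz then allows one factor \<open>norm (S g)\<close> to be cancelled.\<close>

lemma is_adj_norm_le:
  assumes "is_adj T S" shows "norm S \<le> norm T"
proof (rule norm_blinfun_bound)
  fix g
  have "of_real ((norm (S g))\<^sup>2) = cinner (T (S g)) g"
    using assms by (simp only: is_adjD cinner_self)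
  then have "(norm (S g))\<^sup>2 = cmod (cinner (T (S g)) g)"
    by (metis norm_of_real abs_power2)
  also have "\<dots> \<le> norm (T (S g)) * norm g" by (rule norm_cinner_le)
  also have "\<dots> \<le> (norm T * norm (S g)) * norm g"
    by (intro mult_right_mono norm_blinfun) simp
  finally have "norm (S g) * norm (S g) \<le> norm (S g) * (norm T * norm g)"
    by (simp add: power2_eq_square algebra_simps)
  then show "norm (S g) \<le> norm T * norm g"
    by (cases "norm (S g) = 0") (auto simp: mult_le_cancel_left)
qed simp

lemma is_adj_norm: "is_adj T S \<Longrightarrow> norm S = norm T"
  by (intro antisym is_adj_norm_le) (auto intro: is_adj_sym)

lemma tendsto_cinner:
  fixes f g :: "'a \<Rightarrow> 'b ell2"
  assumes "(f \<longlongrightarrow> a) F" "(g \<longlongrightarrow> b) F"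
  shows "((\<lambda>x. cinner (f x) (g x)) \<longlongrightarrow> cinner a b) F"
proof -
  interpret bounded_bilinear "cinner :: 'b ell2 \<Rightarrow> 'b ell2 \<Rightarrow> complex"
    by standard (auto simp: cinner_add_left cinner_add_right cinner_simps scaleR_conv_of_real
        intro!: exI [of _ 1] norm_cinner_le)
  show ?thesis by (rule tendsto [OF assms])
qed

text \<open>Passing to adjoints is isometric, so the adjoints of a convergent sequence are Cauchy,
  and continuity of the inner product identifies their limit.\<close>

lemma is_adj_limit:
  assumes T: "X \<longlonglongrightarrow> T" and adj: "\<And>n. is_adj (X n) (Y n)"
  obtains S where "Y \<longlonglongrightarrow> S" "is_adj T S"
proof -
  have "Cauchy Y"
  proof (rule CauchyI)
    fix e :: real assume "e > 0"
    then obtain M where M: "\<And>m n. m \<ge> M \<Longrightarrow> n \<ge> M \<Longrightarrow> norm (X m - X n) < e"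
      using CauchyD LIMSEQ_imp_Cauchy [OF T] by blast
    have "norm (Y m - Y n) = norm (X m - X n)" for m n
      by (rule is_adj_norm) (intro is_adj_simps adj)
    then show "\<exists>M. \<forall>m\<ge>M. \<forall>n\<ge>M. norm (Y m - Y n) < e" using M by metis
  qed
  then obtain S where S: "Y \<longlonglongrightarrow> S" using Cauchy_convergent_iff convergent_def by blast
  have "cinner (T f) g = cinner f (S g)" for f g
  proof (rule LIMSEQ_unique)
    show "(\<lambda>n. cinner (X n f) g) \<longlonglongrightarrow> cinner (T f) g"
      by (intro tendsto_cinner blinfun.tendsto T tendsto_const)
    show "(\<lambda>n. cinner (X n f) g) \<longlonglongrightarrow> cinner f (S g)"
      unfolding is_adjD [OF adj] by (intro tendsto_cinner blinfun.tendsto S tendsto_const)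
  qed
  then show ?thesis using S that by (simp add: is_adj_def)
qed

lemma op_scale_of_real: "op_scale (of_real r) T = r *\<^sub>R T"
  by (rule blinfun_eqI) (simp add: blinfun.scaleR_left ell2_scaleR_eq)

lemma op_scale_compose_left: "op_scale c T o\<^sub>L S = op_scale c (T o\<^sub>L S)"
  by (rule blinfun_eqI) simp

lemma op_scale_compose_right: "is_adj T T' \<Longrightarrow> T o\<^sub>L op_scale c S = op_scale c (T o\<^sub>L S)"
  by (rule blinfun_eqI) (simp add: is_adj_scale)

lemma blinfun_compose_simps:
  "(a + b) o\<^sub>L c = (a o\<^sub>L c) + (b o\<^sub>L c)" "c o\<^sub>L (a + b) = (c o\<^sub>L a) + (c o\<^sub>L b)"
  "(a - b) o\<^sub>L c = (a o\<^sub>L c) - (b o\<^sub>L c)" "c o\<^sub>L (a - b) = (c o\<^sub>L a) - (c o\<^sub>L b)"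
  by (rule blinfun_eqI; simp add: blinfun.add_left blinfun.add_right blinfun.diff_left blinfun.diff_right)+

lemma is_adj_sum: "(\<And>i. i \<in> I \<Longrightarrow> is_adj (T i) (S i)) \<Longrightarrow> is_adj (sum T I) (sum S I)"
  by (induction I rule: infinite_finite_induct) (auto intro: is_adj_simps)

section \<open>Positive operators and closed subalgebras with adjoints\<close>

lemma op_le_0_iff: "op_le 0 T \<longleftrightarrow> (\<forall>f. cinner f (T f) \<in> \<real> \<and> 0 \<le> Re (cinner f (T f)))"
  by (simp add: op_le_def)

lemma op_le_0_adj: "is_adj b b' \<Longrightarrow> op_le 0 (b' o\<^sub>L b)"
  unfolding op_le_0_iff by (simp add: cinner_self flip: is_adjD)

lemma op_le_0_simps:
  "op_le 0 a \<Longrightarrow> op_le 0 b \<Longrightarrow> op_le 0 (a + b)"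
  "op_le 0 a \<Longrightarrow> 0 \<le> r \<Longrightarrow> op_le 0 (r *\<^sub>R a)"
  "op_le 0 0"
  by (auto simp: op_le_0_iff blinfun.add_left blinfun.scaleR_left cinner_add_right cinner_simps
      simp flip: of_real_mult)

lemma op_le_norm:
  assumes "op_le 0 a" "norm a \<le> 1" shows "op_le a id_blinfun"
  unfolding op_le_def
proof (intro allI conjI)
  fix f
  have r: "cinner f (a f) \<in> \<real>" "0 \<le> Re (cinner f (a f))" using assms by (auto simp: op_le_0_iff)
  then have c: "cinner f (a f) = of_real (Re (cinner f (a f)))" by simp
  have "Re (cinner f (a f)) \<le> cmod (cinner f (a f))" by (rule complex_Re_le_cmod)
  also have "\<dots> \<le> norm f * norm (a f)" by (rule norm_cinner_le)
  also have "\<dots> \<le> norm f * (norm a * norm f)" by (intro mult_left_mono norm_blinfun) simp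
  also have "\<dots> \<le> norm f * (1 * norm f)" by (intro mult_left_mono mult_right_mono assms) auto
  finally show "0 \<le> Re (cinner f ((id_blinfun - a) f))"
    by (simp add: blinfun.diff_left cinner_simps cinner_self power2_eq_square)
  show "cinner f ((id_blinfun - a) f) \<in> \<real>"
    using r by (simp add: blinfun.diff_left cinner_simps cinner_self)
qed

text \<open>Complex polarization: the form at \<open>f + g\<close> gives the sum of the two mixed
  terms, at \<open>f + ell2_scale \<i> g\<close> a multiple of their difference. Complex linearity
  of \<open>h\<close>, supplied by \<open>is_adj\<close>, is essential, since an antilinear operator
  can have zero form.\<close>

lemma quadratic_form_zero:
  assumes h: "is_adj h h'" and z: "\<And>f. cinner f (h f) = 0"
  shows "h = 0"
proof (rule blinfun_eqI, rule cinner_ext)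
  fix f g
  have "cinner (f + g) (h (f + g)) = 0" "cinner (f + ell2_scale \<i> g) (h (f + ell2_scale \<i> g)) = 0"
    by (rule z)+
  then have "cinner f (h g) + cinner g (h f) = 0"
    and "\<i> * cinner f (h g) - \<i> * cinner g (h f) = 0"
    by (simp_all add: blinfun.add_right is_adj_scale [OF h] cinner_add_left cinner_add_right
        cinner_scale_left cinner_scale_right z)
  then have "cinner f (h g) = 0" by (simp add: add_eq_0_iff2)
  then show "cinner f (h g) = cinner f ((0::'a op) g)" by simp
qed

text \<open>The assumption \<open>is_adj\<close> makes the description \<open>op_adj\<close>
  meaningful on \<open>A\<close> and, through \<open>is_adj_scale\<close>, makes every member
  complex-linear.\<close>

locale cstar_subalgebra =
  fixes A :: "'x op set"
  assumes closed: "closed A" and zero: "0 \<in> A"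
    and add: "a \<in> A \<Longrightarrow> b \<in> A \<Longrightarrow> a + b \<in> A"
    and scale: "a \<in> A \<Longrightarrow> op_scale c a \<in> A"
    and mult: "a \<in> A \<Longrightarrow> b \<in> A \<Longrightarrow> a o\<^sub>L b \<in> A"
    and is_adj: "a \<in> A \<Longrightarrow> is_adj a (op_adj a)"
    and adj: "a \<in> A \<Longrightarrow> op_adj a \<in> A"
begin

lemma scaleR: "a \<in> A \<Longrightarrow> r *\<^sub>R a \<in> A"
  using scale by (simp flip: op_scale_of_real)

lemma diff: "a \<in> A \<Longrightarrow> b \<in> A \<Longrightarrow> a - b \<in> A"
  using add [of a "- 1 *\<^sub>R b"] scaleR [of b "- 1"] by simp

lemma sum: "(\<And>i. i \<in> I \<Longrightarrow> T i \<in> A) \<Longrightarrow> sum T I \<in> A"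
  by (induction I rule: infinite_finite_induct) (auto intro: add zero)

lemma limit: "(\<And>n. X n \<in> A) \<Longrightarrow> X \<longlonglongrightarrow> T \<Longrightarrow> T \<in> A"
  using closed closed_sequentially by blast

lemma adj_simps:
  "a \<in> A \<Longrightarrow> b \<in> A \<Longrightarrow> op_adj (a + b) = op_adj a + op_adj b"
  "a \<in> A \<Longrightarrow> b \<in> A \<Longrightarrow> op_adj (a - b) = op_adj a - op_adj b"
  "a \<in> A \<Longrightarrow> b \<in> A \<Longrightarrow> op_adj (a o\<^sub>L b) = op_adj b o\<^sub>L op_adj a"
  "a \<in> A \<Longrightarrow> op_adj (op_scale c a) = op_scale (cnj c) (op_adj a)"
  "a \<in> A \<Longrightarrow> op_adj (op_adj a) = a"
  "a \<in> A \<Longrightarrow> op_adj (r *\<^sub>R a) = r *\<^sub>R op_adj a"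
  "a \<in> A \<Longrightarrow> norm (op_adj a) = norm a"
  by (auto intro!: op_adj_eq is_adj_simps is_adj_norm intro: is_adj is_adj_sym)

lemma compose_scale: "a \<in> A \<Longrightarrow> a o\<^sub>L op_scale c b = op_scale c (a o\<^sub>L b)"
  by (rule op_scale_compose_right) (rule is_adj)

lemma positive_partI: "a \<in> A \<Longrightarrow> op_adj a o\<^sub>L a \<in> positive_part A"
  unfolding positive_part_def by (auto intro: op_le_0_adj is_adj mult adj)

lemma positive_part_simps:
  "a \<in> positive_part A \<Longrightarrow> b \<in> positive_part A \<Longrightarrow> a + b \<in> positive_part A"
  "a \<in> positive_part A \<Longrightarrow> 0 \<le> r \<Longrightarrow> r *\<^sub>R a \<in> positive_part A"
  "0 \<in> positive_part A"
  unfolding positive_part_def by (auto intro: op_le_0_simps add scaleR zero)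

lemma positive_part_in: "a \<in> positive_part A \<Longrightarrow> a \<in> A"
  by (simp add: positive_part_def)

text \<open>With \<open>X\<close> and \<open>Y\<close> as in the proof, the first difference is
  \<open>2 X + 2 Y\<close> and \<i> times the second is \<open>2 X - 2 Y\<close>. The right-hand
  side has the shape required by \<open>dec\<close>: four positive elements, two of them entering
  with factor \<i>.\<close>

lemma polarization:
  assumes "b \<in> A" "c \<in> A"
  defines "q \<equiv> \<lambda>u. op_adj (b + op_scale u c) o\<^sub>L (b + op_scale u c)"
  shows "op_adj b o\<^sub>L c = (1/4) *\<^sub>R ((q 1 - q (- 1)) + op_scale \<i> (q (- \<i>) - q \<i>))"
proof -
  define X where "X = op_adj b o\<^sub>L c"
  define Y where "Y = op_adj c o\<^sub>L b"
  define Z where "Z = (op_adj b o\<^sub>L b) + (op_adj c o\<^sub>L c)"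
  have q: "q u = Z + op_scale u X + op_scale (cnj u) Y" if "cnj u * u = 1" for u
  proof -
    have "q u = (op_adj b o\<^sub>L b) + op_scale u X + op_scale (cnj u) Y
        + op_scale (cnj u) (op_scale u (op_adj c o\<^sub>L c))"
      using assms by (simp add: q_def X_def Y_def adj_simps scale blinfun_compose_simps
          compose_scale op_scale_compose_left adj algebra_simps)
    then show ?thesis using that by (simp add: Z_def)
  qed
  have "(1/4) *\<^sub>R ((q 1 - q (- 1)) + op_scale \<i> (q (- \<i>) - q \<i>)) = X"
    by (rule blinfun_eqI, rule ell2_eqI)
      (simp add: q blinfun.add_left blinfun.diff_left blinfun.scaleR_left algebra_simps scaleR_conv_of_real)
  then show ?thesis by (simp add: X_def)
qed

end

section \<open>Bounded weights\<close>

locale finite_weight = cstar_subalgebra +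
  fixes \<psi> :: "'a op \<Rightarrow> ennreal"
  assumes weight: "weight A \<psi>" and finite: "a \<in> positive_part A \<Longrightarrow> \<psi> a < \<infinity>"
begin

definition val :: "'a op \<Rightarrow> real" where "val a = enn2real (\<psi> a)"

lemma val_add: "a \<in> positive_part A \<Longrightarrow> b \<in> positive_part A \<Longrightarrow> val (a + b) = val a + val b"
  using weight finite by (auto simp: val_def weight_def enn2real_plus)

lemma val_zero: "val 0 = 0"
  using val_add [of 0 0] positive_part_simps(3) by simp

lemma val_scaleR: "a \<in> positive_part A \<Longrightarrow> 0 \<le> r \<Longrightarrow> val (r *\<^sub>R a) = r * val a"
  using weight by (cases "r = 0") (auto simp: val_def weight_def enn2real_mult val_zero [unfolded val_def])

lemma val_nonneg: "0 \<le> val a"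
  by (simp add: val_def)

lemma ennreal_val: "a \<in> positive_part A \<Longrightarrow> \<psi> a = ennreal (val a)"
  using finite [of a] by (simp add: val_def)

text \<open>The value of the linear extension is first introduced as a relation. That every element
  has such a decomposition is proved only later, by factorization, since splitting a selfadjoint
  element into positive and negative part would call for functional calculus.\<close>

definition dec :: "'a op \<Rightarrow> complex \<Rightarrow> bool" where
  "dec a z \<longleftrightarrow> (\<exists>x1\<in>positive_part A. \<exists>x2\<in>positive_part A. \<exists>x3\<in>positive_part A. \<exists>x4\<in>positive_part A.
     a = (x1 - x2) + op_scale \<i> (x3 - x4) \<and>
     z = of_real (val x1 - val x2) + \<i> * of_real (val x3 - val x4))"

text \<open>Comparing two decompositions gives \<open>h = op_scale \<i> k\<close>, where
  \<open>h\<close> and \<open>k\<close> are combinations of positive elements and so have real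
  quadratic forms. Both forms vanish, hence \<open>h\<close> and \<open>k\<close> do, and the claim
  becomes additivity of \<open>val\<close>.\<close>

lemma dec_unique:
  assumes "dec a z" "dec a z'" shows "z = z'"
proof -
  obtain x1 x2 x3 x4 where x: "x1\<in>positive_part A" "x2\<in>positive_part A" "x3\<in>positive_part A"
    "x4\<in>positive_part A" "a = (x1 - x2) + op_scale \<i> (x3 - x4)"
    "z = of_real (val x1 - val x2) + \<i> * of_real (val x3 - val x4)"
    using assms(1) unfolding dec_def by blast
  obtain y1 y2 y3 y4 where y: "y1\<in>positive_part A" "y2\<in>positive_part A" "y3\<in>positive_part A"
    "y4\<in>positive_part A" "a = (y1 - y2) + op_scale \<i> (y3 - y4)"
    "z' = of_real (val y1 - val y2) + \<i> * of_real (val y3 - val y4)"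
    using assms(2) unfolding dec_def by blast
  have im: "Im (cinner f (b f)) = 0" if "b \<in> positive_part A" for b f
    using that unfolding positive_part_def op_le_0_iff by (auto simp: complex_is_Real_iff)
  define h where "h = (x1 + y2) - (y1 + x2)"
  define k where "k = (y3 + x4) - (x3 + y4)"
  have hk: "h = op_scale \<i> k"
  proof -
    have "h - op_scale \<i> k = (x1 - x2) + op_scale \<i> (x3 - x4) - ((y1 - y2) + op_scale \<i> (y3 - y4))"
      by (rule blinfun_eqI) (simp add: h_def k_def blinfun.add_left blinfun.diff_left algebra_simps)
    then show ?thesis using x(5) y(5) by simp
  qed
  have inA: "h \<in> A" "k \<in> A"
    unfolding h_def k_def by (intro diff add positive_part_in x y)+
  have "cinner f (h f) = 0 \<and> cinner f (k f) = 0" for f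
  proof -
    have "Im (cinner f (h f)) = 0" "Im (cinner f (k f)) = 0"
      unfolding h_def k_def
      by (simp_all add: blinfun.add_left blinfun.diff_left cinner_add_right cinner_simps im x y)
    moreover have "cinner f (h f) = \<i> * cinner f (k f)" by (simp add: hk cinner_scale_right)
    ultimately show ?thesis by (auto simp: complex_eq_iff)
  qed
  then have "h = 0" "k = 0" using quadratic_form_zero is_adj inA by metis+
  then have "x1 + y2 = y1 + x2" "y3 + x4 = x3 + y4" by (auto simp: h_def k_def)
  then have "val x1 + val y2 = val y1 + val x2" "val y3 + val x4 = val x3 + val y4"
    using x y val_add by metis+
  then show ?thesis
    unfolding x(6) y(6) by (auto simp: complex_eq_iff)
qed

lemma dec_pos: "a \<in> positive_part A \<Longrightarrow> dec a (of_real (val a))"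
  unfolding dec_def
  by (rule bexI [of _ a], rule bexI [of _ 0], rule bexI [of _ 0], rule bexI [of _ 0])
    (auto simp: val_zero positive_part_simps)

lemma dec_add: assumes "dec a z" "dec b w" shows "dec (a + b) (z + w)"
proof -
  obtain x1 x2 x3 x4 where x: "x1\<in>positive_part A" "x2\<in>positive_part A" "x3\<in>positive_part A"
    "x4\<in>positive_part A" "a = (x1 - x2) + op_scale \<i> (x3 - x4)"
    "z = of_real (val x1 - val x2) + \<i> * of_real (val x3 - val x4)"
    using assms(1) unfolding dec_def by blast
  obtain y1 y2 y3 y4 where y: "y1\<in>positive_part A" "y2\<in>positive_part A" "y3\<in>positive_part A"
    "y4\<in>positive_part A" "b = (y1 - y2) + op_scale \<i> (y3 - y4)"
    "w = of_real (val y1 - val y2) + \<i> * of_real (val y3 - val y4)"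
    using assms(2) unfolding dec_def by blast
  show ?thesis unfolding dec_def
    by (rule bexI [of _ "x1 + y1"], rule bexI [of _ "x2 + y2"], rule bexI [of _ "x3 + y3"],
        rule bexI [of _ "x4 + y4"], rule conjI)
      (auto simp: x y val_add positive_part_simps algebra_simps op.scale_right_distrib op.scale_right_diff_distrib)
qed

lemma dec_scaleR: assumes "dec a z" "0 \<le> r" shows "dec (r *\<^sub>R a) (of_real r * z)"
proof -
  obtain x1 x2 x3 x4 where x: "x1\<in>positive_part A" "x2\<in>positive_part A" "x3\<in>positive_part A"
    "x4\<in>positive_part A" "a = (x1 - x2) + op_scale \<i> (x3 - x4)"
    "z = of_real (val x1 - val x2) + \<i> * of_real (val x3 - val x4)"
    using assms(1) unfolding dec_def by blast
  have "r *\<^sub>R a = (r *\<^sub>R x1 - r *\<^sub>R x2) + op_scale \<i> (r *\<^sub>R x3 - r *\<^sub>R x4)"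
    unfolding x(5) by (rule blinfun_eqI, rule ell2_eqI)
      (simp add: blinfun.add_left blinfun.diff_left blinfun.scaleR_left algebra_simps scaleR_conv_of_real)
  then show ?thesis unfolding dec_def
    by (intro bexI [of _ "r *\<^sub>R x1"] bexI [of _ "r *\<^sub>R x2"] bexI [of _ "r *\<^sub>R x3"]
        bexI [of _ "r *\<^sub>R x4"] conjI)
      (auto simp: x assms(2) val_scaleR positive_part_simps algebra_simps)
qed

lemma dec_uminus: assumes "dec a z" shows "dec (- a) (- z)"
proof -
  obtain x1 x2 x3 x4 where x: "x1\<in>positive_part A" "x2\<in>positive_part A" "x3\<in>positive_part A"
    "x4\<in>positive_part A" "a = (x1 - x2) + op_scale \<i> (x3 - x4)"
    "z = of_real (val x1 - val x2) + \<i> * of_real (val x3 - val x4)"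
    using assms(1) unfolding dec_def by blast
  have "- a = (x2 - x1) + op_scale \<i> (x4 - x3)"
    unfolding x(5) by (simp add: op.scale_right_diff_distrib)
  then show ?thesis unfolding dec_def
    by (intro bexI [of _ x1] bexI [of _ x2] bexI [of _ x3] bexI [of _ x4] conjI)
      (auto simp: x algebra_simps)
qed

lemma dec_i: assumes "dec a z" shows "dec (op_scale \<i> a) (\<i> * z)"
proof -
  obtain x1 x2 x3 x4 where x: "x1\<in>positive_part A" "x2\<in>positive_part A" "x3\<in>positive_part A"
    "x4\<in>positive_part A" "a = (x1 - x2) + op_scale \<i> (x3 - x4)"
    "z = of_real (val x1 - val x2) + \<i> * of_real (val x3 - val x4)"
    using assms(1) unfolding dec_def by blast
  have "op_scale \<i> a = (x4 - x3) + op_scale \<i> (x1 - x2)"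
    unfolding x(5) by (rule blinfun_eqI, rule ell2_eqI)
      (simp add: blinfun.add_left blinfun.diff_left algebra_simps)
  then show ?thesis unfolding dec_def
    by (intro bexI [of _ x1] bexI [of _ x2] bexI [of _ x3] bexI [of _ x4] conjI)
      (auto simp: x algebra_simps)
qed

lemma dec_scaleR': assumes "dec a z" shows "dec (r *\<^sub>R a) (of_real r * z)"
proof (cases "0 \<le> r")
  case False
  then show ?thesis using dec_uminus [OF dec_scaleR [OF assms, of "- r"]] by simp
qed (use dec_scaleR [OF assms] in auto)

lemma dec_scale: assumes "dec a z" shows "dec (op_scale c a) (c * z)"
proof -
  have "op_scale c a = Re c *\<^sub>R a + op_scale \<i> (Im c *\<^sub>R a)"
    by (rule blinfun_eqI, rule ell2_eqI)
      (simp add: blinfun.add_left blinfun.scaleR_left scaleR_conv_of_real complex_eq_iff algebra_simps)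
  moreover have "c * z = of_real (Re c) * z + \<i> * (of_real (Im c) * z)"
    by (simp add: complex_eq_iff)
  ultimately show ?thesis
    using dec_add [OF dec_scaleR' dec_i [OF dec_scaleR']] assms by metis
qed

definition ext :: "'a op \<Rightarrow> complex" where "ext a = (THE z. dec a z)"

lemma ext_eq: "dec a z \<Longrightarrow> ext a = z"
  unfolding ext_def by (rule the_equality) (auto intro: dec_unique)

lemma ext_pos: "a \<in> positive_part A \<Longrightarrow> ext a = of_real (val a)"
  by (rule ext_eq) (rule dec_pos)

lemma dec_adj_mult: "b \<in> A \<Longrightarrow> c \<in> A \<Longrightarrow> \<exists>z. dec (op_adj b o\<^sub>L c) z"
proof -
  assume bc: "b \<in> A" "c \<in> A"
  define q where "q = (\<lambda>u. op_adj (b + op_scale u c) o\<^sub>L (b + op_scale u c))"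
  have q: "dec (q u) (of_real (val (q u)))" for u
    unfolding q_def by (intro dec_pos positive_partI add scale bc)
  have "op_adj b o\<^sub>L c = (1/4) *\<^sub>R ((q 1 + - q (- 1)) + op_scale \<i> (q (- \<i>) + - q \<i>))"
    using polarization [OF bc] by (simp add: q_def)
  moreover have "\<exists>z. dec ((1/4) *\<^sub>R ((q 1 + - q (- 1)) + op_scale \<i> (q (- \<i>) + - q \<i>))) z"
    by (intro exI) (rule dec_scaleR' dec_add dec_i dec_uminus q)+
  ultimately show ?thesis by metis
qed

end

lemmas compose_sum_left = bounded_bilinear.sum_left [OF bounded_bilinear_blinfun_compose]
lemmas compose_sum_right = bounded_bilinear.sum_right [OF bounded_bilinear_blinfun_compose]
lemmas tendsto_compose_op = bounded_bilinear.tendsto [OF bounded_bilinear_blinfun_compose]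

lemma compose_assoc: "(a o\<^sub>L b) o\<^sub>L c = a o\<^sub>L (b o\<^sub>L c)"
  by (rule blinfun_eqI) simp

section \<open>Approximate units of projections\<close>

text \<open>In the application \<open>P\<close> gives the vertex projections and \<open>D\<close> is
  the linear span of the generators, on which finite sums of projections are not merely approximate
  but exact left units.\<close>

locale approx_unit = cstar_subalgebra +
  fixes P :: "'i \<Rightarrow> 'a op" and V :: "'i set" and D :: "'a op set"
  assumes P_in: "v \<in> V \<Longrightarrow> P v \<in> A"
    and P_adj: "v \<in> V \<Longrightarrow> is_adj (P v) (P v)"
    and P_mult: "v \<in> V \<Longrightarrow> w \<in> V \<Longrightarrow> P v o\<^sub>L P w = (if v = w then P v else 0)"
    and dense: "A \<subseteq> closure D"
    and approx_dense: "a \<in> D \<Longrightarrow> \<exists>F. finite F \<and> F \<subseteq> V \<and>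
      (\<forall>F'. finite F' \<longrightarrow> F \<subseteq> F' \<longrightarrow> F' \<subseteq> V \<longrightarrow> sum P F' o\<^sub>L a = a)"
begin

lemma proj_in: "F \<subseteq> V \<Longrightarrow> sum P F \<in> A"
  using P_in by (intro sum) auto

lemma proj_adj: "F \<subseteq> V \<Longrightarrow> is_adj (sum P F) (sum P F)"
  using P_adj by (intro is_adj_sum) auto

lemma proj_mult:
  assumes "finite F" "finite F'" "F \<subseteq> V" "F' \<subseteq> V"
  shows "sum P F o\<^sub>L sum P F' = sum P (F \<inter> F')"
proof -
  have "sum P F o\<^sub>L sum P F' = (\<Sum>v\<in>F. \<Sum>w\<in>F'. if v = w then P v else 0)"
    unfolding compose_sum_left unfolding compose_sum_right
    by (intro sum.cong refl P_mult) (use assms in auto)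
  also have "\<dots> = (\<Sum>v\<in>F. if v \<in> F' then P v else 0)"
    using assms by (simp add: sum.delta)
  also have "\<dots> = sum P (F \<inter> F')"
    using assms by (simp add: sum.inter_restrict)
  finally show ?thesis .
qed

lemma proj_norm:
  assumes "finite F" "F \<subseteq> V" shows "norm (sum P F) \<le> 1"
proof (rule norm_blinfun_bound)
  fix f
  let ?p = "sum P F"
  have "cinner (?p f) (?p f) = cinner f ((?p o\<^sub>L ?p) f)"
    by (simp add: is_adjD [OF proj_adj [OF assms(2)]])
  also have "\<dots> = cinner f (?p f)" by (simp add: proj_mult assms)
  finally have "of_real ((norm (?p f))\<^sup>2) = cinner f (?p f)" by (simp only: cinner_self)
  then have "(norm (?p f))\<^sup>2 = cmod (cinner f (?p f))" by (metis norm_of_real abs_power2)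
  also have "\<dots> \<le> norm f * norm (?p f)" by (rule norm_cinner_le)
  finally have "norm (?p f) * norm (?p f) \<le> norm f * norm (?p f)" by (simp add: power2_eq_square)
  then show "norm (?p f) \<le> 1 * norm f"
    by (cases "norm (?p f) = 0") (auto simp: mult_le_cancel_right)
qed simp

lemma proj_pos: assumes "finite F" "F \<subseteq> V" shows "sum P F \<in> positive_part A"
  using positive_partI [OF proj_in [OF assms(2)]] op_adj_eq [OF proj_adj [OF assms(2)]] assms
  by (simp add: proj_mult)

text \<open>On \<open>D\<close> the projections act exactly, and they are contractions, so the error
  for \<open>a\<close> is at most twice its distance to some \<open>d\<close> in
  \<open>D\<close>.\<close>

lemma proj_approx:
  assumes "a \<in> A" "e > 0"
  shows "\<exists>F. finite F \<and> F \<subseteq> V \<and>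
    (\<forall>F'. finite F' \<longrightarrow> F \<subseteq> F' \<longrightarrow> F' \<subseteq> V \<longrightarrow> norm (a - (sum P F' o\<^sub>L a)) < e)"
proof -
  have "a \<in> closure D" using dense assms by blast
  then obtain d where d: "d \<in> D" "dist d a < e / 2"
    using assms(2) closure_approachable half_gt_zero by blast
  obtain F where F: "finite F" "F \<subseteq> V"
    "\<And>F'. finite F' \<Longrightarrow> F \<subseteq> F' \<Longrightarrow> F' \<subseteq> V \<Longrightarrow> sum P F' o\<^sub>L d = d"
    using approx_dense [OF d(1)] by blast
  show ?thesis
  proof (intro exI conjI allI impI)
    fix F' assume F': "finite F'" "F \<subseteq> F'" "F' \<subseteq> V"
    have "a - (sum P F' o\<^sub>L a) = (a - d) + (sum P F' o\<^sub>L (d - a))"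
      by (simp add: blinfun_compose_simps F(3) [OF F'])
    also have "norm \<dots> \<le> norm (a - d) + norm (sum P F' o\<^sub>L (d - a))" by (rule norm_triangle_ineq)
    also have "norm (sum P F' o\<^sub>L (d - a)) \<le> norm (sum P F') * norm (d - a)" by (rule norm_blinfun_compose)
    also have "\<dots> \<le> 1 * norm (d - a)" by (intro mult_right_mono proj_norm F') simp
    finally show "norm (a - (sum P F' o\<^sub>L a)) < e" using d(2) by (simp add: dist_norm norm_minus_commute)
  qed (use F in auto)
qed

text \<open>
  With finite sets growing so fast that \<open>\<parallel>a - p\<^sub>k a\<parallel> \<le> 4\<^sup>-\<^sup>k\<close>, and \<open>d\<^sub>k = p\<^sub>k - p\<^sub>k\<^sub>-\<^sub>1\<close>, the factors are
  \<open>h = \<Sum> 2\<^sup>-\<^sup>k d\<^sub>k\<close> and \<open>c = \<Sum> 2\<^sup>k d\<^sub>k a\<close>.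
\<close>

lemma factorization:
  assumes a: "a \<in> A"
  obtains h c where "h \<in> A" "c \<in> A" "a = h o\<^sub>L c"
proof -
  define good where "good = (\<lambda>k F. finite F \<and> F \<subseteq> V \<and>
    (\<forall>F'. finite F' \<longrightarrow> F \<subseteq> F' \<longrightarrow> F' \<subseteq> V \<longrightarrow> norm (a - (sum P F' o\<^sub>L a)) < (1/4) ^ k))"
  have "\<exists>F. good k F" for k unfolding good_def by (rule proj_approx [OF a]) simp
  then obtain F where F: "\<And>k. good k (F k)" by metis
  \<comment> \<open>The union over \<open>j < k\<close> makes the sets increase and start from the
    empty set; the error bound with index \<open>k\<close> is therefore available at
    \<open>E (Suc k)\<close>.\<close>
  define E where "E = (\<lambda>k. \<Union>j<k. F j)"
  have E: "finite (E k)" "E k \<subseteq> V" for k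
    using F by (auto simp: E_def good_def)
  have E_mono: "E k \<subseteq> E (Suc k)" for k by (auto simp: E_def less_Suc_eq)
  have E_mono': "E j \<subseteq> E k" if "j \<le> k" for j k
    unfolding E_def by (rule UN_mono) (use that in auto)
  have E_norm: "norm (a - (sum P (E (Suc k)) o\<^sub>L a)) < (1/4) ^ k" for k
  proof -
    have "F k \<subseteq> E (Suc k)" by (auto simp: E_def)
    then show ?thesis using F [of k] E [of "Suc k"] unfolding good_def by blast
  qed
  define B where "B = (\<lambda>k. E (Suc k) - E k)"
  have B: "finite (B k)" "B k \<subseteq> V" for k using E by (auto simp: B_def)
  have B_disj: "B j \<inter> B k = {}" if "j \<noteq> k" for j k
    using that E_mono' [of "Suc j" k] E_mono' [of "Suc k" j] by (fastforce simp: B_def nat_neq_iff Suc_le_eq)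
  define p where "p = (\<lambda>k. sum P (B k))"
  have p_in: "p k \<in> A" for k unfolding p_def by (rule proj_in [OF B(2)])
  have p_norm: "norm (p k) \<le> 1" for k unfolding p_def by (rule proj_norm [OF B])
  have p_mult: "p j o\<^sub>L p k = (if j = k then p j else 0)" for j k
    unfolding p_def using proj_mult [OF B(1) B(1) B(2) B(2)] B_disj by auto
  have p_sum: "(\<Sum>k<K. p k) = sum P (E K)" for K
  proof (induction K)
    case 0 then show ?case by (simp add: E_def)
  next
    case (Suc K)
    have "sum P (E (Suc K)) = sum P (B K) + sum P (E K)"
      unfolding B_def by (rule sum.subset_diff [OF E_mono E(1)])
    then show ?case using Suc by (simp add: p_def add.commute)
  qed
  define hs where "hs = (\<lambda>k. (1/2::real) ^ k *\<^sub>R p k)"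
  define cs where "cs = (\<lambda>k. (2::real) ^ k *\<^sub>R (p k o\<^sub>L a))"
  have hsum: "summable hs"
  proof (rule summable_comparison_test')
    show "summable (\<lambda>k. (1/2::real) ^ k)" by (rule summable_geometric) simp
    show "norm (hs n) \<le> (1/2) ^ n" for n
      using p_norm [of n] by (simp add: hs_def mult_left_le)
  qed
  have csum: "summable cs"
  proof (rule summable_comparison_test')
    show "summable (\<lambda>k. 4 * (1/2::real) ^ k)" by (intro summable_mult summable_geometric) simp
    \<comment> \<open>The index 0 is left out because the block \<open>p n\<close> annihilates what
      \<open>E n\<close> has already captured, and the error there is
      \<open>(1/4) ^ (n - 1)\<close>. Together with the weight \<open>2 ^ n\<close> this is
      \<open>4 * (1/2) ^ n\<close>.\<close>
    show "norm (cs n) \<le> 4 * (1/2) ^ n" if n1: "n \<ge> 1" for n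
    proof -
      obtain m where m: "n = Suc m" using n1 by (cases n) auto
      have "p n o\<^sub>L sum P (E n) = 0"
        unfolding p_def using proj_mult [OF B(1) E(1) B(2) E(2)] by (simp add: B_def Int_commute [of "_ - _"])
      then have "p n o\<^sub>L (sum P (E n) o\<^sub>L a) = 0" by (simp flip: compose_assoc)
      then have "p n o\<^sub>L a = p n o\<^sub>L (a - (sum P (E n) o\<^sub>L a))" by (simp add: blinfun_compose_simps)
      also have "norm \<dots> \<le> norm (p n) * norm (a - (sum P (E n) o\<^sub>L a))" by (rule norm_blinfun_compose)
      also have "\<dots> \<le> 1 * (1/4) ^ m"
        using E_norm [of m] by (intro mult_mono p_norm) (auto simp: m)
      finally have "norm (p n o\<^sub>L a) \<le> (1/4) ^ m" by simp
      then have "norm (cs n) \<le> 2 ^ n * (1/4) ^ m" by (simp add: cs_def)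
      also have "\<dots> = 4 * (1/2) ^ n"
      proof -
        have "(4::real) ^ m = 2 ^ m * 2 ^ m" by (simp flip: power_mult_distrib)
        then show ?thesis by (simp add: m power_divide field_simps)
      qed
      finally show ?thesis .
    qed
  qed
  obtain h where h: "(\<lambda>K. \<Sum>k<K. hs k) \<longlonglongrightarrow> h" using hsum by (auto simp: summable_def sums_def)
  obtain c where c: "(\<lambda>K. \<Sum>k<K. cs k) \<longlonglongrightarrow> c" using csum by (auto simp: summable_def sums_def)
  have hin: "h \<in> A" by (rule limit [OF _ h]) (intro sum, auto simp: hs_def intro: scaleR p_in)
  have cin: "c \<in> A" by (rule limit [OF _ c]) (intro sum, auto simp: cs_def intro: scaleR p_in mult a)
  have part: "(\<Sum>k<K. hs k) o\<^sub>L (\<Sum>k<K. cs k) = sum P (E K) o\<^sub>L a" for K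
  proof -
    \<comment> \<open>Distinct blocks are orthogonal and on the diagonal the weights cancel, so the
      product of the partial sums telescopes to \<open>sum P (E K)\<close> times
      \<open>a\<close>.\<close>
    have "hs j o\<^sub>L cs k = (if j = k then p j o\<^sub>L a else 0)" for j k
    proof -
      have "hs j o\<^sub>L cs k = ((1/2) ^ j * 2 ^ k) *\<^sub>R ((p j o\<^sub>L p k) o\<^sub>L a)"
        by (rule blinfun_eqI) (simp add: hs_def cs_def blinfun.scaleR_left blinfun.scaleR_right)
      moreover have "(1/2) ^ k * 2 ^ k = (1::real)" by (simp flip: power_mult_distrib)
      ultimately show ?thesis by (auto simp: p_mult)
    qed
    then have "(\<Sum>k<K. hs k) o\<^sub>L (\<Sum>k<K. cs k) = (\<Sum>j<K. \<Sum>k<K. if j = k then p j o\<^sub>L a else 0)"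
      unfolding compose_sum_left compose_sum_right by simp
    also have "\<dots> = (\<Sum>j<K. p j) o\<^sub>L a" by (simp add: compose_sum_left)
    finally show ?thesis by (simp add: p_sum)
  qed
  have "(\<lambda>K. sum P (E K) o\<^sub>L a) \<longlonglongrightarrow> (h o\<^sub>L c)"
    using tendsto_compose_op [OF h c] by (simp add: part)
  moreover have "(\<lambda>K. sum P (E (Suc K)) o\<^sub>L a) \<longlonglongrightarrow> a"
  proof (rule LIM_zero_cancel, rule Lim_null_comparison)
    show "\<forall>\<^sub>F K in sequentially. norm ((sum P (E (Suc K)) o\<^sub>L a) - a) \<le> (1/4) ^ K"
      using E_norm by (intro always_eventually allI) (simp add: norm_minus_commute less_imp_le)
  qed (simp add: LIMSEQ_power_zero)
  ultimately have "a = h o\<^sub>L c" using LIMSEQ_unique LIMSEQ_Suc by blast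
  then show ?thesis using that hin cin by blast
qed

end

section \<open>The linear extension of a finite weight\<close>

locale finite_weight_approx = finite_weight A \<psi> + approx_unit A P V D
  for A :: "'a op set" and \<psi> and P :: "'i \<Rightarrow> 'a op" and V D
begin

text \<open>Factorization turns an arbitrary element into a product of an adjoint with an element,
  and to such products polarization applies.\<close>

lemma dec_ex: "a \<in> A \<Longrightarrow> \<exists>z. dec a z"
proof -
  assume "a \<in> A"
  then obtain h c where "h \<in> A" "c \<in> A" "a = h o\<^sub>L c" by (rule factorization)
  then show ?thesis using dec_adj_mult [of "op_adj h" c] by (simp add: adj adj_simps)
qed

lemma dec_ext: "a \<in> A \<Longrightarrow> dec a (ext a)"
  using dec_ex ext_eq by metis

lemma ext_add: "a \<in> A \<Longrightarrow> b \<in> A \<Longrightarrow> ext (a + b) = ext a + ext b"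
  by (intro ext_eq dec_add dec_ext)

lemma ext_scale: "a \<in> A \<Longrightarrow> ext (op_scale c a) = c * ext a"
  by (intro ext_eq dec_scale dec_ext)

lemma ext_diff: "a \<in> A \<Longrightarrow> b \<in> A \<Longrightarrow> ext (a - b) = ext a - ext b"
  using ext_add [of a "op_scale (- 1) b"] ext_scale [of b "- 1"] scale [of b "- 1"] by simp

lemma weight_N_eq: "weight_N A \<psi> = A"
  unfolding weight_N_def using finite positive_partI by auto

lemma weight_N_adj: "weight_N A \<psi> \<inter> op_adj ` weight_N A \<psi> = A"
  unfolding weight_N_eq by (auto simp: image_iff intro: adj adj_simps(5) [symmetric])

lemma weight_M_eq: "weight_M A \<psi> = A"
proof
  show "weight_M A \<psi> \<subseteq> A" unfolding weight_M_def weight_N_eq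
    by (rule op.span_minimal) (auto intro: mult adj op.subspaceI zero add scale)
  show "A \<subseteq> weight_M A \<psi>"
  proof
    fix a assume "a \<in> A"
    then obtain h c where "h \<in> A" "c \<in> A" "a = h o\<^sub>L c" by (rule factorization)
    then have "a = op_adj (op_adj h) o\<^sub>L c" "op_adj h \<in> A" "c \<in> A" by (auto simp: adj_simps adj)
    then show "a \<in> weight_M A \<psi>" unfolding weight_M_def weight_N_eq by (blast intro: op.span_base)
  qed
qed

text \<open>Additivity, homogeneity and the values on positive elements determine a functional
  through the decompositions in \<open>dec\<close>, so the description in \<open>weight_ext\<close>
  has exactly one solution. The statement is open in \<open>L\<close> so that it serves both for
  \<open>ext\<close> and for a functional constructed independently.\<close>

lemma weight_ext_eqI:
  assumes L_add: "\<And>a b. a \<in> A \<Longrightarrow> b \<in> A \<Longrightarrow> L (a + b) = L a + L b"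
    and L_scale: "\<And>a c. a \<in> A \<Longrightarrow> L (op_scale c a) = c * L a"
    and L_pos: "\<And>a. a \<in> positive_part A \<Longrightarrow> L a = of_real (val a)"
    and "a \<in> A"
  shows "weight_ext A \<psi> a = L a"
proof -
  have eq: "K a = ext a" if K_add: "\<And>a b. a \<in> A \<Longrightarrow> b \<in> A \<Longrightarrow> K (a + b) = K a + K b"
    and K_scale: "\<And>a c. a \<in> A \<Longrightarrow> K (op_scale c a) = c * K a"
    and K_pos: "\<And>a. a \<in> positive_part A \<Longrightarrow> K a = of_real (val a)" and "a \<in> A" for K a
  proof -
    obtain x1 x2 x3 x4 where x: "x1\<in>positive_part A" "x2\<in>positive_part A" "x3\<in>positive_part A"
      "x4\<in>positive_part A" "a = (x1 - x2) + op_scale \<i> (x3 - x4)"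
      "ext a = of_real (val x1 - val x2) + \<i> * of_real (val x3 - val x4)"
      using dec_ext [OF \<open>a \<in> A\<close>] unfolding dec_def by blast
    note xA = x(1-4) [THEN positive_part_in]
    have K_diff: "K (y - z) = K y - K z" if "y \<in> A" "z \<in> A" for y z
      using K_add [of y "op_scale (- 1) z"] K_scale [of z "- 1"] scale [of z "- 1"] that by simp
    show ?thesis unfolding x(6)
      by (simp add: x(5) K_add K_scale K_diff K_pos x(1-4) xA diff scale)
  qed
  have "weight_ext A \<psi> = (\<lambda>a. if a \<in> A then ext a else 0)"
    unfolding weight_ext_def weight_M_eq
  proof (rule the_equality, goal_cases)
    case 1
    then show ?case
      using positive_part_in by (auto simp: add scale ext_add ext_scale ext_pos val_def)
  next
    case (2 K)
    then have "K a = ext a" if "a \<in> A" for a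
      by (intro eq that) (use finite in \<open>auto simp: val_def\<close>)
    then show ?case using 2 by auto
  qed
  then show ?thesis using eq [of L, OF L_add L_scale L_pos \<open>a \<in> A\<close>] \<open>a \<in> A\<close> by simp
qed

lemma weight_ext_eq: "a \<in> A \<Longrightarrow> weight_ext A \<psi> a = ext a"
  by (rule weight_ext_eqI) (auto intro: ext_add ext_scale ext_pos)

end

locale contractive_weight = finite_weight_approx +
  assumes contractive: "a \<in> positive_part A \<Longrightarrow> val a \<le> norm a"
begin

text \<open>For norms at most 1, positivity at \<open>b - op_scale u c\<close>, with
  \<open>u\<close> the phase that makes \<open>u * z\<close> equal to \<open>cmod z\<close>, gives
  \<open>2 * cmod z \<le> 2\<close>. Rescaling both factors yields the general case.\<close>

lemma ext_adj_mult_le: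
  assumes "b \<in> A" "c \<in> A"
  shows "cmod (ext (op_adj b o\<^sub>L c)) \<le> norm b * norm c"
proof -
  have unit: "cmod (ext (op_adj b o\<^sub>L c)) \<le> 1"
    if bc: "b \<in> A" "c \<in> A" "norm b \<le> 1" "norm c \<le> 1" for b c
  proof -
    define z where "z = ext (op_adj b o\<^sub>L c)"
    define u where "u = (if z = 0 then 1 else cnj (sgn z))"
    have u: "cnj u * u = 1" "u * z = of_real (cmod z)"
    proof -
      have c: "cnj w * w = of_real ((cmod w)\<^sup>2)" for w
        by (metis complex_norm_square mult.commute)
      show "cnj u * u = 1" by (simp add: u_def c norm_sgn)
      show "u * z = of_real (cmod z)"
        using c [of z] by (auto simp: u_def sgn_div_norm scaleR_conv_of_real power2_eq_square field_simps)
    qed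
    define d where "d = b - op_scale u c"
    have dA: "d \<in> A" unfolding d_def by (intro diff scale bc)
    note memb = bc(1,2) scale mult adj diff add
    define z' where "z' = ext (op_adj c o\<^sub>L b)"
    have "op_adj d o\<^sub>L d = ((op_adj b o\<^sub>L b) + (op_adj c o\<^sub>L c))
        - (op_scale u (op_adj b o\<^sub>L c) + op_scale (cnj u) (op_adj c o\<^sub>L b))"
      using u by (simp add: d_def memb adj_simps blinfun_compose_simps compose_scale
          op_scale_compose_left algebra_simps)
    then have e: "ext (op_adj d o\<^sub>L d) = ext (op_adj b o\<^sub>L b) + ext (op_adj c o\<^sub>L c) - (u * z + cnj u * z')"
      by (simp add: memb ext_add ext_diff ext_scale z_def z'_def)
    \<comment> \<open>Hermitian symmetry of \<open>ext\<close> is not at hand. That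
      \<open>ext\<close> is real at this second square supplies the part of it that is needed,
      namely \<open>Re (cnj u * z') = cmod z\<close>.\<close>
    define d2 where "d2 = b + op_scale (\<i> * u) c"
    have d2A: "d2 \<in> A" unfolding d2_def by (intro add scale bc)
    have "op_adj d2 o\<^sub>L d2 = ((op_adj b o\<^sub>L b) + (op_adj c o\<^sub>L c))
        + (op_scale (\<i> * u) (op_adj b o\<^sub>L c) + op_scale (cnj (\<i> * u)) (op_adj c o\<^sub>L b))"
      using u by (simp add: d2_def memb adj_simps blinfun_compose_simps compose_scale
          op_scale_compose_left algebra_simps)
    then have e2: "ext (op_adj d2 o\<^sub>L d2) = ext (op_adj b o\<^sub>L b) + ext (op_adj c o\<^sub>L c)
        + (\<i> * u * z + cnj (\<i> * u) * z')"
      by (simp add: memb ext_add ext_diff ext_scale z_def z'_def)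
    have real: "Im (ext (op_adj x o\<^sub>L x)) = 0" "0 \<le> Re (ext (op_adj x o\<^sub>L x))"
      "Re (ext (op_adj x o\<^sub>L x)) \<le> (norm x)\<^sup>2" if "x \<in> A" for x
    proof -
      note p = positive_partI [OF that]
      show "Im (ext (op_adj x o\<^sub>L x)) = 0" "0 \<le> Re (ext (op_adj x o\<^sub>L x))"
        by (simp_all add: ext_pos [OF p] val_nonneg)
      have "Re (ext (op_adj x o\<^sub>L x)) \<le> norm (op_adj x o\<^sub>L x)"
        using contractive [OF p] by (simp add: ext_pos [OF p])
      also have "\<dots> \<le> norm (op_adj x) * norm x" by (rule norm_blinfun_compose)
      finally show "Re (ext (op_adj x o\<^sub>L x)) \<le> (norm x)\<^sup>2"
        using that by (simp add: adj_simps power2_eq_square)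
    qed
    have "Re (cnj u * z') = cmod z"
    proof -
      have "Im (ext (op_adj d2 o\<^sub>L d2)) = 0" by (rule real [OF d2A])
      then have "Im (\<i> * (u * z) - \<i> * (cnj u * z')) = 0"
        unfolding e2 using real(1) [OF bc(1)] real(1) [OF bc(2)] by (simp add: algebra_simps)
      then show ?thesis using u by (simp add: algebra_simps)
    qed
    then have "0 \<le> Re (ext (op_adj b o\<^sub>L b)) + Re (ext (op_adj c o\<^sub>L c)) - 2 * cmod z"
      using real(2) [OF dA] unfolding e u by simp
    moreover have "(norm b)\<^sup>2 \<le> 1" "(norm c)\<^sup>2 \<le> 1" using bc by (simp_all add: power_le_one)
    ultimately show ?thesis using real(3) [OF bc(1)] real(3) [OF bc(2)] unfolding z_def by linarith
  qed
  show ?thesis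
  proof (cases "b = 0 \<or> c = 0")
    case True
    have "op_adj (0::'a op) = 0" by (rule op_adj_eq) (rule is_adj_simps)
    with True have "op_adj b o\<^sub>L c = 0" by auto
    then show ?thesis using ext_scale [OF zero, of 0] by simp
  next
    case False
    define b' where "b' = inverse (norm b) *\<^sub>R b"
    define c' where "c' = inverse (norm c) *\<^sub>R c"
    have "op_adj b' o\<^sub>L c' = op_scale (of_real (inverse (norm b) * inverse (norm c))) (op_adj b o\<^sub>L c)"
      unfolding b'_def c'_def op_scale_of_real
      by (rule blinfun_eqI) (simp add: adj_simps assms blinfun.scaleR_left blinfun.scaleR_right)
    then have "ext (op_adj b' o\<^sub>L c') = of_real (inverse (norm b) * inverse (norm c)) * ext (op_adj b o\<^sub>L c)"
      by (simp add: ext_scale assms mult adj)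
    moreover have "cmod (ext (op_adj b' o\<^sub>L c')) \<le> 1"
      by (rule unit) (use False assms in \<open>auto simp: b'_def c'_def intro: scaleR\<close>)
    ultimately have "cmod (of_real (inverse (norm b) * inverse (norm c)) * ext (op_adj b o\<^sub>L c)) \<le> 1"
      by simp
    then have "inverse (norm b) * inverse (norm c) * cmod (ext (op_adj b o\<^sub>L c)) \<le> 1"
      by (simp only: norm_mult norm_of_real abs_mult abs_inverse abs_norm_cancel)
    then show ?thesis using False by (simp add: field_simps)
  qed
qed

text \<open>With a finite sum \<open>p\<close> of projections that nearly fixes the left factor
  \<open>h\<close> of \<open>a\<close>, the element is the sum of \<open>p o\<^sub>L a\<close> and
  \<open>(h - (p o\<^sub>L h)) o\<^sub>L c\<close>. The first is a product with a contraction, which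
  yields the constant 1; the second is arbitrarily small.\<close>

lemma ext_norm_le: assumes "a \<in> A" shows "cmod (ext a) \<le> norm a"
proof (rule field_le_epsilon)
  fix e :: real assume "e > 0"
  obtain h c where hc: "h \<in> A" "c \<in> A" "a = h o\<^sub>L c" by (rule factorization [OF assms])
  define e' where "e' = e / (norm c + 1)"
  have e': "e' > 0" "e' * norm c \<le> e"
    using \<open>e > 0\<close> by (auto simp: e'_def field_simps add_pos_nonneg)
  obtain F where F: "finite F" "F \<subseteq> V" "norm (h - (sum P F o\<^sub>L h)) < e'"
    using proj_approx [OF hc(1) e'(1)] by blast
  let ?p = "sum P F"
  have p: "?p \<in> A" "op_adj ?p = ?p" using F by (auto intro: proj_in op_adj_eq proj_adj)
  let ?h = "h - (?p o\<^sub>L h)"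
  have hA: "?h \<in> A" by (intro diff mult p hc)
  have "a = (op_adj ?p o\<^sub>L a) + (op_adj (op_adj ?h) o\<^sub>L c)"
    using hA by (simp add: adj_simps p hc blinfun_compose_simps compose_assoc)
  then have "ext a = ext (op_adj ?p o\<^sub>L a) + ext (op_adj (op_adj ?h) o\<^sub>L c)"
    using assms hA p hc by (metis ext_add mult adj)
  then have "cmod (ext a) \<le> cmod (ext (op_adj ?p o\<^sub>L a)) + cmod (ext (op_adj (op_adj ?h) o\<^sub>L c))"
    by (simp add: norm_triangle_ineq)
  also have "\<dots> \<le> norm ?p * norm a + norm (op_adj ?h) * norm c"
    by (intro add_mono ext_adj_mult_le p assms hc adj hA)
  also have "\<dots> \<le> 1 * norm a + e' * norm c"
    using F proj_norm [OF F(1,2)] hA by (intro add_mono mult_right_mono) (auto simp: adj_simps)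
  finally show "cmod (ext a) \<le> norm a + e" using e' by simp
qed

end

section \<open>Automatic continuity of automorphisms\<close>

context cstar_subalgebra
begin

text \<open>
  If \<open>\<parallel>a\<parallel> < 1\<close> then \<open>1 - a\<^sup>* a = (1 - d)\<^sup>2\<close> for a selfadjoint \<open>d\<close> in the algebra, obtained as the
  fixed point of \<open>d \<mapsto> (a\<^sup>* a + d\<^sup>2) / 2\<close>; so \<open>1 - \<Phi>(a)\<^sup>* \<Phi>(a) = (1 - \<Phi>(d))\<^sup>2 \<ge> 0\<close>.
\<close>

lemma quasi_sqrt:
  assumes a: "a \<in> A" "norm a < 1"
  obtains d where "d \<in> A" "op_adj d = d" "2 *\<^sub>R d = (op_adj a o\<^sub>L a) + (d o\<^sub>L d)"
proof -
  define x where "x = op_adj a o\<^sub>L a"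
  have x: "x \<in> A" "op_adj x = x"
    using adj_simps(3) [OF adj [OF a(1)] a(1)] adj_simps(5) [OF a(1)]
    by (simp_all add: x_def mult adj a)
  define s where "s = (norm a)\<^sup>2"
  have s: "0 \<le> s" "s < 1" using a by (auto simp: s_def power_less_one_iff abs_square_less_1)
  have xs: "norm x \<le> s"
    using norm_blinfun_compose [of "op_adj a" a] a by (simp add: x_def s_def adj_simps power2_eq_square)
  \<comment> \<open>The smaller root of \<open>s + r * r = 2 * r\<close>: the ball of radius
    \<open>r\<close> is mapped into itself, and \<open>r < 1\<close> is also the contraction
    constant on it.\<close>
  define r where "r = 1 - sqrt (1 - s)"
  have r: "0 \<le> r" "r < 1" "s + r * r = 2 * r"
    using s by (auto simp: r_def algebra_simps)
  define S where "S = {d \<in> A. op_adj d = d \<and> norm d \<le> r}"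
  have "complete S"
  proof -
    have "closed S" unfolding closed_sequential_limits
    proof (intro allI impI)
      fix X l assume "(\<forall>n. X n \<in> S) \<and> X \<longlonglongrightarrow> l"
      then have X: "\<And>n. X n \<in> A" "\<And>n. op_adj (X n) = X n" "\<And>n. norm (X n) \<le> r" "X \<longlonglongrightarrow> l"
        by (auto simp: S_def)
      have adjX: "\<And>n. is_adj (X n) (X n)" using X is_adj by metis
      obtain l' where "X \<longlonglongrightarrow> l'" "is_adj l l'" by (rule is_adj_limit [OF X(4) adjX])
      then have "is_adj l l" using X(4) LIMSEQ_unique by metis
      moreover have "norm l \<le> r" using X(3) by (intro Lim_bounded [OF tendsto_norm [OF X(4)]]) auto
      moreover have "l \<in> A" by (rule limit [OF X(1) X(4)])
      ultimately show "l \<in> S" by (auto simp: S_def intro: op_adj_eq)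
    qed
    then show ?thesis by (simp add: complete_eq_closed)
  qed
  moreover have "S \<noteq> {}"
  proof -
    have "op_adj (0::'a op) = 0" by (rule op_adj_eq) (rule is_adj_simps)
    then have "0 \<in> S" using r zero by (auto simp: S_def)
    then show ?thesis by blast
  qed
  moreover have "(\<lambda>d. (1/2) *\<^sub>R (x + (d o\<^sub>L d))) ` S \<subseteq> S"
  proof
    fix y assume "y \<in> (\<lambda>d. (1/2) *\<^sub>R (x + (d o\<^sub>L d))) ` S"
    then obtain d where d: "d \<in> A" "op_adj d = d" "norm d \<le> r" and y: "y = (1/2) *\<^sub>R (x + (d o\<^sub>L d))"
      by (auto simp: S_def)
    have "norm y \<le> (1/2) * (norm x + norm (d o\<^sub>L d))"
      unfolding y by (simp add: norm_triangle_ineq)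
    also have "\<dots> \<le> (1/2) * (s + r * r)"
      using norm_blinfun_compose [of d d] d r
      by (intro mult_left_mono add_mono xs) (auto intro: order_trans [OF _ mult_mono])
    finally have "norm y \<le> r" using r by simp
    moreover have "op_adj y = y" unfolding y by (simp add: adj_simps add mult d x)
    moreover have "y \<in> A" unfolding y by (intro scaleR add mult d x)
    ultimately show "y \<in> S" by (simp add: S_def)
  qed
  moreover have "dist ((1/2) *\<^sub>R (x + (d o\<^sub>L d))) ((1/2) *\<^sub>R (x + (e o\<^sub>L e))) \<le> r * dist d e"
    if "d \<in> S" "e \<in> S" for d e
  proof -
    have de: "norm d \<le> r" "norm e \<le> r" using that by (auto simp: S_def)
    have "(1/2) *\<^sub>R (x + (d o\<^sub>L d)) - (1/2) *\<^sub>R (x + (e o\<^sub>L e))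
        = (1/2) *\<^sub>R ((d o\<^sub>L (d - e)) + ((d - e) o\<^sub>L e))"
      by (simp add: blinfun_compose_simps algebra_simps)
    then have "dist ((1/2) *\<^sub>R (x + (d o\<^sub>L d))) ((1/2) *\<^sub>R (x + (e o\<^sub>L e)))
        \<le> (1/2) * (norm (d o\<^sub>L (d - e)) + norm ((d - e) o\<^sub>L e))"
      unfolding dist_norm by (simp add: norm_triangle_ineq)
    also have "\<dots> \<le> (1/2) * (norm d * norm (d - e) + norm (d - e) * norm e)"
      by (intro mult_left_mono add_mono norm_blinfun_compose) simp
    also have "\<dots> \<le> (1/2) * (r * norm (d - e) + norm (d - e) * r)"
      by (intro mult_left_mono add_mono mult_right_mono de) auto
    finally show ?thesis by (simp add: dist_norm)
  qed
  ultimately have "\<exists>!d\<in>S. (1/2) *\<^sub>R (x + (d o\<^sub>L d)) = d"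
    using r Banach_fix [of S r "\<lambda>d. (1/2) *\<^sub>R (x + (d o\<^sub>L d))"] by blast
  then obtain d where d: "d \<in> S" "(1/2) *\<^sub>R (x + (d o\<^sub>L d)) = d" by blast
  have "2 *\<^sub>R d = x + (d o\<^sub>L d)" by (subst d(2) [symmetric]) simp
  then show ?thesis using d(1) that by (auto simp: S_def x_def)
qed

lemma star_automorphism_simps:
  assumes "star_automorphism A \<Phi>"
  shows "a \<in> A \<Longrightarrow> \<Phi> a \<in> A"
    "a \<in> A \<Longrightarrow> b \<in> A \<Longrightarrow> \<Phi> (a + b) = \<Phi> a + \<Phi> b"
    "a \<in> A \<Longrightarrow> b \<in> A \<Longrightarrow> \<Phi> (a o\<^sub>L b) = \<Phi> a o\<^sub>L \<Phi> b"
    "a \<in> A \<Longrightarrow> \<Phi> (op_scale c a) = op_scale c (\<Phi> a)"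
    "a \<in> A \<Longrightarrow> \<Phi> (op_adj a) = op_adj (\<Phi> a)"
    "a \<in> A \<Longrightarrow> \<Phi> (r *\<^sub>R a) = r *\<^sub>R \<Phi> a"
    "a \<in> A \<Longrightarrow> b \<in> A \<Longrightarrow> \<Phi> (a - b) = \<Phi> a - \<Phi> b"
proof -
  show 1: "a \<in> A \<Longrightarrow> \<Phi> a \<in> A"
    "a \<in> A \<Longrightarrow> b \<in> A \<Longrightarrow> \<Phi> (a + b) = \<Phi> a + \<Phi> b"
    "a \<in> A \<Longrightarrow> b \<in> A \<Longrightarrow> \<Phi> (a o\<^sub>L b) = \<Phi> a o\<^sub>L \<Phi> b"
    "a \<in> A \<Longrightarrow> \<Phi> (op_scale c a) = op_scale c (\<Phi> a)"
    "a \<in> A \<Longrightarrow> \<Phi> (op_adj a) = op_adj (\<Phi> a)" for a b c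
    using assms by (auto simp: star_automorphism_def dest: bij_betwE)
  show r: "a \<in> A \<Longrightarrow> \<Phi> (r *\<^sub>R a) = r *\<^sub>R \<Phi> a" for a r
    using 1(4) [of a "of_real r"] by (simp add: op_scale_of_real)
  show "a \<in> A \<Longrightarrow> b \<in> A \<Longrightarrow> \<Phi> (a - b) = \<Phi> a - \<Phi> b"
    using 1(2) [of a "- 1 *\<^sub>R b"] r [of b "- 1"] scaleR [of b "- 1"] by simp
qed

text \<open>Serves the uniqueness part of \<open>gauge_action\<close>: an automorphism is determined
  by its values on a dense subset only if it is continuous, and continuity is not part of
  \<open>star_automorphism\<close>.\<close>

lemma star_automorphism_norm_le:
  assumes \<Phi>: "star_automorphism A \<Phi>" and a: "a \<in> A"
  shows "norm (\<Phi> a) \<le> norm a"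
proof -
  note simps = star_automorphism_simps [OF \<Phi>]
  have unit: "norm (\<Phi> a) \<le> 1" if a: "a \<in> A" "norm a < 1" for a
  proof -
    obtain d where d: "d \<in> A" "op_adj d = d" "2 *\<^sub>R d = (op_adj a o\<^sub>L a) + (d o\<^sub>L d)"
      by (rule quasi_sqrt [OF a])
    have "\<Phi> (2 *\<^sub>R d) = \<Phi> ((op_adj a o\<^sub>L a) + (d o\<^sub>L d))" by (simp only: d(3))
    then have e: "2 *\<^sub>R \<Phi> d = (op_adj (\<Phi> a) o\<^sub>L \<Phi> a) + (\<Phi> d o\<^sub>L \<Phi> d)"
      using d(1) a(1) by (simp add: simps adj mult)
    have sd: "op_adj (\<Phi> d) = \<Phi> d" using simps(5) [OF d(1)] d(2) by simp
    have isa: "is_adj (\<Phi> a) (op_adj (\<Phi> a))" "is_adj (\<Phi> d) (\<Phi> d)"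
      using is_adj [OF simps(1) [OF a(1)]] is_adj [OF simps(1) [OF d(1)]] sd by auto
    show ?thesis
    proof (rule norm_blinfun_bound)
      fix f
      let ?g = "\<Phi> d f"
      have "2 *\<^sub>R ?g = op_adj (\<Phi> a) (\<Phi> a f) + \<Phi> d ?g"
        using arg_cong [OF e, of "\<lambda>T. blinfun_apply T f"] by (simp add: blinfun.add_left blinfun.scaleR_left)
      then have "cinner f (2 *\<^sub>R ?g) = cinner f (op_adj (\<Phi> a) (\<Phi> a f)) + cinner f (\<Phi> d ?g)"
        by (simp add: cinner_add_right)
      also have "\<dots> = cinner (\<Phi> a f) (\<Phi> a f) + cinner ?g ?g"
        by (simp add: is_adjD [OF isa(1)] is_adjD [OF isa(2)])
      finally have "2 * cinner f ?g = of_real ((norm (\<Phi> a f))\<^sup>2) + of_real ((norm ?g)\<^sup>2)"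
        by (simp add: cinner_simps cinner_self)
      then have "Re (2 * cinner f ?g) = Re (of_real ((norm (\<Phi> a f))\<^sup>2) + of_real ((norm ?g)\<^sup>2))"
        by (rule arg_cong)
      then have "2 * inner f ?g = (norm (\<Phi> a f))\<^sup>2 + (norm ?g)\<^sup>2" by (simp add: inner_ell2_def)
      moreover have "(norm (f - ?g))\<^sup>2 = (norm f)\<^sup>2 - 2 * inner f ?g + (norm ?g)\<^sup>2"
        by (simp add: power2_norm_eq_inner inner_diff_left inner_diff_right inner_commute)
      \<comment> \<open>This is the identity between \<open>1 - \<Phi>(a)\<^sup>* \<Phi>(a)\<close>
        and the square of \<open>1 - \<Phi>(d)\<close>, tested on \<open>f\<close>; it avoids a unit
        in the algebra.\<close>
      ultimately have "(norm (\<Phi> a f))\<^sup>2 + (norm (f - ?g))\<^sup>2 = (norm f)\<^sup>2" by simp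
      then have "(norm (\<Phi> a f))\<^sup>2 \<le> (norm f)\<^sup>2" using zero_le_power2 [of "norm (f - ?g)"] by linarith
      then show "norm (\<Phi> a f) \<le> 1 * norm f" by (simp add: power2_le_iff_abs_le)
    qed simp
  qed
  show ?thesis
  proof (rule field_le_epsilon)
    fix e :: real assume "e > 0"
    define r where "r = norm a + e"
    have r: "r > 0" "norm a < r" using \<open>e > 0\<close> by (auto simp: r_def add_nonneg_pos)
    have "norm (\<Phi> (inverse r *\<^sub>R a)) \<le> 1"
      by (rule unit) (use r a in \<open>auto simp: scaleR field_simps\<close>)
    then show "norm (\<Phi> a) \<le> norm a + e"
      using r simps(6) [OF a] by (simp add: field_simps r_def)
  qed
qed

end

section \<open>Bounded functions on a strip\<close>

definition KMS_fun :: "real \<Rightarrow> (complex \<Rightarrow> complex) \<Rightarrow> bool" where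
  "KMS_fun \<beta> F \<longleftrightarrow> continuous_on (KMS_strip \<beta>) F \<and> bounded (F ` KMS_strip \<beta>) \<and>
     F holomorphic_on interior (KMS_strip \<beta>)"

lemma KMS_strip_iff: "z \<in> KMS_strip \<beta> \<longleftrightarrow> (0 \<le> Im z \<and> Im z \<le> \<beta>) \<or> (\<beta> \<le> Im z \<and> Im z \<le> 0)"
  by (auto simp: KMS_strip_def closed_segment_eq_real_ivl)

lemma KMS_fun_add: "KMS_fun \<beta> F \<Longrightarrow> KMS_fun \<beta> H \<Longrightarrow> KMS_fun \<beta> (\<lambda>z. F z + H z)"
  unfolding KMS_fun_def by (auto intro!: continuous_intros bounded_plus_comp holomorphic_intros)

lemma KMS_fun_diff: "KMS_fun \<beta> F \<Longrightarrow> KMS_fun \<beta> H \<Longrightarrow> KMS_fun \<beta> (\<lambda>z. F z - H z)"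
  unfolding KMS_fun_def by (auto intro!: continuous_intros bounded_minus_comp holomorphic_intros)

lemma KMS_fun_mult:
  assumes "KMS_fun \<beta> F" "KMS_fun \<beta> H" shows "KMS_fun \<beta> (\<lambda>z. F z * H z)"
proof -
  have "bounded ((\<lambda>z. F z * H z) ` KMS_strip \<beta>)"
  proof -
    obtain b c where b: "\<And>z. z \<in> KMS_strip \<beta> \<Longrightarrow> norm (F z) \<le> b"
      and c: "\<And>z. z \<in> KMS_strip \<beta> \<Longrightarrow> norm (H z) \<le> c"
      using assms by (auto simp: KMS_fun_def bounded_iff)
    have "norm (F z * H z) \<le> b * c" if "z \<in> KMS_strip \<beta>" for z
      using b [OF that] c [OF that] order_trans [OF norm_ge_zero b [OF that]]
      by (simp add: norm_mult mult_mono)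
    then show ?thesis by (auto simp: bounded_iff)
  qed
  then show ?thesis using assms
    unfolding KMS_fun_def by (auto intro!: continuous_intros holomorphic_intros)
qed

lemma KMS_fun_const: "KMS_fun \<beta> (\<lambda>z. c)"
  unfolding KMS_fun_def by (auto intro!: continuous_intros holomorphic_intros simp: bounded_iff)

lemma KMS_fun_exp: "KMS_fun \<beta> (\<lambda>z. exp (\<i> * of_real r * z))"
proof -
  have "norm (exp (\<i> * of_real r * z)) \<le> exp (\<bar>r\<bar> * \<bar>\<beta>\<bar>)" if "z \<in> KMS_strip \<beta>" for z
  proof -
    have "- (r * Im z) \<le> \<bar>r\<bar> * \<bar>Im z\<bar>" by (metis abs_ge_minus_self abs_mult)
    also have "\<dots> \<le> \<bar>r\<bar> * \<bar>\<beta>\<bar>" using that by (intro mult_left_mono) (auto simp: KMS_strip_iff)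
    finally show ?thesis by simp
  qed
  then show ?thesis
    unfolding KMS_fun_def by (auto intro!: continuous_intros holomorphic_intros simp: bounded_iff)
qed

text \<open>Multiplying by \<open>exp (- \<epsilon> z\<^sup>2)\<close> forces decay along the strip, so that the maximum principle for rectangles applies.\<close>

lemma strip_maximum_principle:
  assumes F: "KMS_fun \<beta> F" and B: "0 \<le> B"
    and b0: "\<And>z. Im z = 0 \<Longrightarrow> cmod (F z) \<le> B"
    and b1: "\<And>z. Im z = \<beta> \<Longrightarrow> cmod (F z) \<le> B"
    and z: "z \<in> KMS_strip \<beta>"
  shows "cmod (F z) \<le> B"
proof -
  obtain C where C: "\<And>z. z \<in> KMS_strip \<beta> \<Longrightarrow> cmod (F z) \<le> C" and C0: "C > 0"
    using F by (auto simp: KMS_fun_def bounded_pos)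
  have normexp: "cmod (exp (- of_real e * w\<^sup>2)) = exp (e * ((Im w)\<^sup>2 - (Re w)\<^sup>2))" for e w
    by (simp add: algebra_simps power2_eq_square)
  \<comment> \<open>In the rectangle below, \<open>B\<close> bounds the horizontal sides and
    \<open>e\<close> the vertical ones; the factor \<open>exp (e * \<beta>\<^sup>2)\<close> is the
    largest modulus that the damping function attains on the strip. Both corrections disappear as
    \<open>e\<close> tends to 0.\<close>
  have bound: "cmod (F z) * exp (e * ((Im z)\<^sup>2 - (Re z)\<^sup>2)) \<le> (B + e) * exp (e * \<beta>\<^sup>2)" if e: "e > 0" for e
  proof -
    have "((\<lambda>R. C * exp (- (e * R\<^sup>2))) \<longlongrightarrow> 0) at_top"
      using e by real_asymp
    then have "\<forall>\<^sub>F R in at_top. C * exp (- (e * R\<^sup>2)) < e"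
      by (rule order_tendstoD(2)) (rule e)
    then have "\<forall>\<^sub>F R in at_top. C * exp (- (e * R\<^sup>2)) < e \<and> \<bar>Re z\<bar> \<le> R"
      using eventually_ge_at_top by (rule eventually_conj)
    then obtain R where R: "C * exp (- (e * R\<^sup>2)) < e" "\<bar>Re z\<bar> \<le> R"
      using eventually_happens' [OF trivial_limit_at_top_linorder] by blast
    \<comment> \<open>The \<open>min\<close> and \<open>max\<close> treat both signs of \<beta> at
      once; for \<open>\<beta> = 0\<close> the rectangle degenerates to a segment, all of whose
      points have imaginary part 0.\<close>
    define S where "S = cbox (Complex (- R) (min 0 \<beta>)) (Complex R (max 0 \<beta>))"
    have SS: "S \<subseteq> KMS_strip \<beta>"
      by (auto simp: S_def cbox_complex_eq KMS_strip_iff min_def max_def split: if_splits)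
    define H where "H = (\<lambda>w. F w * exp (- of_real e * w\<^sup>2))"
    have imb: "(Im w)\<^sup>2 \<le> \<beta>\<^sup>2" if "w \<in> KMS_strip \<beta>" for w
      using that by (auto simp: KMS_strip_iff abs_le_square_iff [symmetric])
    have "cmod (H z) \<le> (B + e) * exp (e * \<beta>\<^sup>2)"
    proof (rule maximum_modulus_frontier [where S = S and f = H and \<xi> = z])
      show "H holomorphic_on interior S"
      proof -
        have "F holomorphic_on interior S"
          by (rule holomorphic_on_subset [OF _ interior_mono [OF SS]]) (use F in \<open>simp add: KMS_fun_def\<close>)
        then show ?thesis unfolding H_def by (intro holomorphic_intros)
      qed
      show "continuous_on (closure S) H"
      proof -
        have "closure S = S" by (simp add: S_def)
        moreover have "continuous_on S F"
          by (rule continuous_on_subset [OF _ SS]) (use F in \<open>simp add: KMS_fun_def\<close>)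
        ultimately show ?thesis unfolding H_def by (auto intro!: continuous_intros)
      qed
      show "bounded S" unfolding S_def by (rule bounded_cbox)
      show "z \<in> S" using z R by (auto simp: S_def cbox_complex_eq KMS_strip_iff)
      fix w assume w: "w \<in> frontier S"
      then have wS: "w \<in> S" using frontier_subset_closed [of S] by (auto simp: S_def)
      then have wst: "w \<in> KMS_strip \<beta>" using SS by blast
      have "w \<notin> box (Complex (- R) (min 0 \<beta>)) (Complex R (max 0 \<beta>))"
        using w by (simp add: S_def frontier_cbox)
      then consider "Im w = 0 \<or> Im w = \<beta>" | "\<bar>Re w\<bar> = R"
      proof -
        have w1: "\<bar>Re w\<bar> \<le> R" "min 0 \<beta> \<le> Im w" "Im w \<le> max 0 \<beta>"
          using wS by (auto simp: S_def cbox_complex_eq)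
        have "\<not> (- R < Re w \<and> Re w < R \<and> min 0 \<beta> < Im w \<and> Im w < max 0 \<beta>)"
          using \<open>w \<notin> box _ _\<close> by (auto simp: box_complex_eq)
        then have "(Im w = 0 \<or> Im w = \<beta>) \<or> \<bar>Re w\<bar> = R" using w1 by linarith
        then show ?thesis using that by blast
      qed
      then show "cmod (H w) \<le> (B + e) * exp (e * \<beta>\<^sup>2)"
      proof cases
        case 1
        then have "cmod (F w) \<le> B" using b0 b1 by blast
        then have "cmod (F w) \<le> B + e" using e by simp
        moreover have "exp (e * ((Im w)\<^sup>2 - (Re w)\<^sup>2)) \<le> exp (e * \<beta>\<^sup>2)"
          using imb [OF wst] zero_le_power2 [of "Re w"]
          unfolding exp_le_cancel_iff mult_le_cancel_left_pos [OF e] by linarith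
        ultimately show ?thesis unfolding H_def norm_mult normexp
          using B e by (intro mult_mono) auto
      next
        case 2
        have "cmod (H w) \<le> C * exp (e * (\<beta>\<^sup>2 - R\<^sup>2))"
          unfolding H_def norm_mult normexp
        proof (intro mult_mono C wst)
          have "(Re w)\<^sup>2 = R\<^sup>2" using 2 by (metis power2_abs)
          then show "exp (e * ((Im w)\<^sup>2 - (Re w)\<^sup>2)) \<le> exp (e * (\<beta>\<^sup>2 - R\<^sup>2))"
            using e imb [OF wst] by simp
        qed (use C0 in auto)
        also have "\<dots> = (C * exp (- (e * R\<^sup>2))) * exp (e * \<beta>\<^sup>2)"
          by (simp add: algebra_simps flip: exp_add)
        also have "\<dots> \<le> (B + e) * exp (e * \<beta>\<^sup>2)"
          using R B by (intro mult_right_mono) auto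
        finally show ?thesis .
      qed
    qed
    then show ?thesis unfolding H_def norm_mult normexp .
  qed
  have "((\<lambda>e. cmod (F z) * exp (e * ((Im z)\<^sup>2 - (Re z)\<^sup>2))) \<longlongrightarrow> cmod (F z) * exp (0 * ((Im z)\<^sup>2 - (Re z)\<^sup>2))) (at_right 0)"
    by (intro tendsto_intros)
  moreover have "((\<lambda>e. (B + e) * exp (e * \<beta>\<^sup>2)) \<longlongrightarrow> (B + 0) * exp (0 * \<beta>\<^sup>2)) (at_right 0)"
    by (intro tendsto_intros)
  moreover have "\<forall>\<^sub>F e in at_right 0. cmod (F z) * exp (e * ((Im z)\<^sup>2 - (Re z)\<^sup>2)) \<le> (B + e) * exp (e * \<beta>\<^sup>2)"
    using eventually_at_right_less [of "0::real"] by eventually_elim (rule bound)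
  ultimately have "cmod (F z) * exp (0 * ((Im z)\<^sup>2 - (Re z)\<^sup>2)) \<le> (B + 0) * exp (0 * \<beta>\<^sup>2)"
    by (intro tendsto_le [OF trivial_limit_at_right_real])
  then show ?thesis by simp
qed

text \<open>Weighting with \<open>exp (i \<lambda> z)\<close> and letting \<open>\<lambda>\<close> tend to infinity kills a function that vanishes on one side of the strip.\<close>

lemma strip_unique:
  assumes F: "KMS_fun \<beta> F" and b0: "\<And>z. Im z = 0 \<Longrightarrow> F z = 0" and z: "Im z = \<beta>"
  shows "F z = 0"
proof (cases "\<beta> = 0")
  case False
  obtain C where C: "\<And>z. z \<in> KMS_strip \<beta> \<Longrightarrow> cmod (F z) \<le> C" and C0: "C > 0"
    using F by (auto simp: KMS_fun_def bounded_pos)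
  have inner: "F w = 0" if w: "w \<in> KMS_strip \<beta>" "Im w \<noteq> \<beta>" for w
  proof -
    have bound: "cmod (F w) \<le> C * exp (- (n * \<bar>\<beta> - Im w\<bar>))" if "n \<ge> 0" for n :: real
    proof -
      \<comment> \<open>The sign of \<beta> selects the direction of growth so that the weighted
        function is relatively small on the side where \<open>F\<close> is not known to
        vanish.\<close>
      define r where "r = sgn \<beta> * n"
      have r: "r * (\<beta> - Im w) = n * \<bar>\<beta> - Im w\<bar>"
        using w False by (auto simp: r_def KMS_strip_iff sgn_if)
      have en: "cmod (exp (\<i> * of_real r * u)) = exp (- (r * Im u))" for u by simp
      have "cmod (F w * exp (\<i> * of_real r * w)) \<le> C * exp (- (r * \<beta>))"
      proof (rule strip_maximum_principle [OF KMS_fun_mult [OF F KMS_fun_exp] _ _ _ w(1)])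
        show "0 \<le> C * exp (- (r * \<beta>))" using C0 by simp
        show "cmod (F u * exp (\<i> * of_real r * u)) \<le> C * exp (- (r * \<beta>))" if "Im u = 0" for u
          using b0 [OF that] C0 by simp
        show "cmod (F u * exp (\<i> * of_real r * u)) \<le> C * exp (- (r * \<beta>))" if "Im u = \<beta>" for u
          unfolding norm_mult en that using that by (intro mult_right_mono C) (auto simp: KMS_strip_iff)
      qed
      then have "cmod (F w) * exp (- (r * Im w)) \<le> C * exp (- (r * \<beta>))"
        unfolding norm_mult en .
      then have "(cmod (F w) * exp (- (r * Im w))) * exp (r * Im w) \<le> (C * exp (- (r * \<beta>))) * exp (r * Im w)"
        by (rule mult_right_mono) simp
      then have "cmod (F w) \<le> C * exp (- (r * (\<beta> - Im w)))"
        by (simp add: mult.assoc algebra_simps flip: exp_add)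
      then show ?thesis by (simp only: r)
    qed
    have pos: "\<bar>\<beta> - Im w\<bar> > 0" using w by simp
    have "((\<lambda>n. C * exp (- (n * \<bar>\<beta> - Im w\<bar>))) \<longlongrightarrow> 0) at_top"
      using pos by real_asymp
    then have "cmod (F w) \<le> 0"
      by (rule tendsto_lowerbound) (use bound in \<open>auto intro: eventually_mono [OF eventually_ge_at_top [of "0::real"]]\<close>)
    then show ?thesis by simp
  qed
  \<comment> \<open>A point of the far side is approached from within the strip, where
    \<open>F\<close> has already been shown to vanish; continuity up to the boundary finishes the
    argument.\<close>
  define u where "u = (\<lambda>n. z - \<i> * of_real (\<beta> / real (n + 2)))"
  have u: "u n \<in> KMS_strip \<beta>" "Im (u n) \<noteq> \<beta>" for n
  proof -
    define q where "q = 1 - 1 / real (n + 2)"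
    have q: "0 \<le> q" "q < 1" by (auto simp: q_def)
    have im: "Im (u n) = \<beta> * q" using z by (simp add: u_def q_def algebra_simps)
    show "Im (u n) \<noteq> \<beta>" using q False by (simp add: im)
    show "u n \<in> KMS_strip \<beta>"
    proof (cases "0 \<le> \<beta>")
      case True
      then show ?thesis using q mult_left_le [of q \<beta>] by (simp add: KMS_strip_iff im)
    next
      case False
      then show ?thesis using q mult_left_le [of q "- \<beta>"] by (simp add: KMS_strip_iff im mult_nonpos_nonneg)
    qed
  qed
  have "(\<lambda>n. \<beta> / real (n + 2)) \<longlonglongrightarrow> 0" by real_asymp
  then have "u \<longlonglongrightarrow> z - \<i> * of_real 0"
    unfolding u_def by (intro tendsto_intros)
  then have "(\<lambda>n. F (u n)) \<longlonglongrightarrow> F z"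
    using F z u by (intro continuous_on_tendsto_compose [of "KMS_strip \<beta>" F]) (auto simp: KMS_fun_def KMS_strip_iff)
  then show ?thesis using inner [OF u] by (simp add: LIMSEQ_const_iff)
qed (use b0 z in auto)

text \<open>The maximum principle carries the Cauchy estimate from the two boundary lines to the
  whole strip. Uniform convergence then preserves continuity and boundedness, and holomorphy in the
  interior.\<close>

lemma strip_limit:
  assumes F: "\<And>n. KMS_fun \<beta> (F n)"
    and c: "\<And>e. e > 0 \<Longrightarrow> \<exists>N. \<forall>m\<ge>N. \<forall>n\<ge>N. \<forall>z. Im z = 0 \<or> Im z = \<beta> \<longrightarrow> cmod (F m z - F n z) \<le> e"
  obtains H where "KMS_fun \<beta> H" "\<And>z. z \<in> KMS_strip \<beta> \<Longrightarrow> (\<lambda>n. F n z) \<longlonglongrightarrow> H z"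
proof -
  let ?S = "KMS_strip \<beta>"
  have unif: "\<exists>N. \<forall>m\<ge>N. \<forall>n\<ge>N. \<forall>z\<in>?S. cmod (F m z - F n z) \<le> e" if e: "e > 0" for e
  proof -
    obtain N where N: "\<And>m n z. m \<ge> N \<Longrightarrow> n \<ge> N \<Longrightarrow> Im z = 0 \<or> Im z = \<beta> \<Longrightarrow> cmod (F m z - F n z) \<le> e"
      using c [OF e] by blast
    have "cmod (F m z - F n z) \<le> e" if "m \<ge> N" "n \<ge> N" "z \<in> ?S" for m n z
      using N [OF that(1,2)] \<open>e > 0\<close>
      by (intro strip_maximum_principle [OF KMS_fun_diff [OF F F] _ _ _ that(3)]) auto
    then show ?thesis by blast
  qed
  have "uniformly_Cauchy_on ?S F"
  proof (rule uniformly_Cauchy_onI)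
    fix e :: real assume "e > 0"
    then obtain N where "\<forall>m\<ge>N. \<forall>n\<ge>N. \<forall>z\<in>?S. cmod (F m z - F n z) \<le> e / 2" using unif [of "e/2"] by auto
    then show "\<exists>M. \<forall>x\<in>?S. \<forall>m\<ge>M. \<forall>n\<ge>M. dist (F m x) (F n x) < e"
      using \<open>e > 0\<close> by (intro exI [of _ N]) (fastforce simp: dist_norm)
  qed
  then obtain H where H: "uniform_limit ?S F H sequentially"
    using Cauchy_uniformly_convergent uniformly_convergent_on_def by blast
  have "continuous_on ?S H"
    by (rule uniform_limit_theorem [OF _ H]) (use F in \<open>auto simp: KMS_fun_def\<close>)
  moreover have "bounded (H ` ?S)"
  proof -
    obtain N where N: "\<And>z. z \<in> ?S \<Longrightarrow> dist (F N z) (H z) < 1"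
      using uniform_limitD [OF H, of 1] by (auto simp: eventually_sequentially)
    obtain b where b: "\<And>z. z \<in> ?S \<Longrightarrow> cmod (F N z) \<le> b"
      using F [of N] by (auto simp: KMS_fun_def bounded_iff)
    have "cmod (H z) \<le> b + 1" if "z \<in> ?S" for z
    proof -
      have "cmod (H z) \<le> cmod (F N z) + cmod (F N z - H z)" by (metis norm_minus_commute norm_triangle_sub)
      then show ?thesis using N [OF that] b [OF that] by (simp add: dist_norm)
    qed
    then show ?thesis by (auto simp: bounded_iff)
  qed
  moreover have "H holomorphic_on interior ?S"
  proof (rule holomorphic_uniform_sequence [where f = F])
    fix x assume "x \<in> interior ?S"
    then obtain d where d: "0 < d" "cball x d \<subseteq> interior ?S" using open_contains_cball open_interior by blast
    then have "cball x d \<subseteq> ?S" using interior_subset by blast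
    then have "uniform_limit (cball x d) F H sequentially" by (rule uniform_limit_on_subset [OF H])
    with d show "\<exists>d>0. cball x d \<subseteq> interior ?S \<and> uniform_limit (cball x d) F H sequentially" by blast
  qed (use F in \<open>auto simp: KMS_fun_def\<close>)
  ultimately show ?thesis using that tendsto_uniform_limitI [OF H] by (auto simp: KMS_fun_def)
qed

section \<open>The topology of the groupoid\<close>

lemma shift_pow: "(shift ^^ n) p = (\<lambda>i. p (n + i))"
  by (induction n) (auto simp: shift_def)

text \<open>
  The arrows \<open>(\<mu>p, |\<mu>| - |\<nu>|, \<nu>p)\<close> for infinite paths \<open>p\<close> starting at \<open>w\<close>. These sets form a basis of
  compact open bisections, any two of which are nested or disjoint. The vertex \<open>w\<close> is needed because
  both words may be empty.
\<close>

definition bisection :: "('v, 'e) pre_digraph \<Rightarrow> 'v \<Rightarrow> 'e list \<Rightarrow> 'e list \<Rightarrow> 'e garrow set" where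
  "bisection G w \<mu> \<nu> = {(p, k, q). p \<in> inf_paths G \<and> q \<in> inf_paths G \<and>
     (\<forall>i<length \<mu>. p i = \<mu> ! i) \<and> (\<forall>i<length \<nu>. q i = \<nu> ! i) \<and>
     k = int (length \<mu>) - int (length \<nu>) \<and>
     (\<forall>i. p (length \<mu> + i) = q (length \<nu> + i)) \<and> tail G (p (length \<mu>)) = w}"

lemma bisection_subset: "bisection G w \<mu> \<nu> \<subseteq> groupoid G"
  unfolding bisection_def groupoid_def shift_pow by force

lemma openin_path_topology:
  "openin (path_topology G) U \<longleftrightarrow> U \<subseteq> inf_paths G \<and>
     (\<forall>p\<in>U. \<exists>n. \<forall>q\<in>inf_paths G. (\<forall>i<n. q i = p i) \<longrightarrow> q \<in> U)"
proof
  assume "openin (path_topology G) U"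
  then have "generate_topology_on {cylinder G es | es. es \<noteq> []} U"
    by (simp add: path_topology_def openin_topology_generated_by_iff)
  then show "U \<subseteq> inf_paths G \<and> (\<forall>p\<in>U. \<exists>n. \<forall>q\<in>inf_paths G. (\<forall>i<n. q i = p i) \<longrightarrow> q \<in> U)"
  proof induction
    case (Int a b)
    show ?case
    proof (intro conjI ballI)
      fix p assume "p \<in> a \<inter> b"
      then obtain m n where "\<forall>q\<in>inf_paths G. (\<forall>i<m. q i = p i) \<longrightarrow> q \<in> a"
        "\<forall>q\<in>inf_paths G. (\<forall>i<n. q i = p i) \<longrightarrow> q \<in> b" using Int by blast
      then show "\<exists>n. \<forall>q\<in>inf_paths G. (\<forall>i<n. q i = p i) \<longrightarrow> q \<in> a \<inter> b"
        by (intro exI [of _ "max m n"]) auto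
    qed (use Int in blast)
  next
    case (UN K)
    then show ?case by (meson UnionE UnionI Sup_least)
  next
    case (Basis s)
    then obtain es where s: "s = cylinder G es" by blast
    show ?case
    proof (intro conjI ballI)
      fix p assume "p \<in> s"
      then show "\<exists>n. \<forall>q\<in>inf_paths G. (\<forall>i<n. q i = p i) \<longrightarrow> q \<in> s"
        by (intro exI [of _ "length es"]) (simp add: s cylinder_def)
    qed (auto simp: s cylinder_def)
  qed auto
next
  assume U: "U \<subseteq> inf_paths G \<and> (\<forall>p\<in>U. \<exists>n. \<forall>q\<in>inf_paths G. (\<forall>i<n. q i = p i) \<longrightarrow> q \<in> U)"
  have "\<exists>C. openin (path_topology G) C \<and> p \<in> C \<and> C \<subseteq> U" if p: "p \<in> U" for p
  proof -
    obtain n where n: "\<forall>q\<in>inf_paths G. (\<forall>i<n. q i = p i) \<longrightarrow> q \<in> U" using U p by blast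
    \<comment> \<open>The basic cylinders of \<open>path_topology\<close> belong to nonempty words;
      the additional letter takes care of \<open>n = 0\<close>.\<close>
    let ?C = "cylinder G (map p [0..<Suc n])"
    have "openin (path_topology G) ?C"
      unfolding path_topology_def by (rule topology_generated_by_Basis) auto
    moreover have "p \<in> ?C" using U p by (auto simp: cylinder_def simp del: upt_Suc)
    moreover have "?C \<subseteq> U" using n by (auto simp: cylinder_def simp del: upt_Suc)
    ultimately show ?thesis by blast
  qed
  then show "openin (path_topology G) U" by (subst openin_subopen) blast
qed

text \<open>The middle component is discrete and constant on the piece, so the product topology
  reduces to a common prefix length for the two paths.\<close>

lemma openin_groupoid_piece:
  "openin (subtopology
      (prod_topology (path_topology G) (prod_topology (discrete_topology UNIV) (path_topology G)))
      (groupoid_piece G k n)) W \<longleftrightarrow> W \<subseteq> groupoid_piece G k n \<and>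
    (\<forall>p q. (p, k, q) \<in> W \<longrightarrow> (\<exists>N. \<forall>p' q'. (p', k, q') \<in> groupoid_piece G k n \<longrightarrow>
      (\<forall>i<N. p' i = p i \<and> q' i = q i) \<longrightarrow> (p', k, q') \<in> W))"
  (is "openin (subtopology ?T ?S) W \<longleftrightarrow> _ \<and> ?nbhd")
proof
  assume "openin (subtopology ?T ?S) W"
  then obtain Q where Q: "openin ?T Q" "W = Q \<inter> ?S" by (auto simp: openin_subtopology)
  have ?nbhd
  proof (intro allI impI)
    fix p q assume "(p, k, q) \<in> W"
    then have pkq: "(p, k, q) \<in> Q" using Q by blast
    from openin_prod_topology_alt [THEN iffD1, OF Q(1), rule_format, OF pkq]
    obtain U V where UV: "openin (path_topology G) U"
      "openin (prod_topology (discrete_topology UNIV) (path_topology G)) V"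
      "p \<in> U" "(k, q) \<in> V" "U \<times> V \<subseteq> Q"
      by (elim exE conjE)
    from openin_prod_topology_alt [THEN iffD1, OF UV(2), rule_format, OF UV(4)]
    obtain U' V' where V: "openin (path_topology G) V'" "k \<in> U'" "q \<in> V'" "U' \<times> V' \<subseteq> V"
      by (elim exE conjE)
    obtain m where m: "\<forall>q\<in>inf_paths G. (\<forall>i<m. q i = p i) \<longrightarrow> q \<in> U"
      using UV(1,3) by (auto simp: openin_path_topology)
    obtain n where n: "\<forall>q'\<in>inf_paths G. (\<forall>i<n. q' i = q i) \<longrightarrow> q' \<in> V'"
      using V(1,3) by (auto simp: openin_path_topology)
    show "\<exists>N. \<forall>p' q'. (p', k, q') \<in> ?S \<longrightarrow> (\<forall>i<N. p' i = p i \<and> q' i = q i) \<longrightarrow> (p', k, q') \<in> W"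
    proof (intro exI [of _ "max m n"] allI impI)
      fix p' q' assume a: "(p', k, q') \<in> ?S" "\<forall>i<max m n. p' i = p i \<and> q' i = q i"
      then have "p' \<in> U" "q' \<in> V'" using m n by (auto simp: groupoid_piece_def)
      then have "(k, q') \<in> V" using V(2,4) by blast
      then have "(p', k, q') \<in> Q" using UV(5) \<open>p' \<in> U\<close> by blast
      then show "(p', k, q') \<in> W" using Q(2) a(1) by blast
    qed
  qed
  then show "W \<subseteq> ?S \<and> ?nbhd" using Q(2) by blast
next
  assume W: "W \<subseteq> ?S \<and> ?nbhd"
  define C where "C = (\<lambda>N p. {p' \<in> inf_paths G. \<forall>i<N. p' i = p i})"
  have C: "openin (path_topology G) (C N p)" for N p
    unfolding openin_path_topology C_def by (intro conjI ballI exI [of _ N]) auto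
  \<comment> \<open>\<open>H N p q\<close> records that the prefix length \<open>N\<close> works at
    \<open>(p, k, q)\<close>. The union below runs over all such \<open>N\<close>, which spares a
    choice.\<close>
  define H where "H = (\<lambda>N p q. \<forall>p' q'. (p', k, q') \<in> ?S \<longrightarrow> (\<forall>i<N. p' i = p i \<and> q' i = q i) \<longrightarrow> (p', k, q') \<in> W)"
  define Q where "Q = (\<Union>(N, p, q)\<in>{(N, p, q). (p, k, q) \<in> W \<and> H N p q}. C N p \<times> {k} \<times> C N q)"
  have "openin ?T (C N p \<times> {k} \<times> C N q)" for N p q
    by (simp add: openin_prod_Times_iff C)
  then have "openin ?T Q" unfolding Q_def by (intro openin_Union) auto
  moreover have "W = Q \<inter> ?S"
  proof
    show "W \<subseteq> Q \<inter> ?S"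
    proof
      fix g assume g: "g \<in> W"
      obtain p k' q where pq0: "g = (p, k', q)" by (metis prod_cases3)
      then have pq: "g = (p, k, q)" "p \<in> inf_paths G" "q \<in> inf_paths G"
        using W g by (auto simp: groupoid_piece_def)
      then obtain N where "H N p q" using W g unfolding H_def by blast
      moreover have "g \<in> C N p \<times> {k} \<times> C N q" using pq by (auto simp: C_def)
      ultimately have "g \<in> Q" unfolding Q_def using g pq(1) by (intro UN_I [of "(N, p, q)"]) auto
      then show "g \<in> Q \<inter> ?S" using g W by blast
    qed
    show "Q \<inter> ?S \<subseteq> W"
    proof
      fix g assume g: "g \<in> Q \<inter> ?S"
      then obtain N p q where h: "H N p q" "g \<in> C N p \<times> {k} \<times> C N q" unfolding Q_def by auto
      then obtain p' q' where "g = (p', k, q')" "\<forall>i<N. p' i = p i \<and> q' i = q i" by (auto simp: C_def)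
      then show "g \<in> W" using h(1) g unfolding H_def by blast
    qed
  qed
  ultimately show "openin (subtopology ?T ?S) W" unfolding openin_subtopology by blast
qed

lemma groupoid_piece_iff:
  "(p, k', q) \<in> groupoid_piece G k n \<longleftrightarrow> k' = k \<and> p \<in> inf_paths G \<and> q \<in> inf_paths G \<and>
     0 \<le> k + int n \<and> (\<forall>i. p (nat (k + int n) + i) = q (n + i))"
  by (auto simp: groupoid_piece_def shift_pow fun_eq_iff)

lemma groupoid_in_piece: "(p, k, q) \<in> groupoid G \<Longrightarrow> \<exists>n. (p, k, q) \<in> groupoid_piece G k n"
proof -
  assume "(p, k, q) \<in> groupoid G"
  then obtain n m where "k = int n - int m" "p \<in> inf_paths G" "q \<in> inf_paths G" "\<And>i. p (n + i) = q (m + i)"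
    by (auto simp: groupoid_def shift_pow fun_eq_iff)
  then have "(p, k, q) \<in> groupoid_piece G k m" by (simp add: groupoid_piece_iff)
  then show ?thesis by blast
qed

text \<open>The free lower bound \<open>M\<close> on the word length allows the neighbourhood to be
  taken at least as fine as a given bisection, as \<open>bisection_nested\<close> requires.\<close>

lemma openin_groupoid_basis:
  assumes U: "openin (groupoid_topology G) U" and g: "g \<in> U"
  obtains w \<mu> \<nu> where "g \<in> bisection G w \<mu> \<nu>" "bisection G w \<mu> \<nu> \<subseteq> U" "length \<mu> \<ge> M"
proof -
  obtain p k q where pkq: "g = (p, k, q)" by (metis prod_cases3)
  then have "(p, k, q) \<in> groupoid G" using U g by (auto simp: openin_groupoid_topology)
  then obtain n where n: "(p, k, q) \<in> groupoid_piece G k n" using groupoid_in_piece by blast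
  then have "(p, k, q) \<in> U \<inter> groupoid_piece G k n" using g pkq by blast
  moreover have "openin (subtopology
        (prod_topology (path_topology G) (prod_topology (discrete_topology UNIV) (path_topology G)))
        (groupoid_piece G k n)) (U \<inter> groupoid_piece G k n)"
    using U by (simp add: openin_groupoid_topology)
  ultimately have "\<exists>N. \<forall>p' q'. (p', k, q') \<in> groupoid_piece G k n \<longrightarrow>
      (\<forall>i<N. p' i = p i \<and> q' i = q i) \<longrightarrow> (p', k, q') \<in> U \<inter> groupoid_piece G k n"
    unfolding openin_groupoid_piece by simp
  then obtain N where N: "\<And>p' q'. (p', k, q') \<in> groupoid_piece G k n \<Longrightarrow>
      (\<forall>i<N. p' i = p i \<and> q' i = q i) \<Longrightarrow> (p', k, q') \<in> U" by auto
  define m where "m = nat (k + int n)"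
  have m: "int m = k + int n" using n by (simp add: m_def groupoid_piece_iff)
  \<comment> \<open>The same number of letters is added on both sides, which preserves the degree
    \<open>k\<close>. \<open>N\<close> of them guarantee agreement with \<open>p\<close> and
    \<open>q\<close> where the neighbourhood asks for it, \<open>M\<close> the requested
    length.\<close>
  define K where "K = N + M"
  define \<mu> where "\<mu> = map p [0..<m + K]"
  define \<nu> where "\<nu> = map q [0..<n + K]"
  have pq: "p \<in> inf_paths G" "q \<in> inf_paths G" "p (m + i) = q (n + i)" for i
    using n by (auto simp: groupoid_piece_iff m_def)
  have "g \<in> bisection G (tail G (p (m + K))) \<mu> \<nu>"
    unfolding bisection_def pkq \<mu>_def \<nu>_def using pq(1,2) pq(3) m by (simp add: add.assoc)
  moreover have "bisection G (tail G (p (m + K))) \<mu> \<nu> \<subseteq> U"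
  proof
    fix h assume "h \<in> bisection G (tail G (p (m + K))) \<mu> \<nu>"
    then obtain p1 q1 where h: "h = (p1, k, q1)" "p1 \<in> inf_paths G" "q1 \<in> inf_paths G"
      "\<And>i. i < m + K \<Longrightarrow> p1 i = p i" "\<And>i. i < n + K \<Longrightarrow> q1 i = q i"
      "\<And>i. p1 (m + K + i) = q1 (n + K + i)"
    proof -
      obtain p1 k1 q1 where h: "h = (p1, k1, q1)" by (metis prod_cases3)
      have "k1 = k" using \<open>h \<in> _\<close> m by (simp add: h bisection_def \<mu>_def \<nu>_def)
      then show ?thesis using that [of p1 q1] \<open>h \<in> _\<close> by (simp add: h bisection_def \<mu>_def \<nu>_def)
    qed
    have "p1 (m + i) = q1 (n + i)" for i
    proof (cases "i < K")
      case False
      then show ?thesis using h(6) [of "i - K"] by simp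
    qed (use h pq in simp)
    then have "(p1, k, q1) \<in> groupoid_piece G k n" using h n by (auto simp: groupoid_piece_iff m_def)
    moreover have "\<forall>i<N. p1 i = p i \<and> q1 i = q i" using h by (simp add: K_def)
    ultimately show "h \<in> U" unfolding h(1) by (rule N)
  qed
  moreover have "length \<mu> \<ge> M" by (simp add: \<mu>_def K_def)
  ultimately show ?thesis using that by blast
qed

text \<open>The inductive limit topology asks for openness in every piece \<open>n\<close>, also
  when the tails are known to agree only beyond the words \<mu> and \<nu>. The remaining finitely
  many equations are then read off from letters shared with \<open>p\<close> and \<open>q\<close>,
  which is why \<open>N\<close> is chosen so large.\<close>

lemma openin_groupoidI:
  assumes sub: "U \<subseteq> groupoid G" and nb: "\<And>g. g \<in> U \<Longrightarrow> \<exists>w \<mu> \<nu>. g \<in> bisection G w \<mu> \<nu> \<and> bisection G w \<mu> \<nu> \<subseteq> U"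
  shows "openin (groupoid_topology G) U"
  unfolding openin_groupoid_topology openin_groupoid_piece
proof (intro conjI allI impI)
  fix k n p q assume pq: "(p, k, q) \<in> U \<inter> groupoid_piece G k n"
  then obtain w \<mu> \<nu> where g: "(p, k, q) \<in> bisection G w \<mu> \<nu>" "bisection G w \<mu> \<nu> \<subseteq> U" using nb by blast
  define m where "m = nat (k + int n)"
  have m: "int m = k + int n" using pq by (simp add: m_def groupoid_piece_iff)
  define N where "N = length \<mu> + length \<nu> + m + n + 1"
  have Zk: "k = int (length \<mu>) - int (length \<nu>)" using g by (simp add: bisection_def)
  show "\<exists>N. \<forall>p' q'. (p', k, q') \<in> groupoid_piece G k n \<longrightarrow>
          (\<forall>i<N. p' i = p i \<and> q' i = q i) \<longrightarrow> (p', k, q') \<in> U \<inter> groupoid_piece G k n"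
  proof (intro exI [of _ N] allI impI)
    fix p' q' assume a: "(p', k, q') \<in> groupoid_piece G k n" "\<forall>i<N. p' i = p i \<and> q' i = q i"
    then have s: "p' (m + i) = q' (n + i)" for i by (simp add: groupoid_piece_iff m_def)
    have "p' (length \<mu> + i) = q' (length \<nu> + i)" for i
    proof (cases "m \<le> length \<mu> + i")
      case True
      then have "p' (length \<mu> + i) = q' (n + (length \<mu> + i - m))" using s [of "length \<mu> + i - m"] by simp
      moreover have "n + (length \<mu> + i - m) = length \<nu> + i" using True m Zk by linarith
      ultimately show ?thesis by simp
    next
      case False
      then have "length \<mu> + i < N" "length \<nu> + i < N" using m Zk by (auto simp: N_def)
      then show ?thesis using a(2) g(1) by (simp add: bisection_def)
    qed
    moreover have "length \<mu> < N" by (simp add: N_def)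
    ultimately have "(p', k, q') \<in> bisection G w \<mu> \<nu>"
      using g(1) a by (auto simp: bisection_def groupoid_piece_iff N_def)
    then show "(p', k, q') \<in> U \<inter> groupoid_piece G k n" using g(2) a(1) by blast
  qed
qed (use sub in auto)

lemma openin_bisection: "openin (groupoid_topology G) (bisection G w \<mu> \<nu>)"
  by (rule openin_groupoidI [OF bisection_subset]) blast

lemma topspace_groupoid_topology: "topspace (groupoid_topology G) = groupoid G"
proof
  have "openin (groupoid_topology G) (topspace (groupoid_topology G))" by simp
  then show "topspace (groupoid_topology G) \<subseteq> groupoid G" by (simp only: openin_groupoid_topology)
  have "openin (groupoid_topology G) (groupoid G)"
  proof (rule openin_groupoidI)
    fix g assume "g \<in> groupoid G"
    then obtain p n m q where g: "g = (p, int n - int m, q)" "p \<in> inf_paths G" "q \<in> inf_paths G"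
      "\<And>i. p (n + i) = q (m + i)"
      by (auto simp: groupoid_def shift_pow fun_eq_iff)
    have "g \<in> bisection G (tail G (p n)) (map p [0..<n]) (map q [0..<m])"
      using g by (auto simp: bisection_def)
    then show "\<exists>w \<mu> \<nu>. g \<in> bisection G w \<mu> \<nu> \<and> bisection G w \<mu> \<nu> \<subseteq> groupoid G" by (meson bisection_subset)
  qed simp
  then show "groupoid G \<subseteq> topspace (groupoid_topology G)" by (rule openin_subset)
qed

text \<open>A common arrow \<open>g\<close> fixes the degree and shows that the longer words extend
  the shorter ones by letters of \<open>g\<close>, the same ones on both sides.\<close>

lemma bisection_nested:
  assumes "g \<in> bisection G w \<mu> \<nu>" "g \<in> bisection G w' \<mu>' \<nu>'" and le: "length \<mu> \<le> length \<mu>'"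
  shows "bisection G w' \<mu>' \<nu>' \<subseteq> bisection G w \<mu> \<nu>"
proof
  fix h assume h: "h \<in> bisection G w' \<mu>' \<nu>'"
  obtain p k q where g: "g = (p, k, q)" by (metis prod_cases3)
  obtain p1 k1 q1 where h1: "h = (p1, k1, q1)" by (metis prod_cases3)
  have len: "int (length \<mu>) - int (length \<nu>) = int (length \<mu>') - int (length \<nu>')"
    using assms by (simp add: bisection_def g)
  have p1: "p1 i = p i" if "i < length \<mu>'" for i using h assms(2) that by (simp add: bisection_def g h1)
  have q1: "q1 i = q i" if "i < length \<nu>'" for i using h assms(2) that by (simp add: bisection_def g h1)
  have "p1 (length \<mu> + i) = q1 (length \<nu> + i)" for i
  proof (cases "length \<mu> + i < length \<mu>'")
    case True
    then show ?thesis using p1 q1 [of "length \<nu> + i"] len assms(1) by (simp add: bisection_def g)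
  next
    case False
    then have "p1 (length \<mu> + i) = p1 (length \<mu>' + (length \<mu> + i - length \<mu>'))" by simp
    also have "\<dots> = q1 (length \<nu>' + (length \<mu> + i - length \<mu>'))"
      using h unfolding bisection_def h1 by blast
    also have "length \<nu>' + (length \<mu> + i - length \<mu>') = length \<nu> + i" using False len by linarith
    finally show ?thesis .
  qed
  moreover have "tail G (p1 (length \<mu>)) = w"
    using p1 [of "length \<mu>"] h assms le by (cases "length \<mu> = length \<mu>'") (auto simp: bisection_def g h1)
  moreover have "length \<nu> \<le> length \<nu>'" using len le by linarith
  ultimately show "h \<in> bisection G w \<mu> \<nu>"
    using h assms(1) p1 q1 le len by (auto simp: bisection_def g h1)
qed

lemma bisection_extend: "tail G e = w \<Longrightarrow> bisection G (head G e) (\<mu> @ [e]) (\<nu> @ [e]) \<subseteq> bisection G w \<mu> \<nu>"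
proof
  fix g assume e: "tail G e = w" and g: "g \<in> bisection G (head G e) (\<mu> @ [e]) (\<nu> @ [e])"
  obtain p k q where pkq: "g = (p, k, q)" by (metis prod_cases3)
  have p: "p i = (\<mu> @ [e]) ! i" if "i < length (\<mu> @ [e])" for i using g that by (simp add: bisection_def pkq)
  have q: "q i = (\<nu> @ [e]) ! i" if "i < length (\<nu> @ [e])" for i using g that by (simp add: bisection_def pkq)
  have s: "p (Suc (length \<mu> + i)) = q (Suc (length \<nu> + i))" for i
    using g by (simp add: bisection_def pkq)
  have "p (length \<mu> + i) = q (length \<nu> + i)" for i
    using p [of "length \<mu>"] q [of "length \<nu>"] s by (cases i) auto
  then show "g \<in> bisection G w \<mu> \<nu>"
    using g e p [of "length \<mu>"] p q by (auto simp: bisection_def pkq nth_append)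
qed

lemma bisection_split:
  assumes "g \<in> bisection G w \<mu> \<nu>"
  shows "\<exists>e\<in>out_arcs G w. g \<in> bisection G (head G e) (\<mu> @ [e]) (\<nu> @ [e])"
proof -
  obtain p k q where pkq: "g = (p, k, q)" by (metis prod_cases3)
  have p: "\<And>i. p i \<in> arcs G" "\<And>i. head G (p i) = tail G (p (Suc i))"
    using assms by (auto simp: bisection_def pkq inf_paths_def)
  have s: "p (length \<mu> + i) = q (length \<nu> + i)" for i using assms by (simp add: bisection_def pkq)
  have "p (length \<mu>) \<in> out_arcs G w" using assms p by (simp add: bisection_def pkq out_arcs_def)
  moreover have "g \<in> bisection G (head G (p (length \<mu>))) (\<mu> @ [p (length \<mu>)]) (\<nu> @ [p (length \<mu>)])"
    using assms s [of 0] s [of "Suc _"] p(2) [of "length \<mu>"] by (auto simp: bisection_def pkq nth_append less_Suc_eq)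
  ultimately show ?thesis by blast
qed

text \<open>Koenig's lemma: a basic set without finite subcover has a branch of such sets, which shrink to a point.\<close>

lemma compactin_bisection:
  assumes rf: "row_finite G" and wf: "wf_digraph G"
  shows "compactin (groupoid_topology G) (bisection G w \<mu> \<nu>)"
  unfolding compactin_def topspace_groupoid_topology
proof (intro conjI allI impI bisection_subset)
  fix \<U> assume \<U>: "Ball \<U> (openin (groupoid_topology G)) \<and> bisection G w \<mu> \<nu> \<subseteq> \<Union>\<U>"
  define fin where "fin = (\<lambda>S. \<exists>\<F>. finite \<F> \<and> \<F> \<subseteq> \<U> \<and> S \<subseteq> \<Union>\<F>)"
  show "\<exists>\<F>. finite \<F> \<and> \<F> \<subseteq> \<U> \<and> bisection G w \<mu> \<nu> \<subseteq> \<Union>\<F>"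
  proof (rule ccontr)
    assume neg: "\<not> ?thesis"
    define S where "S = (\<lambda>(w, \<mu>, \<nu>). bisection G w \<mu> \<nu>)"
    define R where "R = (\<lambda>(w, \<mu>, \<nu>) y. \<exists>e\<in>out_arcs G w. y = (head G e, \<mu> @ [e], \<nu> @ [e]))"
    have fin_empty: "S x \<noteq> {}" if "\<not> fin (S x)" for x
    proof
      assume "S x = {}"
      then have "fin (S x)" unfolding fin_def by (intro exI [of _ "{}"]) auto
      then show False using that by blast
    qed
    have step: "\<exists>y. \<not> fin (S y) \<and> R x y" if nf: "\<not> fin (S x)" for x
    proof (rule ccontr)
      assume no: "\<not> ?thesis"
      obtain w \<mu> \<nu> where x: "x = (w, \<mu>, \<nu>)" by (metis prod_cases3)
      have w: "w \<in> verts G"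
      proof -
        obtain p k q where "(p, k, q) \<in> bisection G w \<mu> \<nu>" using fin_empty [OF nf] unfolding S_def x case_prod_conv
          by (metis ex_in_conv prod_cases3)
        then have "p (length \<mu>) \<in> arcs G" "tail G (p (length \<mu>)) = w" by (auto simp: bisection_def inf_paths_def)
        then show ?thesis using wf_digraph.tail_in_verts [OF wf] by blast
      qed
      have "\<exists>\<F>. finite \<F> \<and> \<F> \<subseteq> \<U> \<and> bisection G (head G e) (\<mu> @ [e]) (\<nu> @ [e]) \<subseteq> \<Union>\<F>"
        if "e \<in> out_arcs G w" for e
      proof -
        have "R x (head G e, \<mu> @ [e], \<nu> @ [e])" using that by (auto simp: R_def x)
        then have "fin (S (head G e, \<mu> @ [e], \<nu> @ [e]))" using no by blast
        then show ?thesis by (simp add: fin_def S_def)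
      qed
      then have "\<forall>e\<in>out_arcs G w. \<exists>\<F>. finite \<F> \<and> \<F> \<subseteq> \<U> \<and> bisection G (head G e) (\<mu> @ [e]) (\<nu> @ [e]) \<subseteq> \<Union>\<F>"
        by (intro ballI)
      from bchoice [OF this] obtain \<F> where F0: "\<forall>e\<in>out_arcs G w. finite (\<F> e) \<and> \<F> e \<subseteq> \<U> \<and>
          bisection G (head G e) (\<mu> @ [e]) (\<nu> @ [e]) \<subseteq> \<Union>(\<F> e)" by (elim exE)
      note F = F0 [THEN bspec]
      note F1 = F [THEN conjunct1] and F2 = F [THEN conjunct2, THEN conjunct1]
        and F3 = F [THEN conjunct2, THEN conjunct2]
      have "finite (out_arcs G w)" using rf w unfolding row_finite_def by blast
      then have "finite (\<Union>e\<in>out_arcs G w. \<F> e)" by (rule finite_UN_I) (rule F1)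
      moreover have "(\<Union>e\<in>out_arcs G w. \<F> e) \<subseteq> \<U>" by (rule UN_least) (rule F2)
      moreover have "bisection G w \<mu> \<nu> \<subseteq> \<Union>(\<Union>e\<in>out_arcs G w. \<F> e)"
      proof
        fix g assume "g \<in> bisection G w \<mu> \<nu>"
        from bisection_split [OF this] obtain e
          where "e \<in> out_arcs G w" "g \<in> bisection G (head G e) (\<mu> @ [e]) (\<nu> @ [e])" by blast
        then have "g \<in> \<Union>(\<F> e)" using F3 [of e] by (rule_tac subsetD)
        moreover have "\<Union>(\<F> e) \<subseteq> \<Union>(\<Union>e\<in>out_arcs G w. \<F> e)"
          using \<open>e \<in> out_arcs G w\<close> by (intro Union_mono UN_upper)
        ultimately show "g \<in> \<Union>(\<Union>e\<in>out_arcs G w. \<F> e)" by (rule rev_subsetD)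
      qed
      ultimately have "fin (S x)" unfolding fin_def S_def x case_prod_conv
        by (intro exI [of _ "\<Union>e\<in>out_arcs G w. \<F> e"] conjI)
      then show False using nf by blast
    qed
    have "\<not> fin (S (w, \<mu>, \<nu>))" using neg by (simp add: S_def fin_def)
    then have "\<exists>X. \<forall>n. (\<not> fin (S (X n)) \<and> (n = 0 \<longrightarrow> X n = (w, \<mu>, \<nu>))) \<and> R (X n) (X (Suc n))"
      by (intro dependent_nat_choice) (use step in auto)
    then obtain X where X: "X 0 = (w, \<mu>, \<nu>)" "\<And>n. \<not> fin (S (X n))" "\<And>n. R (X n) (X (Suc n))"
      by blast
    define W where "W = (\<lambda>n. fst (X n))"
    define A where "A = (\<lambda>n. fst (snd (X n)))"
    define B where "B = (\<lambda>n. snd (snd (X n)))"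
    have SX: "S (X n) = bisection G (W n) (A n) (B n)" for n by (simp add: S_def W_def A_def B_def case_prod_unfold)
    have ext: "\<exists>e\<in>out_arcs G (W n). W (Suc n) = head G e \<and> A (Suc n) = A n @ [e] \<and> B (Suc n) = B n @ [e]" for n
      using X(3) [of n] by (auto simp: R_def W_def A_def B_def case_prod_unfold)
    have chain: "bisection G (W (n + j)) (A (n + j)) (B (n + j)) \<subseteq> bisection G (W n) (A n) (B n)" for n j
    proof (induction j)
      case (Suc j)
      obtain e where e: "e \<in> out_arcs G (W (n + j))" "W (Suc (n + j)) = head G e"
        "A (Suc (n + j)) = A (n + j) @ [e]" "B (Suc (n + j)) = B (n + j) @ [e]" using ext by blast
      then have "bisection G (W (Suc (n + j))) (A (Suc (n + j))) (B (Suc (n + j))) \<subseteq> bisection G (W (n + j)) (A (n + j)) (B (n + j))"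
        by (simp add: bisection_extend out_arcs_def)
      then show ?case using Suc by simp
    qed simp
    have len: "length (A n) = length \<mu> + n" "length (B n) = length \<nu> + n" for n
    proof -
      have "length (A n) = length \<mu> + n \<and> length (B n) = length \<nu> + n"
      proof (induction n)
        case 0 then show ?case by (simp add: A_def B_def X)
      next
        case (Suc n) then show ?case using ext [of n] by auto
      qed
      then show "length (A n) = length \<mu> + n" "length (B n) = length \<nu> + n" by auto
    qed
    \<comment> \<open>Letter \<open>i\<close> is taken from stage \<open>Suc i\<close>, by which the
      word has more than \<open>i\<close> letters even if \<mu> is empty.\<close>
    define p where "p = (\<lambda>i. A (Suc i) ! i)"
    define q where "q = (\<lambda>i. B (Suc i) ! i)"
    define k where "k = int (length \<mu>) - int (length \<nu>)"
    have pre: "A (n + j) ! i = A n ! i" if "i < length (A n)" for i n j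
    proof (induction j)
      case (Suc j)
      have "i < length (A (n + j))" using that by (simp add: len)
      then show ?case using ext [of "n + j"] Suc by (auto simp: nth_append)
    qed simp
    have pre': "B (n + j) ! i = B n ! i" if "i < length (B n)" for i n j
    proof (induction j)
      case (Suc j)
      have "i < length (B (n + j))" using that by (simp add: len)
      then show ?case using ext [of "n + j"] Suc by (auto simp: nth_append)
    qed simp
    have pA: "p i = A n ! i" if "i < length (A n)" for i n
      using pre [of i "Suc i" n] pre [of i n "Suc i"] that by (simp add: p_def len add.commute)
    have qB: "q i = B n ! i" if "i < length (B n)" for i n
      using pre' [of i "Suc i" n] pre' [of i n "Suc i"] that by (simp add: q_def len add.commute)
    \<comment> \<open>No set of the chain is empty, as the empty set has a finite subcover. Its
      members agree with the limit arrow on a long prefix, so every condition on the limit is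
      checked one index at a time on such a member.\<close>
    have wit: "\<exists>p1 q1. (p1, k, q1) \<in> bisection G (W n) (A n) (B n) \<and> (\<forall>i<n. p1 i = p i \<and> q1 i = q i)" for n
    proof -
      obtain p1 k1 q1 where g: "(p1, k1, q1) \<in> bisection G (W n) (A n) (B n)"
        using fin_empty [OF X(2) [of n]] unfolding SX by (auto simp: ex_in_conv [symmetric])
      then have "k1 = k" by (simp add: bisection_def len k_def)
      moreover have "\<forall>i<n. p1 i = p i \<and> q1 i = q i" using g pA [of _ n] qB [of _ n] by (simp add: bisection_def len)
      ultimately show ?thesis using g by blast
    qed
    have pq: "p \<in> inf_paths G \<and> q \<in> inf_paths G"
    proof -
      have "p i \<in> arcs G \<and> head G (p i) = tail G (p (Suc i)) \<and> q i \<in> arcs G \<and> head G (q i) = tail G (q (Suc i))" for i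
      proof -
        obtain p1 q1 where g: "(p1, k, q1) \<in> bisection G (W (i + 2)) (A (i + 2)) (B (i + 2))"
          "\<forall>j<i + 2. p1 j = p j \<and> q1 j = q j" using wit by blast
        then have "p1 \<in> inf_paths G" "q1 \<in> inf_paths G" by (auto simp: bisection_def)
        then have "p1 i \<in> arcs G" "head G (p1 i) = tail G (p1 (Suc i))"
          "q1 i \<in> arcs G" "head G (q1 i) = tail G (q1 (Suc i))" by (simp_all add: inf_paths_def)
        moreover have "p1 i = p i" "q1 i = q i" "p1 (Suc i) = p (Suc i)" "q1 (Suc i) = q (Suc i)"
          using g(2) by simp_all
        ultimately show ?thesis by simp
      qed
      then show ?thesis by (simp add: inf_paths_def)
    qed
    have mem: "(p, k, q) \<in> bisection G (W n) (A n) (B n)" for n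
    proof -
      have "p (length (A n) + i) = q (length (B n) + i) \<and> tail G (p (length (A n))) = W n" for i
      proof -
        define N where "N = n + length \<mu> + length \<nu> + i + 1"
        obtain p1 q1 where g: "(p1, k, q1) \<in> bisection G (W (n + N)) (A (n + N)) (B (n + N))"
          "\<forall>j<n + N. p1 j = p j \<and> q1 j = q j" using wit by blast
        then have "(p1, k, q1) \<in> bisection G (W n) (A n) (B n)" using chain by blast
        then have "p1 (length (A n) + i) = q1 (length (B n) + i)" "tail G (p1 (length (A n))) = W n"
          by (simp_all add: bisection_def)
        moreover have "length (A n) + i < n + N" "length (B n) + i < n + N" by (simp_all add: len N_def)
        ultimately show ?thesis using g(2) by simp
      qed
      then show ?thesis using pq pA qB by (auto simp: bisection_def k_def len)
    qed
    then have "(p, k, q) \<in> bisection G w \<mu> \<nu>" using mem [of 0] by (simp add: W_def A_def B_def X)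
    then obtain U where U: "U \<in> \<U>" "(p, k, q) \<in> U" using \<U> by blast
    then have "openin (groupoid_topology G) U" using \<U> by auto
    then obtain w' \<mu>' \<nu>' where Z': "(p, k, q) \<in> bisection G w' \<mu>' \<nu>'" "bisection G w' \<mu>' \<nu>' \<subseteq> U"
      using U(2) by (rule openin_groupoid_basis)
    \<comment> \<open>At this stage the first word is at least as long as \<open>\<mu>'\<close>, so
      the set lies inside a single member of the cover.\<close>
    have "S (X (length \<mu>')) \<subseteq> U"
      using bisection_nested [OF Z'(1) mem [of "length \<mu>'"]] Z'(2) by (simp add: SX len)
    then have "fin (S (X (length \<mu>')))" using U(1) unfolding fin_def by (intro exI [of _ "{U}"]) auto
    then show False using X(2) by blast
  qed
qed

text \<open>Around an arrow outside, choose a bisection with at least as long a first word: meeting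
  the given set would mean being contained in it.\<close>

lemma closedin_bisection: "closedin (groupoid_topology G) (bisection G w \<mu> \<nu>)"
  unfolding closedin_def topspace_groupoid_topology
proof (intro conjI bisection_subset openin_groupoidI)
  fix g assume g: "g \<in> groupoid G - bisection G w \<mu> \<nu>"
  then have "g \<in> topspace (groupoid_topology G)" by (simp add: topspace_groupoid_topology)
  with openin_topspace obtain w' \<mu>' \<nu>' where Z': "g \<in> bisection G w' \<mu>' \<nu>'" "length \<mu> \<le> length \<mu>'"
    by (rule openin_groupoid_basis)
  have "bisection G w' \<mu>' \<nu>' \<inter> bisection G w \<mu> \<nu> = {}"
  proof (rule ccontr)
    assume "bisection G w' \<mu>' \<nu>' \<inter> bisection G w \<mu> \<nu> \<noteq> {}"
    then obtain h where "h \<in> bisection G w' \<mu>' \<nu>'" "h \<in> bisection G w \<mu> \<nu>" by auto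
    then have "bisection G w' \<mu>' \<nu>' \<subseteq> bisection G w \<mu> \<nu>" using bisection_nested Z'(2) by metis
    then show False using g Z' by auto
  qed
  then show "\<exists>w' \<mu>' \<nu>'. g \<in> bisection G w' \<mu>' \<nu>' \<and> bisection G w' \<mu>' \<nu>' \<subseteq> groupoid G - bisection G w \<mu> \<nu>"
    using Z'(1) bisection_subset [of G w' \<mu>' \<nu>'] by (intro exI [of _ w'] exI [of _ \<mu>'] exI [of _ \<nu>']) auto
qed blast

text \<open>A new set is either contained in one already chosen, or it replaces the chosen sets that
  it contains and is disjoint from the others. Disjointness later makes sums over the family
  pointwise trivial, which a mere finite cover would not do.\<close>

lemma nested_disjoint_refinement:
  assumes nest: "\<And>i j. S i \<inter> S j = {} \<or> S i \<subseteq> S j \<or> S j \<subseteq> S i" and "finite I"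
  shows "\<exists>J\<subseteq>I. pairwise (\<lambda>i j. S i \<inter> S j = {}) J \<and> (\<Union>i\<in>J. S i) = (\<Union>i\<in>I. S i)"
  using \<open>finite I\<close>
proof (induction I rule: finite_induct)
  case (insert x I)
  obtain J where J: "J \<subseteq> I" "pairwise (\<lambda>i j. S i \<inter> S j = {}) J" "(\<Union>i\<in>J. S i) = (\<Union>i\<in>I. S i)"
    using insert.IH by blast
  show ?case
  proof (cases "\<exists>j\<in>J. S x \<subseteq> S j")
    case True
    then have "(\<Union>i\<in>J. S i) = (\<Union>i\<in>insert x I. S i)"
      unfolding UN_insert J(3) [symmetric] by blast
    then show ?thesis using J(1,2) by (intro exI [of _ J]) auto
  next
    case False
    define J' where "J' = insert x {j \<in> J. \<not> S j \<subseteq> S x}"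
    have 1: "J' \<subseteq> insert x I" using J by (auto simp: J'_def)
    have dx: "S j \<inter> S x = {}" if "j \<in> J" "\<not> S j \<subseteq> S x" for j
      using nest [of j x] that False by auto
    have 2: "pairwise (\<lambda>i j. S i \<inter> S j = {}) J'"
      using J(2) dx unfolding J'_def pairwise_def by (auto simp: Int_commute)
    have "(\<Union>i\<in>J. S i) \<subseteq> (\<Union>i\<in>J'. S i)" by (auto simp: J'_def)
    moreover have "(\<Union>i\<in>J'. S i) \<subseteq> (\<Union>i\<in>insert x J. S i)" by (intro UN_mono) (auto simp: J'_def)
    moreover have "S x \<subseteq> (\<Union>i\<in>J'. S i)" by (auto simp: J'_def)
    ultimately have 3: "(\<Union>i\<in>J'. S i) = (\<Union>i\<in>insert x I. S i)"
      unfolding UN_insert J(3) [symmetric] by auto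
    show ?thesis using 1 2 3 by (intro exI [of _ J'] conjI)
  qed
qed (auto simp: pairwise_def)

lemma bisection_disjoint_refinement:
  assumes "finite I"
  shows "\<exists>J\<subseteq>I. pairwise (\<lambda>i j. (\<lambda>(w, \<mu>, \<nu>). bisection G w \<mu> \<nu>) i \<inter> (\<lambda>(w, \<mu>, \<nu>). bisection G w \<mu> \<nu>) j = {}) J \<and>
    (\<Union>(w, \<mu>, \<nu>)\<in>J. bisection G w \<mu> \<nu>) = (\<Union>(w, \<mu>, \<nu>)\<in>I. bisection G w \<mu> \<nu>)"
proof (rule nested_disjoint_refinement [OF _ assms])
  define S where "S = (\<lambda>(w, \<mu>, \<nu>). bisection G w \<mu> \<nu>)"
  fix i j
  have "S i \<inter> S j = {} \<or> S i \<subseteq> S j \<or> S j \<subseteq> S i"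
  proof (cases "S i \<inter> S j = {}")
    case False
    then obtain h where h: "h \<in> S i" "h \<in> S j" by auto
    obtain w \<mu> \<nu> w' \<mu>' \<nu>' where ij: "i = (w, \<mu>, \<nu>)" "j = (w', \<mu>', \<nu>')" by (metis prod_cases3)
    show ?thesis
      using bisection_nested [of h G w \<mu> \<nu> w' \<mu>' \<nu>'] bisection_nested [of h G w' \<mu>' \<nu>' w \<mu> \<nu>] h
      by (cases "length \<mu> \<le> length \<mu>'") (auto simp: S_def ij)
  qed simp
  then show "(\<lambda>(w, \<mu>, \<nu>). bisection G w \<mu> \<nu>) i \<inter> (\<lambda>(w, \<mu>, \<nu>). bisection G w \<mu> \<nu>) j = {} \<or>
    (\<lambda>(w, \<mu>, \<nu>). bisection G w \<mu> \<nu>) i \<subseteq> (\<lambda>(w, \<mu>, \<nu>). bisection G w \<mu> \<nu>) j \<or>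
    (\<lambda>(w, \<mu>, \<nu>). bisection G w \<mu> \<nu>) j \<subseteq> (\<lambda>(w, \<mu>, \<nu>). bisection G w \<mu> \<nu>) i"
    by (simp only: S_def)
qed

section \<open>Compactly supported functions\<close>

lemma Cc_add: "f \<in> Cc X \<Longrightarrow> h \<in> Cc X \<Longrightarrow> (\<lambda>x. f x + h x) \<in> Cc X"
proof -
  assume f: "f \<in> Cc X" and h: "h \<in> Cc X"
  let ?S = "\<lambda>f. X closure_of {x \<in> topspace X. f x \<noteq> (0::complex)}"
  have "compactin X (?S f \<union> ?S h)" using f h by (auto simp: Cc_def intro: compactin_Un)
  moreover have "?S (\<lambda>x. f x + h x) \<subseteq> ?S f \<union> ?S h"
    unfolding closure_of_Un [symmetric] by (rule closure_of_mono) auto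
  ultimately have "compactin X (?S (\<lambda>x. f x + h x))"
    by (rule closed_compactin) simp
  then show ?thesis using f h by (auto simp: Cc_def intro: continuous_intros)
qed

lemma Cc_cmult: "f \<in> Cc X \<Longrightarrow> (\<lambda>x. c * f x) \<in> Cc X"
proof -
  assume f: "f \<in> Cc X"
  let ?S = "\<lambda>f. X closure_of {x \<in> topspace X. f x \<noteq> (0::complex)}"
  have "?S (\<lambda>x. c * f x) \<subseteq> ?S f" by (rule closure_of_mono) auto
  then have "compactin X (?S (\<lambda>x. c * f x))"
    using f closed_compactin [of X "?S f" "?S (\<lambda>x. c * f x)"] by (simp add: Cc_def)
  moreover have "continuous_map X euclidean (\<lambda>x. c * f x)"
  proof -
    have "continuous_map euclidean euclidean (\<lambda>z. c * z)" by (simp add: continuous_intros)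
    then show ?thesis using continuous_map_compose [of X euclidean f euclidean "\<lambda>z. c * z"] f
      by (simp add: Cc_def o_def)
  qed
  ultimately show ?thesis using f by (auto simp: Cc_def)
qed

lemma Cc_zero: "(\<lambda>x. 0) \<in> Cc X"
  by (auto simp: Cc_def)

lemma Cc_indicator_bisection:
  assumes rf: "row_finite G" and wf: "wf_digraph G"
  shows "(indicator (bisection G w \<mu> \<nu>) :: _ \<Rightarrow> complex) \<in> Cc (groupoid_topology G)"
proof -
  let ?X = "groupoid_topology G" and ?Z = "bisection G w \<mu> \<nu>"
  have "continuous_map ?X euclidean (indicator ?Z :: _ \<Rightarrow> complex)"
    unfolding continuous_map
  proof (intro conjI allI impI)
    fix U :: "complex set"
    have "{x \<in> topspace ?X. indicator ?Z x \<in> U} =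
      (if 1 \<in> U then if 0 \<in> U then topspace ?X else ?Z else if 0 \<in> U then topspace ?X - ?Z else {})"
      using bisection_subset [of G w \<mu> \<nu>] by (auto simp: topspace_groupoid_topology indicator_def)
    moreover have "openin ?X (topspace ?X - ?Z)" using closedin_bisection [of G w \<mu> \<nu>] by (simp add: closedin_def)
    ultimately show "openin ?X {x \<in> topspace ?X. indicator ?Z x \<in> U}"
      using openin_bisection by auto
  qed auto
  moreover have "{x \<in> topspace ?X. (indicator ?Z x :: complex) \<noteq> 0} = ?Z"
    using bisection_subset [of G w \<mu> \<nu>] by (auto simp: topspace_groupoid_topology indicator_def)
  moreover have "?X closure_of ?Z = ?Z" by (simp add: closure_of_closedin closedin_bisection)
  moreover have "indicator ?Z x = (0::complex)" if "x \<notin> groupoid G" for x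
    using that bisection_subset [of G w \<mu> \<nu>] by (auto simp: indicator_def)
  ultimately show ?thesis
    using compactin_bisection [OF rf wf] unfolding Cc_def by (simp add: topspace_groupoid_topology)
qed

lemma Cc_local:
  assumes f: "f \<in> Cc (groupoid_topology G)" and g: "g \<in> groupoid G" and e: "e > 0"
  obtains w \<mu> \<nu> where "g \<in> bisection G w \<mu> \<nu>" "length \<mu> \<ge> M" "\<And>h. h \<in> bisection G w \<mu> \<nu> \<Longrightarrow> cmod (f h - f g) < e"
proof -
  have "openin (groupoid_topology G) {x \<in> topspace (groupoid_topology G). f x \<in> ball (f g) e}"
    using f unfolding Cc_def continuous_map by auto
  moreover have "g \<in> {x \<in> topspace (groupoid_topology G). f x \<in> ball (f g) e}"
    using g e by (simp add: topspace_groupoid_topology)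
  ultimately obtain w \<mu> \<nu> where "g \<in> bisection G w \<mu> \<nu>"
    "bisection G w \<mu> \<nu> \<subseteq> {x \<in> topspace (groupoid_topology G). f x \<in> ball (f g) e}" "length \<mu> \<ge> M"
    by (rule openin_groupoid_basis)
  then show ?thesis using that [of w \<mu> \<nu>] by (auto simp: dist_norm norm_minus_commute)
qed

lemma Cc_support:
  assumes f: "f \<in> Cc (groupoid_topology G)"
  obtains I where "finite I" "\<And>g. f g \<noteq> 0 \<Longrightarrow> g \<in> (\<Union>(w, \<mu>, \<nu>)\<in>I. bisection G w \<mu> \<nu>)"
proof -
  let ?X = "groupoid_topology G"
  let ?K = "?X closure_of {x \<in> topspace ?X. f x \<noteq> 0}"
  have K: "compactin ?X ?K" using f by (simp add: Cc_def)
  have sub: "?K \<subseteq> \<Union>(range (\<lambda>(w, \<mu>, \<nu>). bisection G w \<mu> \<nu>))"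
  proof
    fix g assume "g \<in> ?K"
    then have "g \<in> topspace ?X" using K compactin_subset_topspace by blast
    with openin_topspace obtain w \<mu> \<nu> where "g \<in> bisection G w \<mu> \<nu>" by (rule openin_groupoid_basis)
    then show "g \<in> \<Union>(range (\<lambda>(w, \<mu>, \<nu>). bisection G w \<mu> \<nu>))" by (intro UnionI rangeI [of _ "(w, \<mu>, \<nu>)"]) auto
  qed
  have "Ball (range (\<lambda>(w, \<mu>, \<nu>). bisection G w \<mu> \<nu>)) (openin ?X)" by (auto simp: openin_bisection)
  then have "\<exists>\<F>. finite \<F> \<and> \<F> \<subseteq> range (\<lambda>(w, \<mu>, \<nu>). bisection G w \<mu> \<nu>) \<and> ?K \<subseteq> \<Union>\<F>"
    using K sub unfolding compactin_def by blast
  then obtain \<F> where \<F>: "finite \<F>" "\<F> \<subseteq> range (\<lambda>(w, \<mu>, \<nu>). bisection G w \<mu> \<nu>)" "?K \<subseteq> \<Union>\<F>"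
    by blast
  obtain I where I: "finite I" "\<F> = (\<lambda>(w, \<mu>, \<nu>). bisection G w \<mu> \<nu>) ` I"
    using finite_subset_image [OF \<F>(1,2)] by blast
  have "g \<in> ?K" if "f g \<noteq> 0" for g
  proof -
    have "g \<in> topspace ?X" using f that unfolding Cc_def by blast
    then show ?thesis using that closure_of_subset [of "{x \<in> topspace ?X. f x \<noteq> 0}" ?X] by auto
  qed
  then show ?thesis using that [OF I(1)] \<F>(3) I(2) by blast
qed

section \<open>Weighted partial bijections\<close>

definition comp_op :: "'x set \<Rightarrow> ('x \<Rightarrow> 'x) \<Rightarrow> ('x \<Rightarrow> complex) \<Rightarrow> 'x op" where
  "comp_op D \<tau> c = Blinfun (\<lambda>f. Abs_ell2 (\<lambda>x. if x \<in> D then c x * ell2_apply f (\<tau> x) else 0))"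

text \<open>Injectivity of \<tau> on \<open>D\<close> makes the reindexed sum a partial sum of the
  squared norm of \<open>f\<close>; the operator norm is therefore governed by the supremum of the
  weight alone.\<close>

lemma comp_op:
  assumes inj: "inj_on \<tau> D" and c: "\<And>x. x \<in> D \<Longrightarrow> cmod (c x) \<le> C" and C: "C \<ge> 0"
  shows "ell2_apply (comp_op D \<tau> c f) x = (if x \<in> D then c x * ell2_apply f (\<tau> x) else 0)"
    and "norm (comp_op D \<tau> c) \<le> C"
proof -
  define h where "h = (\<lambda>f x. if x \<in> D then c x * ell2_apply f (\<tau> x) else 0)"
  have fin: "(\<Sum>x\<in>F. (cmod (h f x))\<^sup>2) \<le> (C * norm f)\<^sup>2" if F: "finite F" for F f
  proof -
    have "(\<Sum>x\<in>F. (cmod (h f x))\<^sup>2) = (\<Sum>x\<in>F \<inter> D. (cmod (h f x))\<^sup>2)"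
      by (rule sum.mono_neutral_right) (use F in \<open>auto simp: h_def\<close>)
    also have "\<dots> \<le> (\<Sum>x\<in>F \<inter> D. C\<^sup>2 * (cmod (ell2_apply f (\<tau> x)))\<^sup>2)"
    proof (rule sum_mono)
      fix x assume x: "x \<in> F \<inter> D"
      have "(cmod (c x))\<^sup>2 \<le> C\<^sup>2" using c [of x] x by (intro power_mono) auto
      then show "(cmod (h f x))\<^sup>2 \<le> C\<^sup>2 * (cmod (ell2_apply f (\<tau> x)))\<^sup>2"
        using x by (simp add: h_def norm_mult power_mult_distrib mult_right_mono)
    qed
    also have "\<dots> = C\<^sup>2 * (\<Sum>y\<in>\<tau> ` (F \<inter> D). (cmod (ell2_apply f y))\<^sup>2)"
      by (subst sum.reindex) (use inj in \<open>auto simp: sum_distrib_left inj_on_def\<close>)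
    also have "\<dots> \<le> C\<^sup>2 * (norm f)\<^sup>2"
      by (intro mult_left_mono norm_ell2_sum_le) (use F in auto)
    finally show ?thesis by (simp add: power_mult_distrib)
  qed
  have a: "ell2_apply (Abs_ell2 (h f)) = h f" and n: "norm (Abs_ell2 (h f)) \<le> C * norm f" for f
    using ell2_boundedI [of "h f" "C * norm f", OF fin] C by auto
  have bl: "bounded_linear (\<lambda>f. Abs_ell2 (h f))"
  proof (rule bounded_linear_intro [where K = C])
    show "Abs_ell2 (h (f + g)) = Abs_ell2 (h f) + Abs_ell2 (h g)" for f g
      by (rule ell2_eqI) (simp add: a, simp add: h_def algebra_simps)
    show "Abs_ell2 (h (r *\<^sub>R f)) = r *\<^sub>R Abs_ell2 (h f)" for r f
      by (rule ell2_eqI) (simp add: a, simp add: h_def)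
    show "norm (Abs_ell2 (h f)) \<le> norm f * C" for f
      using n by (simp add: mult.commute)
  qed
  have app: "comp_op D \<tau> c f = Abs_ell2 (h f)" for f
    unfolding comp_op_def using bounded_linear_Blinfun_apply [OF bl] by (simp add: h_def)
  show "ell2_apply (comp_op D \<tau> c f) x = (if x \<in> D then c x * ell2_apply f (\<tau> x) else 0)"
    by (simp add: app a) (simp add: h_def)
  show "norm (comp_op D \<tau> c) \<le> C"
    by (rule norm_blinfun_bound) (use C n in \<open>auto simp: app\<close>)
qed

definition partial_bij_op :: "'x set \<Rightarrow> ('x \<Rightarrow> 'x) \<Rightarrow> 'x op" where
  "partial_bij_op D \<tau> = comp_op D \<tau> (\<lambda>_. 1)"

lemma partial_bij_op_apply: "inj_on \<tau> D \<Longrightarrow> ell2_apply (partial_bij_op D \<tau> f) x = (if x \<in> D then ell2_apply f (\<tau> x) else 0)"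
  unfolding partial_bij_op_def by (subst comp_op(1) [of \<tau> D _ 1]) auto

lemma is_adj_partial_bij_op:
  assumes bij: "bij_betw \<tau> D D'" and inv: "\<And>x. x \<in> D \<Longrightarrow> \<tau>' (\<tau> x) = x"
  shows "is_adj (partial_bij_op D \<tau>) (partial_bij_op D' \<tau>')"
  unfolding is_adj_def
proof (intro allI)
  fix f g
  have i: "inj_on \<tau> D" using bij by (rule bij_betw_imp_inj_on)
  have i': "inj_on \<tau>' D'" using bij inv by (intro inj_on_inverseI [where g = \<tau>]) (auto simp: bij_betw_def)
  have "((\<lambda>x. cnj (ell2_apply (partial_bij_op D \<tau> f) x) * ell2_apply g x) has_sum cinner (partial_bij_op D \<tau> f) g) UNIV"
    by (rule cinner_has_sum)
  then have "((\<lambda>x. cnj (ell2_apply f (\<tau> x)) * ell2_apply g (\<tau>' (\<tau> x))) has_sum cinner (partial_bij_op D \<tau> f) g) D"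
    by (rule has_sum_cong_neutral [THEN iffD1, rotated -1]) (auto simp: partial_bij_op_apply [OF i] inv)
  then have "((\<lambda>y. cnj (ell2_apply f y) * ell2_apply g (\<tau>' y)) has_sum cinner (partial_bij_op D \<tau> f) g) D'"
    by (subst has_sum_reindex_bij_betw [OF bij, symmetric])
  then have "((\<lambda>y. cnj (ell2_apply f y) * ell2_apply (partial_bij_op D' \<tau>' g) y) has_sum cinner (partial_bij_op D \<tau> f) g) UNIV"
    by (rule has_sum_cong_neutral [THEN iffD1, rotated -1]) (auto simp: partial_bij_op_apply [OF i'])
  then show "cinner (partial_bij_op D \<tau> f) g = cinner f (partial_bij_op D' \<tau>' g)"
    using cinner_has_sum has_sum_unique by blast
qed

section \<open>The generators\<close>

primrec conc :: "'e list \<Rightarrow> 'e path \<Rightarrow> 'e path" where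
  "conc [] p = p"
| "conc (e # es) p = case_nat e (conc es p)"

lemma conc_nth: "conc es p i = (if i < length es then es ! i else p (i - length es))"
  by (induction es arbitrary: i) (auto split: nat.splits)

lemma shift_conc [simp]: "(shift ^^ length es) (conc es p) = p"
  by (simp add: shift_pow conc_nth)

lemma conc_append: "conc (es @ fs) p = conc es (conc fs p)"
  by (induction es) auto

lemma conc_eq_iff [simp]: "conc es p = conc es q \<longleftrightarrow> p = q"
  by (metis shift_conc)

lemma case_nat_eq_iff [simp]: "case_nat a (p::nat \<Rightarrow> 'e) = case_nat b q \<longleftrightarrow> a = b \<and> p = q"
  by (auto simp: fun_eq_iff split: nat.splits)

lemma conc_shift: "(\<forall>i<length es. p i = es ! i) \<Longrightarrow> conc es ((shift ^^ length es) p) = p"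
  by (auto simp: fun_eq_iff conc_nth shift_pow)

primrec start :: "('v, 'e) pre_digraph \<Rightarrow> 'e list \<Rightarrow> 'v \<Rightarrow> 'v" where
  "start G [] w = w"
| "start G (e # es) w = tail G e"

text \<open>The empty word is a walk at any \<open>w\<close>, vertex or not; generators attached to
  something that is not a vertex vanish by \<open>path_op_zero_verts\<close>.\<close>

primrec walk :: "('v, 'e) pre_digraph \<Rightarrow> 'e list \<Rightarrow> 'v \<Rightarrow> bool" where
  "walk G [] w \<longleftrightarrow> True"
| "walk G (e # es) w \<longleftrightarrow> e \<in> arcs G \<and> head G e = start G es w \<and> walk G es w"

lemma case_nat_inf_paths:
  "case_nat e p \<in> inf_paths G \<longleftrightarrow> e \<in> arcs G \<and> head G e = tail G (p 0) \<and> p \<in> inf_paths G"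
proof
  assume "case_nat e p \<in> inf_paths G"
  then have a: "case_nat e p i \<in> arcs G" "head G (case_nat e p i) = tail G (case_nat e p (Suc i))" for i
    by (auto simp: inf_paths_def)
  show "e \<in> arcs G \<and> head G e = tail G (p 0) \<and> p \<in> inf_paths G"
    using a [of 0] a [of "Suc _"] by (auto simp: inf_paths_def)
next
  assume "e \<in> arcs G \<and> head G e = tail G (p 0) \<and> p \<in> inf_paths G"
  then show "case_nat e p \<in> inf_paths G"
    by (auto simp: inf_paths_def split: nat.splits)
qed

lemma tail_conc: "tail G (conc es p 0) = start G es (tail G (p 0))"
  by (cases es) auto

lemma conc_inf_paths: "conc es p \<in> inf_paths G \<longleftrightarrow> p \<in> inf_paths G \<and> walk G es (tail G (p 0))"
  by (induction es) (auto simp: case_nat_inf_paths tail_conc)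

lemma groupoid_iff:
  "(p, k, q) \<in> groupoid G \<longleftrightarrow> p \<in> inf_paths G \<and> q \<in> inf_paths G \<and>
    (\<exists>n m. k = int n - int m \<and> (\<forall>i. p (n + i) = q (m + i)))"
  by (auto simp: groupoid_def shift_pow fun_eq_iff)

lemma groupoid_swap_prefix_aux:
  assumes "(conc \<mu> p, k, q) \<in> groupoid G" "conc \<nu> p \<in> inf_paths G"
  shows "(conc \<nu> p, k - int (length \<mu>) + int (length \<nu>), q) \<in> groupoid G"
proof -
  obtain n m where nm: "k = int n - int m" "\<And>i. conc \<mu> p (n + i) = q (m + i)"
    using assms unfolding groupoid_iff by blast
  have "conc \<nu> p (n + length \<nu> + i) = q (m + length \<mu> + i)" for i
    using nm(2) [of "length \<mu> + i"] by (simp add: conc_nth add_ac)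
  moreover have "k - int (length \<mu>) + int (length \<nu>) = int (n + length \<nu>) - int (m + length \<mu>)"
    using nm by simp
  ultimately show ?thesis using assms unfolding groupoid_iff by blast
qed

lemma groupoid_swap_prefix:
  "(conc \<mu> p, k, q) \<in> groupoid G \<Longrightarrow> walk G \<nu> (tail G (p 0)) \<Longrightarrow>
    (conc \<nu> p, k - int (length \<mu>) + int (length \<nu>), q) \<in> groupoid G"
  by (rule groupoid_swap_prefix_aux) (auto simp: groupoid_iff conc_inf_paths)

definition op_dom :: "('v, 'e) pre_digraph \<Rightarrow> 'v \<Rightarrow> 'e list \<Rightarrow> 'e list \<Rightarrow> 'e garrow set" where
  "op_dom G w \<mu> \<nu> = {(p, k, q). (p, k, q) \<in> groupoid G \<and> (\<exists>p'. p = conc \<mu> p' \<and> tail G (p' 0) = w) \<and> walk G \<nu> w}"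

text \<open>Only the range side of an arrow changes, as left convolution preserves the source
  fibres. The change of degree records the difference of the two prefix lengths.\<close>

definition swap_prefix :: "'e list \<Rightarrow> 'e list \<Rightarrow> 'e garrow \<Rightarrow> 'e garrow" where
  "swap_prefix \<mu> \<nu> = (\<lambda>(p, k, q). (conc \<nu> ((shift ^^ length \<mu>) p), k - int (length \<mu>) + int (length \<nu>), q))"

lemma swap_prefix_conc [simp]: "swap_prefix \<mu> \<nu> (conc \<mu> p, k, q) = (conc \<nu> p, k - int (length \<mu>) + int (length \<nu>), q)"
  by (simp add: swap_prefix_def)

lemma op_dom_conc: "(conc \<mu> p, k, q) \<in> op_dom G w \<mu> \<nu> \<longleftrightarrow> (conc \<mu> p, k, q) \<in> groupoid G \<and> tail G (p 0) = w \<and> walk G \<nu> w"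
  by (auto simp: op_dom_def)

lemma op_dom_cases:
  assumes "g \<in> op_dom G w \<mu> \<nu>"
  obtains p k q where "g = (conc \<mu> p, k, q)" "(conc \<mu> p, k, q) \<in> groupoid G" "tail G (p 0) = w"
    "walk G \<nu> w" "walk G \<mu> w" "p \<in> inf_paths G"
proof -
  obtain p k q where g: "g = (conc \<mu> p, k, q)" "(conc \<mu> p, k, q) \<in> groupoid G" "tail G (p 0) = w" "walk G \<nu> w"
    using assms by (auto simp: op_dom_def)
  then have "conc \<mu> p \<in> inf_paths G" by (simp add: groupoid_iff)
  then show ?thesis using that g by (simp add: conc_inf_paths)
qed

lemma swap_prefix_dom: "g \<in> op_dom G w \<mu> \<nu> \<Longrightarrow> swap_prefix \<mu> \<nu> g \<in> op_dom G w \<nu> \<mu>"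
  by (erule op_dom_cases) (auto simp: op_dom_conc groupoid_swap_prefix)

lemma swap_prefix_involution: "g \<in> op_dom G w \<mu> \<nu> \<Longrightarrow> swap_prefix \<nu> \<mu> (swap_prefix \<mu> \<nu> g) = g"
  by (erule op_dom_cases) simp

lemma bij_betw_swap_prefix: "bij_betw (swap_prefix \<mu> \<nu>) (op_dom G w \<mu> \<nu>) (op_dom G w \<nu> \<mu>)"
  by (rule bij_betw_byWitness [where f' = "swap_prefix \<nu> \<mu>"]) (auto simp: swap_prefix_involution swap_prefix_dom)

lemma inj_on_swap_prefix: "inj_on (swap_prefix \<mu> \<nu>) (op_dom G w \<mu> \<nu>)"
  using bij_betw_swap_prefix by (rule bij_betw_imp_inj_on)

text \<open>In the usual notation for graph algebras this is \<open>S\<^sub>\<mu> P\<^sub>w S\<^sub>\<nu>\<^sup>*\<close>; it vanishes unless \<open>\<mu>\<close> and \<open>\<nu>\<close> are paths ending at \<open>w\<close>.\<close>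

definition path_op :: "('v, 'e) pre_digraph \<Rightarrow> 'v \<Rightarrow> 'e list \<Rightarrow> 'e list \<Rightarrow> 'e garrow op" where
  "path_op G w \<mu> \<nu> = partial_bij_op (op_dom G w \<mu> \<nu>) (swap_prefix \<mu> \<nu>)"

lemma path_op_apply:
  "ell2_apply (path_op G w \<mu> \<nu> f) g = (if g \<in> op_dom G w \<mu> \<nu> then ell2_apply f (swap_prefix \<mu> \<nu> g) else 0)"
  unfolding path_op_def by (rule partial_bij_op_apply [OF inj_on_swap_prefix])

lemma is_adj_path_op: "is_adj (path_op G w \<mu> \<nu>) (path_op G w \<nu> \<mu>)"
  unfolding path_op_def by (rule is_adj_partial_bij_op [OF bij_betw_swap_prefix swap_prefix_involution])

lemma op_adj_path_op: "op_adj (path_op G w \<mu> \<nu>) = path_op G w \<nu> \<mu>"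
  by (rule op_adj_eq) (rule is_adj_path_op)

section \<open>Multiplication table of the generators\<close>

lemma path_op_composeI:
  assumes "\<And>g. g \<in> op_dom G w \<mu> \<nu> \<Longrightarrow> swap_prefix \<mu> \<nu> g \<in> op_dom G w' \<mu>' \<nu>' \<Longrightarrow>
      g \<in> op_dom G w'' \<mu>'' \<nu>'' \<and> swap_prefix \<mu>' \<nu>' (swap_prefix \<mu> \<nu> g) = swap_prefix \<mu>'' \<nu>'' g"
    and "\<And>g. g \<in> op_dom G w'' \<mu>'' \<nu>'' \<Longrightarrow> g \<in> op_dom G w \<mu> \<nu> \<and> swap_prefix \<mu> \<nu> g \<in> op_dom G w' \<mu>' \<nu>'"
  shows "path_op G w \<mu> \<nu> o\<^sub>L path_op G w' \<mu>' \<nu>' = path_op G w'' \<mu>'' \<nu>''"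
proof (rule blinfun_eqI, rule ell2_eqI)
  fix f g
  show "ell2_apply ((path_op G w \<mu> \<nu> o\<^sub>L path_op G w' \<mu>' \<nu>') f) g = ell2_apply (path_op G w'' \<mu>'' \<nu>'' f) g"
    using assms(1) [of g] assms(2) [of g] by (auto simp: path_op_apply)
qed

lemma path_op_compose_zeroI:
  assumes "\<And>g. g \<in> op_dom G w \<mu> \<nu> \<Longrightarrow> swap_prefix \<mu> \<nu> g \<notin> op_dom G w' \<mu>' \<nu>'"
  shows "path_op G w \<mu> \<nu> o\<^sub>L path_op G w' \<mu>' \<nu>' = 0"
proof (rule blinfun_eqI, rule ell2_eqI)
  fix f g
  show "ell2_apply ((path_op G w \<mu> \<nu> o\<^sub>L path_op G w' \<mu>' \<nu>') f) g = ell2_apply ((0::_ op) f) g"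
    using assms(1) [of g] by (auto simp: path_op_apply)
qed

lemma path_op_zero: "\<not> (walk G \<mu> w \<and> walk G \<nu> w) \<Longrightarrow> path_op G w \<mu> \<nu> = 0"
  by (rule blinfun_eqI, rule ell2_eqI) (auto simp: path_op_apply elim: op_dom_cases)

lemma op_dom_Cons:
  "g \<in> op_dom G w (e # \<mu>) \<nu> \<longleftrightarrow> (\<exists>p k q. g = (case_nat e p, k, q) \<and> e \<in> arcs G \<and> head G e = tail G (p 0) \<and>
     (p, k - 1, q) \<in> op_dom G w \<mu> \<nu>)"
proof
  assume "g \<in> op_dom G w (e # \<mu>) \<nu>"
  then obtain p k q where g: "g = (conc (e # \<mu>) p, k, q)" "(conc (e # \<mu>) p, k, q) \<in> groupoid G" "tail G (p 0) = w"
    "walk G \<nu> w" "walk G (e # \<mu>) w" "p \<in> inf_paths G" by (rule op_dom_cases)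
  have "(conc \<mu> p, k - 1, q) \<in> groupoid G"
    using groupoid_swap_prefix [of "[e]" "conc \<mu> p" k q G "[]"] g by simp
  then show "\<exists>p k q. g = (case_nat e p, k, q) \<and> e \<in> arcs G \<and> head G e = tail G (p 0) \<and> (p, k - 1, q) \<in> op_dom G w \<mu> \<nu>"
    using g by (intro exI [of _ "conc \<mu> p"] exI [of _ k] exI [of _ q]) (auto simp: op_dom_conc tail_conc)
next
  assume "\<exists>p k q. g = (case_nat e p, k, q) \<and> e \<in> arcs G \<and> head G e = tail G (p 0) \<and> (p, k - 1, q) \<in> op_dom G w \<mu> \<nu>"
  then obtain p k q where g: "g = (case_nat e p, k, q)" "e \<in> arcs G" "head G e = tail G (p 0)"
    "(p, k - 1, q) \<in> op_dom G w \<mu> \<nu>" by blast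
  obtain p' where p': "p = conc \<mu> p'" "(conc \<mu> p', k - 1, q) \<in> groupoid G" "tail G (p' 0) = w" "walk G \<nu> w"
    using g(4) by (auto simp: op_dom_def)
  have "(conc (e # \<mu>) p', k, q) \<in> groupoid G"
    using groupoid_swap_prefix [of "[]" "conc \<mu> p'" "k - 1" q G "[e]"] p' g by simp
  then show "g \<in> op_dom G w (e # \<mu>) \<nu>" using g(1) p' by (auto simp: op_dom_def)
qed

lemma swap_prefix_Cons: "swap_prefix (e # \<mu>) \<nu> (case_nat e p, k, q) = swap_prefix \<mu> \<nu> (p, k - 1, q)"
proof -
  have "(shift ^^ length (e # \<mu>)) (case_nat e p) = (shift ^^ length \<mu>) p"
    unfolding shift_pow by (simp add: fun_eq_iff)
  then show ?thesis by (simp add: swap_prefix_def del: funpow.simps)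
qed

lemma path_op_Cons:
  assumes "e \<in> arcs G"
  shows "path_op G (head G e) [e] [] o\<^sub>L path_op G w \<mu> \<nu> = path_op G w (e # \<mu>) \<nu>"
proof (rule path_op_composeI)
  fix g assume g: "g \<in> op_dom G (head G e) [e] []" "swap_prefix [e] [] g \<in> op_dom G w \<mu> \<nu>"
  obtain p k q where pkq: "g = (case_nat e p, k, q)" "head G e = tail G (p 0)"
    using g(1) unfolding op_dom_Cons by blast
  have m: "swap_prefix [e] [] g = (p, k - 1, q)" by (simp add: pkq swap_prefix_Cons) (simp add: swap_prefix_def)
  have "g \<in> op_dom G w (e # \<mu>) \<nu>" using g(2) assms pkq unfolding m op_dom_Cons by blast
  then show "g \<in> op_dom G w (e # \<mu>) \<nu> \<and> swap_prefix \<mu> \<nu> (swap_prefix [e] [] g) = swap_prefix (e # \<mu>) \<nu> g"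
    by (simp add: m) (simp add: pkq swap_prefix_Cons)
next
  fix g assume "g \<in> op_dom G w (e # \<mu>) \<nu>"
  then obtain p k q where pkq: "g = (case_nat e p, k, q)" "head G e = tail G (p 0)" "(p, k - 1, q) \<in> op_dom G w \<mu> \<nu>"
    unfolding op_dom_Cons by blast
  have m: "swap_prefix [e] [] g = (p, k - 1, q)" by (simp add: pkq swap_prefix_Cons) (simp add: swap_prefix_def)
  have "(p, k - 1, q) \<in> op_dom G (head G e) [] []" using pkq by (auto simp: op_dom_def)
  then have "g \<in> op_dom G (head G e) [e] []" unfolding op_dom_Cons using assms pkq by blast
  then show "g \<in> op_dom G (head G e) [e] [] \<and> swap_prefix [e] [] g \<in> op_dom G w \<mu> \<nu>" using pkq m by simp
qed

text \<open>The relation that isometries of distinct edges have orthogonal ranges. The walk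
  condition matters: if \<open>e\<close> does not lead to the start of \<nu>, the product is 0,
  while \<open>path_op G w \<mu> \<nu>\<close> may well be different from 0.\<close>

lemma path_op_compose_edge_Cons:
  assumes "e \<in> arcs G"
  shows "path_op G w \<mu> (f # \<nu>) o\<^sub>L path_op G (head G e) [e] [] = (if f = e \<and> walk G (e # \<nu>) w then path_op G w \<mu> \<nu> else 0)"
proof (cases "f = e \<and> walk G (e # \<nu>) w")
  case True
  have "path_op G w \<mu> (f # \<nu>) o\<^sub>L path_op G (head G e) [e] [] = path_op G w \<mu> \<nu>"
  proof (rule path_op_composeI)
    fix g assume "g \<in> op_dom G w \<mu> (f # \<nu>)"
    then obtain p k q where g: "g = (conc \<mu> p, k, q)" "(conc \<mu> p, k, q) \<in> groupoid G" "tail G (p 0) = w"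
      "walk G (f # \<nu>) w" by (rule op_dom_cases)
    have m: "swap_prefix \<mu> (f # \<nu>) g = (case_nat e (conc \<nu> p), k - int (length \<mu>) + int (length \<nu>) + 1, q)"
      using True by (simp add: g(1))
    show "g \<in> op_dom G w \<mu> \<nu> \<and> swap_prefix [e] [] (swap_prefix \<mu> (f # \<nu>) g) = swap_prefix \<mu> \<nu> g"
      unfolding m swap_prefix_Cons using g by (simp add: op_dom_conc) (simp add: swap_prefix_def)
  next
    fix g assume "g \<in> op_dom G w \<mu> \<nu>"
    then obtain p k q where g: "g = (conc \<mu> p, k, q)" "(conc \<mu> p, k, q) \<in> groupoid G" "tail G (p 0) = w"
      "walk G \<nu> w" by (rule op_dom_cases)
    have d: "g \<in> op_dom G w \<mu> (f # \<nu>)" unfolding g(1) op_dom_conc using g True by simp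
    have m: "swap_prefix \<mu> (f # \<nu>) g = (conc [e] (conc \<nu> p), k - int (length \<mu>) + int (length \<nu>) + 1, q)"
      using True by (simp add: g(1))
    have "swap_prefix \<mu> (f # \<nu>) g \<in> groupoid G" using swap_prefix_dom [OF d] by (auto simp: op_dom_def)
    then have "swap_prefix \<mu> (f # \<nu>) g \<in> op_dom G (head G e) [e] []"
      unfolding m op_dom_conc using True g by (simp add: tail_conc)
    then show "g \<in> op_dom G w \<mu> (f # \<nu>) \<and> swap_prefix \<mu> (f # \<nu>) g \<in> op_dom G (head G e) [e] []" using d by blast
  qed
  then show ?thesis using True by simp
next
  case False
  have "path_op G w \<mu> (f # \<nu>) o\<^sub>L path_op G (head G e) [e] [] = 0"
  proof (rule path_op_compose_zeroI)
    fix g assume "g \<in> op_dom G w \<mu> (f # \<nu>)"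
    then obtain p k q where g: "g = (conc \<mu> p, k, q)" "(conc \<mu> p, k, q) \<in> groupoid G" "tail G (p 0) = w"
      "walk G (f # \<nu>) w" by (rule op_dom_cases)
    then show "swap_prefix \<mu> (f # \<nu>) g \<notin> op_dom G (head G e) [e] []"
      using False by (auto simp: op_dom_def)
  qed
  then show ?thesis unfolding if_not_P [OF False] .
qed

lemma path_op_compose_edge_Nil:
  assumes "e \<in> arcs G"
  shows "path_op G w \<mu> [] o\<^sub>L path_op G (head G e) [e] [] = (if w = tail G e then path_op G (head G e) (\<mu> @ [e]) [] else 0)"
proof (cases "w = tail G e")
  case True
  have "path_op G w \<mu> [] o\<^sub>L path_op G (head G e) [e] [] = path_op G (head G e) (\<mu> @ [e]) []"
  proof (rule path_op_composeI)
    fix g assume "g \<in> op_dom G w \<mu> []" and mg: "swap_prefix \<mu> [] g \<in> op_dom G (head G e) [e] []"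
    then obtain p k q where g: "g = (conc \<mu> p, k, q)" "(conc \<mu> p, k, q) \<in> groupoid G" "tail G (p 0) = w"
      by (auto elim: op_dom_cases)
    obtain p' where p': "p = case_nat e p'" "tail G (p' 0) = head G e"
      using mg by (auto simp: g(1) op_dom_def)
    have c: "conc \<mu> p = conc (\<mu> @ [e]) p'" by (simp add: conc_append p')
    have "g \<in> op_dom G (head G e) (\<mu> @ [e]) []"
      using g(2) p'(2) unfolding g(1) c by (simp only: op_dom_conc) simp
    moreover have "swap_prefix [e] [] (swap_prefix \<mu> [] g) = (p', k - int (length \<mu>) - 1, q)"
      using swap_prefix_conc [of "[e]" "[]" p'] by (simp add: g(1) p')
    moreover have "swap_prefix (\<mu> @ [e]) [] g = (p', k - int (length \<mu>) - 1, q)"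
      unfolding g(1) c swap_prefix_conc by simp
    ultimately show "g \<in> op_dom G (head G e) (\<mu> @ [e]) [] \<and> swap_prefix [e] [] (swap_prefix \<mu> [] g) = swap_prefix (\<mu> @ [e]) [] g"
      by simp
  next
    fix g assume "g \<in> op_dom G (head G e) (\<mu> @ [e]) []"
    then obtain p k q where g: "g = (conc (\<mu> @ [e]) p, k, q)" "(conc (\<mu> @ [e]) p, k, q) \<in> groupoid G"
      "tail G (p 0) = head G e" by (auto elim: op_dom_cases)
    then have g': "g = (conc \<mu> (conc [e] p), k, q)" "(conc \<mu> (conc [e] p), k, q) \<in> groupoid G"
      by (simp_all add: conc_append)
    have d: "g \<in> op_dom G w \<mu> []" unfolding g'(1) op_dom_conc using g'(2) True by simp
    have "swap_prefix \<mu> [] g \<in> groupoid G" using swap_prefix_dom [OF d] by (auto simp: op_dom_def)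
    moreover have m: "swap_prefix \<mu> [] g = (conc [e] p, k - int (length \<mu>), q)" by (simp add: g'(1) del: conc.simps(2))
    ultimately have "swap_prefix \<mu> [] g \<in> op_dom G (head G e) [e] []"
      unfolding m op_dom_conc using g by simp
    then show "g \<in> op_dom G w \<mu> [] \<and> swap_prefix \<mu> [] g \<in> op_dom G (head G e) [e] []" using d by blast
  qed
  then show ?thesis using True by simp
next
  case False
  have "path_op G w \<mu> [] o\<^sub>L path_op G (head G e) [e] [] = 0"
  proof (rule path_op_compose_zeroI)
    fix g assume "g \<in> op_dom G w \<mu> []"
    then obtain p k q where g: "g = (conc \<mu> p, k, q)" "(conc \<mu> p, k, q) \<in> groupoid G" "tail G (p 0) = w"
      by (auto elim: op_dom_cases)
    then show "swap_prefix \<mu> [] g \<notin> op_dom G (head G e) [e] []"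
      using False by (auto simp: op_dom_def)
  qed
  then show ?thesis using False by simp
qed

lemma path_op_vertex: "path_op G v [] [] o\<^sub>L path_op G w \<mu> \<nu> = (if start G \<mu> w = v then path_op G w \<mu> \<nu> else 0)"
proof (cases "start G \<mu> w = v")
  case True
  have "path_op G v [] [] o\<^sub>L path_op G w \<mu> \<nu> = path_op G w \<mu> \<nu>"
  proof (rule path_op_composeI)
    fix g assume "g \<in> op_dom G w \<mu> \<nu>"
    then obtain p k q where g: "g = (conc \<mu> p, k, q)" "(conc \<mu> p, k, q) \<in> groupoid G" "tail G (p 0) = w"
      by (rule op_dom_cases)
    then have "g \<in> op_dom G v [] []" using True by (auto simp: op_dom_def tail_conc)
    moreover have "swap_prefix [] [] g = g" by (simp add: g(1) swap_prefix_def)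
    ultimately show "g \<in> op_dom G v [] [] \<and> swap_prefix [] [] g \<in> op_dom G w \<mu> \<nu>" using \<open>g \<in> op_dom G w \<mu> \<nu>\<close> by simp
  next
    fix g assume g: "g \<in> op_dom G v [] []" "swap_prefix [] [] g \<in> op_dom G w \<mu> \<nu>"
    have "swap_prefix [] [] g = g" by (auto simp: swap_prefix_def split: prod.splits)
    then show "g \<in> op_dom G w \<mu> \<nu> \<and> swap_prefix \<mu> \<nu> (swap_prefix [] [] g) = swap_prefix \<mu> \<nu> g" using g by simp
  qed
  then show ?thesis using True by simp
next
  case False
  have "path_op G v [] [] o\<^sub>L path_op G w \<mu> \<nu> = 0"
  proof (rule path_op_compose_zeroI)
    fix g assume g: "g \<in> op_dom G v [] []"
    have "swap_prefix [] [] g = g" by (auto simp: swap_prefix_def split: prod.splits)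
    then show "swap_prefix [] [] g \<notin> op_dom G w \<mu> \<nu>"
      using g False by (auto simp: op_dom_def tail_conc)
  qed
  then show ?thesis using False by simp
qed

lemma path_op_Nil_compose:
  "path_op G w [] [] o\<^sub>L path_op G w [] \<nu> = path_op G w [] \<nu>" "path_op G w \<mu> [] o\<^sub>L path_op G w [] [] = path_op G w \<mu> []"
proof -
  show *: "path_op G w [] [] o\<^sub>L path_op G w [] \<nu> = path_op G w [] \<nu>" for \<nu> by (simp add: path_op_vertex)
  have "is_adj (path_op G w [] [] o\<^sub>L path_op G w [] \<mu>) (path_op G w \<mu> [] o\<^sub>L path_op G w [] [])"
    by (intro is_adj_simps is_adj_path_op)
  then show "path_op G w \<mu> [] o\<^sub>L path_op G w [] [] = path_op G w \<mu> []"
    unfolding * using is_adj_path_op is_adj_unique by metis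
qed

lemma path_op_factor: "path_op G w \<mu> [] o\<^sub>L path_op G w [] \<nu> = path_op G w \<mu> \<nu>"
proof (induction \<mu>)
  case Nil
  show ?case by (rule path_op_Nil_compose)
next
  case (Cons e \<mu>)
  show ?case
  proof (cases "e \<in> arcs G")
    case True
    have "path_op G w (e # \<mu>) [] o\<^sub>L path_op G w [] \<nu> = path_op G (head G e) [e] [] o\<^sub>L (path_op G w \<mu> [] o\<^sub>L path_op G w [] \<nu>)"
      unfolding path_op_Cons [OF True, of w \<mu> "[]", symmetric] by (rule compose_assoc)
    then show ?thesis by (simp only: Cons path_op_Cons [OF True])
  next
    case False
    then show ?thesis by (simp add: path_op_zero)
  qed
qed

text \<open>The adjoints of the two rules for right multiplication by an edge; uniqueness of
  adjoints spares a second computation with arrows.\<close>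

lemma path_op_edge_adj_compose:
  assumes "e \<in> arcs G"
  shows "path_op G (head G e) [] [e] o\<^sub>L path_op G w (f # \<mu>) \<nu> = (if f = e \<and> walk G (e # \<mu>) w then path_op G w \<mu> \<nu> else 0)"
    and "path_op G (head G e) [] [e] o\<^sub>L path_op G w [] \<nu> = (if w = tail G e then path_op G (head G e) [] (\<nu> @ [e]) else 0)"
proof -
  have "is_adj (path_op G w \<nu> (f # \<mu>) o\<^sub>L path_op G (head G e) [e] []) (path_op G (head G e) [] [e] o\<^sub>L path_op G w (f # \<mu>) \<nu>)"
    by (intro is_adj_simps is_adj_path_op)
  moreover have "is_adj (path_op G w \<nu> (f # \<mu>) o\<^sub>L path_op G (head G e) [e] [])
      (if f = e \<and> walk G (e # \<mu>) w then path_op G w \<mu> \<nu> else 0)"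
    unfolding path_op_compose_edge_Cons [OF assms] by (auto intro: is_adj_path_op is_adj_simps)
  ultimately show "path_op G (head G e) [] [e] o\<^sub>L path_op G w (f # \<mu>) \<nu> = (if f = e \<and> walk G (e # \<mu>) w then path_op G w \<mu> \<nu> else 0)"
    by (rule is_adj_unique)
  have "is_adj (path_op G w \<nu> [] o\<^sub>L path_op G (head G e) [e] []) (path_op G (head G e) [] [e] o\<^sub>L path_op G w [] \<nu>)"
    by (intro is_adj_simps is_adj_path_op)
  moreover have "is_adj (path_op G w \<nu> [] o\<^sub>L path_op G (head G e) [e] [])
      (if w = tail G e then path_op G (head G e) [] (\<nu> @ [e]) else 0)"
    unfolding path_op_compose_edge_Nil [OF assms] by (auto intro: is_adj_path_op is_adj_simps)
  ultimately show "path_op G (head G e) [] [e] o\<^sub>L path_op G w [] \<nu> = (if w = tail G e then path_op G (head G e) [] (\<nu> @ [e]) else 0)"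
    by (rule is_adj_unique)
qed

text \<open>An infinite path starting at \<open>v\<close> has exactly one first edge, so a single
  summand sees a given arrow, and exchanging a prefix for itself changes nothing.\<close>

lemma path_op_vertex_sum:
  fixes G :: "('v, 'e) pre_digraph"
  assumes "finite (out_arcs G v)"
  shows "path_op G v [] [] = (\<Sum>e\<in>out_arcs G v. path_op G (head G e) [e] [e])"
proof (rule blinfun_eqI, rule ell2_eqI)
  fix f :: "'e garrow ell2" and g :: "'e garrow"
  obtain p k q where g: "g = (p, k, q)" by (metis prod_cases3)
  have id: "swap_prefix [] [] g = g" by (simp add: g swap_prefix_def)
  have lin: "ell2_apply (blinfun_apply (sum S I) f) g = (\<Sum>e\<in>I. ell2_apply (blinfun_apply (S e) f) g)" for S :: "_ \<Rightarrow> _ op" and I :: "'e set"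
    by (induction I rule: infinite_finite_induct) (auto simp: blinfun.add_left)
  have d: "g \<in> op_dom G (head G e) [e] [e] \<longleftrightarrow> g \<in> groupoid G \<and> p 0 = e" and
    m: "g \<in> op_dom G (head G e) [e] [e] \<Longrightarrow> swap_prefix [e] [e] g = g" if "e \<in> out_arcs G v" for e
  proof -
    show "g \<in> op_dom G (head G e) [e] [e] \<longleftrightarrow> g \<in> groupoid G \<and> p 0 = e"
    proof
      assume "g \<in> op_dom G (head G e) [e] [e]"
      then show "g \<in> groupoid G \<and> p 0 = e" by (auto simp: op_dom_def g)
    next
      assume a: "g \<in> groupoid G \<and> p 0 = e"
      have "p = case_nat e (\<lambda>i. p (Suc i))" using a by (auto simp: fun_eq_iff split: nat.splits)
      moreover have "tail G (p (Suc 0)) = head G e" using a by (auto simp: g groupoid_iff inf_paths_def)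
      ultimately show "g \<in> op_dom G (head G e) [e] [e]"
        using a that by (auto simp: op_dom_def g)
    qed
    show "g \<in> op_dom G (head G e) [e] [e] \<Longrightarrow> swap_prefix [e] [e] g = g"
      by (erule op_dom_cases) (metis add_diff_cancel_right' diff_add_cancel swap_prefix_conc)
  qed
  have "ell2_apply (blinfun_apply (\<Sum>e\<in>out_arcs G v. path_op G (head G e) [e] [e]) f) g
      = (\<Sum>e\<in>out_arcs G v. if g \<in> groupoid G \<and> p 0 = e then ell2_apply f g else 0)"
    unfolding lin by (intro sum.cong refl) (use d m in \<open>auto simp: path_op_apply\<close>)
  also have "\<dots> = (if g \<in> groupoid G \<and> p 0 \<in> out_arcs G v then ell2_apply f g else 0)"
    using assms by (cases "g \<in> groupoid G") (simp_all del: in_out_arcs_conv)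
  also have "\<dots> = ell2_apply (path_op G v [] [] f) g"
  proof (cases "g \<in> groupoid G")
    case True
    then have "p 0 \<in> arcs G" by (simp add: g groupoid_iff inf_paths_def)
    moreover have "g \<in> op_dom G v [] [] \<longleftrightarrow> tail G (p 0) = v" using True by (simp add: op_dom_def g)
    ultimately show ?thesis using True by (simp add: path_op_apply id)
  next
    case False
    then have "g \<notin> op_dom G v [] []" by (auto simp: op_dom_def)
    then show ?thesis using False by (simp add: path_op_apply)
  qed
  finally show "ell2_apply (path_op G v [] [] f) g = ell2_apply (blinfun_apply (\<Sum>e\<in>out_arcs G v. path_op G (head G e) [e] [e]) f) g"
    by simp
qed

section \<open>The span of the generators\<close>

definition genspan :: "('v, 'e) pre_digraph \<Rightarrow> 'e garrow op set" where
  "genspan G = op.span {path_op G w \<mu> \<nu> | w \<mu> \<nu>. True}"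

lemma path_op_in_genspan: "path_op G w \<mu> \<nu> \<in> genspan G"
  unfolding genspan_def by (rule op.span_base) blast

lemma genspan_induct [consumes 1, case_names zero add scale T]:
  assumes "a \<in> genspan G" "P 0" "\<And>a b. a \<in> genspan G \<Longrightarrow> b \<in> genspan G \<Longrightarrow> P a \<Longrightarrow> P b \<Longrightarrow> P (a + b)"
    "\<And>c a. a \<in> genspan G \<Longrightarrow> P a \<Longrightarrow> P (op_scale c a)" "\<And>w \<mu> \<nu>. P (path_op G w \<mu> \<nu>)"
  shows "P a"
proof -
  have "a \<in> genspan G \<and> P a"
    using assms(1) unfolding genspan_def
  proof (induction rule: op.span_induct_alt)
    case base
    then show ?case using assms(2) op.span_zero by blast
  next
    case (step c x y)
    then obtain w \<mu> \<nu> where x: "x = path_op G w \<mu> \<nu>" by blast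
    have "x \<in> genspan G" "P x" unfolding x using path_op_in_genspan assms(5) by auto
    then have "op_scale c x \<in> genspan G" "P (op_scale c x)"
      using assms(4) unfolding genspan_def by (auto intro: op.span_scale)
    then show ?case using step assms(3) unfolding genspan_def by (auto intro: op.span_add)
  qed
  then show ?thesis by blast
qed

lemma genspan_simps:
  "0 \<in> genspan G" "a \<in> genspan G \<Longrightarrow> b \<in> genspan G \<Longrightarrow> a + b \<in> genspan G"
  "a \<in> genspan G \<Longrightarrow> op_scale c a \<in> genspan G"
  "(\<And>i. i \<in> I \<Longrightarrow> F i \<in> genspan G) \<Longrightarrow> sum F I \<in> genspan G"
  unfolding genspan_def by (auto intro: op.span_zero op.span_add op.span_scale op.span_sum)

lemma genspan_adj: "a \<in> genspan G \<Longrightarrow> \<exists>a'. is_adj a a' \<and> a' \<in> genspan G"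
proof (induction rule: genspan_induct)
  case zero
  show ?case using is_adj_simps(1) genspan_simps(1) by blast
next
  case (add a b)
  then show ?case using is_adj_simps(2) genspan_simps(2) by metis
next
  case (scale c a)
  then show ?case using is_adj_simps(5) genspan_simps(3) by metis
next
  case (T w \<mu> \<nu>)
  show ?case by (rule exI, rule conjI, rule is_adj_path_op, rule path_op_in_genspan)
qed

lemma genspan_left:
  assumes "b \<in> genspan G" and T: "\<And>w \<mu> \<nu>. S o\<^sub>L path_op G w \<mu> \<nu> \<in> genspan G" and S: "is_adj S S'"
  shows "S o\<^sub>L b \<in> genspan G"
  using assms(1)
proof (induction rule: genspan_induct)
  case (add a b)
  then show ?case by (simp add: blinfun_compose_simps genspan_simps)
next
  case (scale c a)
  then show ?case by (simp add: op_scale_compose_right [OF S] genspan_simps)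
qed (auto simp: T genspan_simps)

text \<open>The multiplication table covers only vertices, single edges and their adjoints. Letters
  are peeled off one at a time until the general product is a succession of these.\<close>

lemma genspan_path_op_mult:
  assumes "b \<in> genspan G" shows "path_op G w \<mu> \<nu> o\<^sub>L b \<in> genspan G"
proof -
  have vertex: "path_op G v [] [] o\<^sub>L b \<in> genspan G" if "b \<in> genspan G" for v b
    by (rule genspan_left [OF that _ is_adj_path_op]) (simp add: path_op_vertex path_op_in_genspan genspan_simps)
  have edge: "path_op G (head G e) [e] [] o\<^sub>L b \<in> genspan G" if "b \<in> genspan G" "e \<in> arcs G" for e b
    by (rule genspan_left [OF that(1) _ is_adj_path_op]) (simp add: path_op_Cons [OF that(2)] path_op_in_genspan)
  have edge_adj: "path_op G (head G e) [] [e] o\<^sub>L b \<in> genspan G" if "b \<in> genspan G" "e \<in> arcs G" for e b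
  proof (rule genspan_left [OF that(1) _ is_adj_path_op])
    fix w \<mu> \<nu>
    show "path_op G (head G e) [] [e] o\<^sub>L path_op G w \<mu> \<nu> \<in> genspan G"
      by (cases \<mu>) (simp_all add: path_op_edge_adj_compose [OF that(2)] path_op_in_genspan genspan_simps)
  qed
  have right: "path_op G w [] \<nu> o\<^sub>L b \<in> genspan G" if "b \<in> genspan G" for w \<nu> b
    using that
  proof (induction \<nu> arbitrary: b)
    case Nil
    then show ?case by (rule vertex)
  next
    case (Cons e \<nu>)
    show ?case
    proof (cases "e \<in> arcs G")
      case True
      have "is_adj (path_op G (head G e) [e] [] o\<^sub>L path_op G w \<nu> []) (path_op G w [] \<nu> o\<^sub>L path_op G (head G e) [] [e])"
        by (intro is_adj_simps is_adj_path_op)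
      then have "path_op G w [] (e # \<nu>) = path_op G w [] \<nu> o\<^sub>L path_op G (head G e) [] [e]"
        unfolding path_op_Cons [OF True] using is_adj_path_op is_adj_unique by metis
      then show ?thesis using Cons edge_adj [OF Cons.prems True] by (simp add: compose_assoc)
    next
      case False
      then show ?thesis by (simp add: path_op_zero genspan_simps)
    qed
  qed
  have left: "path_op G w \<mu> [] o\<^sub>L b \<in> genspan G" if "b \<in> genspan G" for w \<mu> b
  proof (induction \<mu>)
    case Nil
    then show ?case by (rule vertex [OF that])
  next
    case (Cons e \<mu>)
    show ?case
    proof (cases "e \<in> arcs G")
      case True
      show ?thesis
        using edge [OF Cons True] unfolding path_op_Cons [OF True, of w \<mu> "[]", symmetric] compose_assoc .
    next
      case False
      then show ?thesis by (simp add: path_op_zero genspan_simps)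
    qed
  qed
  have "path_op G w \<mu> \<nu> o\<^sub>L b = path_op G w \<mu> [] o\<^sub>L (path_op G w [] \<nu> o\<^sub>L b)"
    by (simp add: path_op_factor compose_assoc [symmetric])
  then show ?thesis using left right assms by simp
qed

lemma genspan_mult:
  assumes "a \<in> genspan G" "b \<in> genspan G" shows "a o\<^sub>L b \<in> genspan G"
  using assms(1)
proof (induction rule: genspan_induct)
  case (add a b)
  then show ?case by (simp add: blinfun_compose_simps genspan_simps)
next
  case (scale c a)
  then show ?case by (simp add: op_scale_compose_left genspan_simps)
next
  case (T w \<mu> \<nu>)
  show ?case by (rule genspan_path_op_mult [OF assms(2)])
qed (simp add: genspan_simps)

lemma cstar_subalgebra_genspan: "cstar_subalgebra (closure (genspan G))"
proof
  let ?A = "closure (genspan G)"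
  have seq: "\<exists>X. (\<forall>n. X n \<in> genspan G) \<and> X \<longlonglongrightarrow> a" if "a \<in> ?A" for a
    using that unfolding closure_sequential by blast
  show "closed ?A" by simp
  show "0 \<in> ?A" using genspan_simps(1) closure_subset by blast
  show "a + b \<in> ?A" if ab: "a \<in> ?A" "b \<in> ?A" for a b
  proof -
    obtain X Y where "\<forall>n. X n \<in> genspan G" "X \<longlonglongrightarrow> a" "\<forall>n. Y n \<in> genspan G" "Y \<longlonglongrightarrow> b"
      using seq [OF ab(1)] seq [OF ab(2)] by blast
    then show ?thesis unfolding closure_sequential
      by (intro exI [of _ "\<lambda>n. X n + Y n"] conjI allI genspan_simps tendsto_add) auto
  qed
  show "a o\<^sub>L b \<in> ?A" if ab: "a \<in> ?A" "b \<in> ?A" for a b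
  proof -
    obtain X Y where "\<forall>n. X n \<in> genspan G" "X \<longlonglongrightarrow> a" "\<forall>n. Y n \<in> genspan G" "Y \<longlonglongrightarrow> b"
      using seq [OF ab(1)] seq [OF ab(2)] by blast
    then show ?thesis unfolding closure_sequential
      by (intro exI [of _ "\<lambda>n. X n o\<^sub>L Y n"] conjI allI genspan_mult tendsto_compose_op) auto
  qed
  show "op_scale c a \<in> ?A" if a: "a \<in> ?A" for a c
  proof -
    obtain X where X: "\<forall>n. X n \<in> genspan G" "X \<longlonglongrightarrow> a" using seq [OF a] by blast
    have "(\<lambda>n. op_scale c (X n)) \<longlonglongrightarrow> op_scale c a"
      unfolding op_scale_def by (intro tendsto_compose_op tendsto_const X)
    then show ?thesis unfolding closure_sequential
      using X by (intro exI [of _ "\<lambda>n. op_scale c (X n)"] conjI allI genspan_simps) auto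
  qed
  have adj: "\<exists>a'. is_adj a a' \<and> a' \<in> ?A" if a: "a \<in> ?A" for a
  proof -
    obtain X where X: "\<forall>n. X n \<in> genspan G" "X \<longlonglongrightarrow> a" using seq [OF a] by blast
    then have "\<forall>n. \<exists>Y. is_adj (X n) Y \<and> Y \<in> genspan G" using genspan_adj by auto
    from choice [OF this] obtain Y where Y: "\<And>n. is_adj (X n) (Y n)" "\<And>n. Y n \<in> genspan G" by auto
    obtain a' where "Y \<longlonglongrightarrow> a'" "is_adj a a'" by (rule is_adj_limit [OF X(2) Y(1)])
    then show ?thesis unfolding closure_sequential using Y by (intro exI [of _ a'] conjI exI [of _ Y]) auto
  qed
  show "is_adj a (op_adj a)" "op_adj a \<in> ?A" if "a \<in> ?A" for a
    using adj [OF that] op_adj_eq by auto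
qed

section \<open>The regular representation\<close>

text \<open>In the definition of \<open>reg_rep\<close>, \<open>Blinfun\<close> and
  \<open>Abs_ell2\<close> can be evaluated only after boundedness is known. The relation permits an
  operator to be exhibited first and is visibly linear; \<open>rep_reg_rep\<close> then identifies
  it with the regular representation.\<close>

definition represents :: "('v, 'e) pre_digraph \<Rightarrow> ('e garrow \<Rightarrow> complex) \<Rightarrow> 'e garrow op \<Rightarrow> bool" where
  "represents G f B \<longleftrightarrow> (\<forall>\<xi> g. if g \<in> groupoid G
     then ((\<lambda>h. f h * ell2_apply \<xi> (gmult (ginv h) g)) has_sum ell2_apply (B \<xi>) g)
       {h \<in> groupoid G. grange h = grange g}
     else ell2_apply (B \<xi>) g = 0)"

lemma repI:
  fixes B :: "'e garrow op"
  assumes "\<And>\<xi> g. g \<in> groupoid G \<Longrightarrow>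
      ((\<lambda>h. f h * ell2_apply \<xi> (gmult (ginv h) g)) has_sum ell2_apply (B \<xi>) g)
       {h \<in> groupoid G. grange h = grange g}"
    and "\<And>\<xi> g. g \<notin> groupoid G \<Longrightarrow> ell2_apply (B \<xi>) g = 0"
  shows "represents G f B"
  unfolding represents_def by (intro allI) (simp add: assms)

lemma repD:
  assumes "represents G f B"
  shows "g \<in> groupoid G \<Longrightarrow>
      ((\<lambda>h. f h * ell2_apply \<xi> (gmult (ginv h) g)) has_sum ell2_apply (B \<xi>) g)
       {h \<in> groupoid G. grange h = grange g}"
    and "g \<notin> groupoid G \<Longrightarrow> ell2_apply (B \<xi>) g = 0"
  using spec [OF spec [OF assms [unfolded represents_def], of \<xi>], of g] by simp_all

lemma rep_reg_rep: assumes "represents G f B" shows "reg_rep G f = B"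
proof -
  have "(\<lambda>g. if g \<in> groupoid G
     then \<Sum>\<^sub>\<infinity>h\<in>{h \<in> groupoid G. grange h = grange g}. f h * ell2_apply \<xi> (gmult (ginv h) g)
     else 0) = ell2_apply (B \<xi>)" for \<xi>
    using repD [OF assms] by (auto simp: fun_eq_iff intro: infsumI)
  then show ?thesis by (simp add: reg_rep_def ell2_apply_inverse blinfun_apply_inverse)
qed

lemma rep_unique: "represents G f B \<Longrightarrow> represents G f B' \<Longrightarrow> B = B'"
  using rep_reg_rep by metis

lemma rep_add: assumes "represents G f B" "represents G f' B'" shows "represents G (\<lambda>h. f h + f' h) (B + B')"
  by (rule repI)
    (use repD [OF assms(1)] repD [OF assms(2)] in \<open>auto simp: blinfun.add_left distrib_right intro: has_sum_add\<close>)

lemma rep_scale: assumes "represents G f B" shows "represents G (\<lambda>h. c * f h) (op_scale c B)"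
  by (rule repI) (use repD [OF assms] in \<open>auto simp: mult.assoc intro: has_sum_cmult_right\<close>)

lemma rep_diff: assumes "represents G f B" "represents G f' B'" shows "represents G (\<lambda>h. f h - f' h) (B - B')"
  using rep_add [OF assms(1) rep_scale [OF assms(2), of "- 1"]] by simp

lemma rep_zero: "represents G (\<lambda>h. 0) 0"
  by (rule repI) auto

lemma rep_sum:
  "finite I \<Longrightarrow> (\<And>i. i \<in> I \<Longrightarrow> represents G (f i) (B i)) \<Longrightarrow> represents G (\<lambda>h. \<Sum>i\<in>I. f i h) (sum B I)"
  by (induction I rule: finite_induct) (auto intro: rep_zero rep_add)

lemma bisection_conc:
  "(p, k, q) \<in> bisection G w \<mu> \<nu> \<longleftrightarrow> k = int (length \<mu>) - int (length \<nu>) \<and> p \<in> inf_paths G \<and> q \<in> inf_paths G \<and>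
     (\<exists>p'. p = conc \<mu> p' \<and> q = conc \<nu> p' \<and> tail G (p' 0) = w)"
proof
  assume a: "(p, k, q) \<in> bisection G w \<mu> \<nu>"
  let ?p = "(shift ^^ length \<mu>) p"
  have "p = conc \<mu> ?p" "q = conc \<nu> ((shift ^^ length \<nu>) q)"
    using a by (auto simp: bisection_def intro!: conc_shift [symmetric])
  moreover have "(shift ^^ length \<nu>) q = ?p" using a by (simp add: bisection_def shift_pow)
  moreover have "tail G (p (length \<mu>)) = w" using a unfolding bisection_def by blast
  moreover from this have "tail G (?p 0) = w" by (simp add: shift_pow)
  moreover have "k = int (length \<mu>) - int (length \<nu>)" "p \<in> inf_paths G" "q \<in> inf_paths G"
    using a by (simp_all add: bisection_def)
  ultimately show "k = int (length \<mu>) - int (length \<nu>) \<and> p \<in> inf_paths G \<and> q \<in> inf_paths G \<and>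
     (\<exists>p'. p = conc \<mu> p' \<and> q = conc \<nu> p' \<and> tail G (p' 0) = w)" by metis
next
  assume "k = int (length \<mu>) - int (length \<nu>) \<and> p \<in> inf_paths G \<and> q \<in> inf_paths G \<and>
     (\<exists>p'. p = conc \<mu> p' \<and> q = conc \<nu> p' \<and> tail G (p' 0) = w)"
  then show "(p, k, q) \<in> bisection G w \<mu> \<nu>" by (auto simp: bisection_def conc_nth)
qed

text \<open>An arrow in a bisection is determined by its range; this is the value of
  \<open>f\<close> at the arrow with range \<open>p\<close>.\<close>

definition bisection_weight :: "('e garrow \<Rightarrow> complex) \<Rightarrow> 'e list \<Rightarrow> 'e list \<Rightarrow> 'e garrow \<Rightarrow> complex" where
  "bisection_weight f \<mu> \<nu> = (\<lambda>(p, k, q). f (p, int (length \<mu>) - int (length \<nu>), conc \<nu> ((shift ^^ length \<mu>) p)))"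

text \<open>At a given \<open>g\<close> the convolution sum has at most one nonzero term, coming
  from the arrow of the bisection with the same range as \<open>g\<close>.\<close>

lemma rep_bisection:
  fixes G :: "('v, 'e) pre_digraph"
  assumes C: "\<And>h. cmod (f h) \<le> C" and supp: "\<And>h. f h \<noteq> 0 \<Longrightarrow> h \<in> bisection G w \<mu> \<nu>"
  shows "represents G f (comp_op (op_dom G w \<mu> \<nu>) (swap_prefix \<mu> \<nu>) (bisection_weight f \<mu> \<nu>))"
    and "norm (comp_op (op_dom G w \<mu> \<nu>) (swap_prefix \<mu> \<nu>) (bisection_weight f \<mu> \<nu>)) \<le> C"
proof -
  let ?B = "comp_op (op_dom G w \<mu> \<nu>) (swap_prefix \<mu> \<nu>) (bisection_weight f \<mu> \<nu>)"
  have C0: "C \<ge> 0" using C norm_ge_zero order_trans by blast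
  have bw: "cmod (bisection_weight f \<mu> \<nu> x) \<le> C" for x
    unfolding bisection_weight_def by (cases x) (simp add: C)
  note app = comp_op(1) [OF inj_on_swap_prefix bw C0]
  show "norm ?B \<le> C" by (rule comp_op(2) [OF inj_on_swap_prefix bw C0])
  show "represents G f ?B"
  proof (rule repI)
    fix \<xi> :: "'e garrow ell2" and g :: "'e garrow"
    assume g: "g \<in> groupoid G"
    obtain p k q where pkq: "g = (p, k, q)" by (metis prod_cases3)
    let ?S = "{h \<in> groupoid G. grange h = grange g}"
    have form: "\<exists>p'. p = conc \<mu> p' \<and> h = (p, int (length \<mu>) - int (length \<nu>), conc \<nu> p') \<and> g \<in> op_dom G w \<mu> \<nu>"
      if h: "h \<in> ?S" "f h \<noteq> 0" for h
    proof -
      obtain p1 k1 q1 where h1: "h = (p1, k1, q1)" by (metis prod_cases3)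
      have p1: "p1 = p" using h(1) by (simp add: h1 pkq)
      have "h \<in> bisection G w \<mu> \<nu>" by (rule supp [OF h(2)])
      then obtain p' where p': "k1 = int (length \<mu>) - int (length \<nu>)" "q1 \<in> inf_paths G" "p = conc \<mu> p'"
        "q1 = conc \<nu> p'" "tail G (p' 0) = w"
        unfolding h1 bisection_conc p1 by blast
      have "walk G \<nu> w" using p' by (simp add: conc_inf_paths)
      then have "g \<in> op_dom G w \<mu> \<nu>" using g p'(3,5) unfolding pkq by (simp add: op_dom_conc)
      then show ?thesis using p' h1 p1 by blast
    qed
    show "((\<lambda>h. f h * ell2_apply \<xi> (gmult (ginv h) g)) has_sum ell2_apply (?B \<xi>) g) ?S"
    proof (cases "g \<in> op_dom G w \<mu> \<nu>")
      case True
      then obtain p' where p': "p = conc \<mu> p'" "walk G \<nu> w" "tail G (p' 0) = w" "p' \<in> inf_paths G" "walk G \<mu> w"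
        unfolding pkq by (auto elim: op_dom_cases)
      define h0 where "h0 = (p, int (length \<mu>) - int (length \<nu>), conc \<nu> p')"
      have "h0 \<in> bisection G w \<mu> \<nu>" unfolding h0_def bisection_conc using p' by (auto simp: conc_inf_paths)
      then have "h0 \<in> groupoid G" by (rule subsetD [OF bisection_subset])
      then have h0S: "h0 \<in> ?S" by (simp add: h0_def pkq)
      have val: "f h0 * ell2_apply \<xi> (gmult (ginv h0) g) = ell2_apply (?B \<xi>) g"
      proof -
        have "ell2_apply (?B \<xi>) g = bisection_weight f \<mu> \<nu> g * ell2_apply \<xi> (swap_prefix \<mu> \<nu> g)"
          using True by (simp add: app)
        then show ?thesis by (simp add: bisection_weight_def pkq p'(1) h0_def algebra_simps)
      qed
      have "((\<lambda>h. f h * ell2_apply \<xi> (gmult (ginv h) g)) has_sum ell2_apply (?B \<xi>) g) {h0}"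
        using has_sum_finite [of "{h0}" "\<lambda>h. f h * ell2_apply \<xi> (gmult (ginv h) g)"] val by simp
      then show ?thesis
      proof (rule has_sum_cong_neutral [THEN iffD1, rotated -1])
        fix h assume "h \<in> ?S - {h0}"
        then have "f h = 0" using form [of h] p'(1) by (auto simp: h0_def)
        then show "f h * ell2_apply \<xi> (gmult (ginv h) g) = 0" by simp
      qed (use h0S in auto)
    next
      case False
      then have "f h * ell2_apply \<xi> (gmult (ginv h) g) = 0" if "h \<in> ?S" for h
        using form [OF that] by auto
      then have "((\<lambda>h. f h * ell2_apply \<xi> (gmult (ginv h) g)) has_sum 0) ?S" by (rule has_sum_0)
      then show ?thesis using False by (simp add: app)
    qed
  next
    fix \<xi> :: "'e garrow ell2" and g :: "'e garrow"
    assume "g \<notin> groupoid G"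
    then show "ell2_apply (?B \<xi>) g = 0" unfolding app by (auto simp: op_dom_def)
  qed
qed

lemma rep_path_op: "represents G (indicator (bisection G w \<mu> \<nu>)) (path_op G w \<mu> \<nu>)"
proof -
  have "bisection_weight (indicator (bisection G w \<mu> \<nu>)) \<mu> \<nu> x = 1" if x: "x \<in> op_dom G w \<mu> \<nu>" for x
  proof -
    obtain p k q where g: "x = (conc \<mu> p, k, q)" "tail G (p 0) = w" "walk G \<nu> w" "walk G \<mu> w" "p \<in> inf_paths G"
      using x by (rule op_dom_cases)
    then have "(conc \<mu> p, int (length \<mu>) - int (length \<nu>), conc \<nu> p) \<in> bisection G w \<mu> \<nu>"
      unfolding bisection_conc by (auto simp: conc_inf_paths)
    then show ?thesis by (simp add: bisection_weight_def g(1))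
  qed
  then have "comp_op (op_dom G w \<mu> \<nu>) (swap_prefix \<mu> \<nu>) (bisection_weight (indicator (bisection G w \<mu> \<nu>)) \<mu> \<nu>) = path_op G w \<mu> \<nu>"
    unfolding path_op_def partial_bij_op_def comp_op_def by (intro arg_cong [where f = Blinfun] ext arg_cong [where f = Abs_ell2]) auto
  then show ?thesis
    using rep_bisection(1) [of "indicator (bisection G w \<mu> \<nu>)" 1 G w \<mu> \<nu>] by (simp add: indicator_def)
qed

lemma vertex_proj_eq:
  fixes G :: "('v, 'e) pre_digraph"
  shows "vertex_proj G v = path_op G v [] []"
proof -
  have "unit_ext (indicator (paths_from G v)) = indicator (bisection G v [] [])"
  proof
    fix g :: "'e garrow"
    obtain p k q where g: "g = (p, k, q)" by (metis prod_cases3)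
    have "p = q \<longleftrightarrow> (\<forall>i. p i = q i)" by (auto simp: fun_eq_iff)
    then show "unit_ext (indicator (paths_from G v)) g = indicator (bisection G v [] []) g"
      by (auto simp: g unit_ext_def bisection_def paths_from_def indicator_def)
  qed
  then show ?thesis unfolding vertex_proj_def using rep_reg_rep [OF rep_path_op] by simp
qed

text \<open>Local constancy up to \<open>e\<close> and compactness give a finite cover by smaller
  bisections. After the refinement to disjoint sets the sum consists of one constant at each arrow
  of the large bisection.\<close>

lemma simple_approx:
  assumes rf: "row_finite G" and wf: "wf_digraph G" and f: "f \<in> Cc (groupoid_topology G)" and e: "e > 0"
  shows "\<exists>J c. finite J \<and> (\<forall>(w', \<mu>', \<nu>')\<in>J. bisection G w' \<mu>' \<nu>' \<subseteq> bisection G w \<mu> \<nu>) \<and>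
    (\<forall>h. cmod (f h * indicator (bisection G w \<mu> \<nu>) h - (\<Sum>j\<in>J. c j * indicator ((\<lambda>(w, \<mu>, \<nu>). bisection G w \<mu> \<nu>) j) h)) \<le> e)"
proof -
  let ?Z = "bisection G w \<mu> \<nu>"
  define S where "S = (\<lambda>(w, \<mu>, \<nu>). bisection G w \<mu> \<nu>)"
  define I0 where "I0 = {i. S i \<subseteq> ?Z \<and> (\<exists>c. \<forall>h\<in>S i. cmod (f h - c) < e)}"
  have cover: "?Z \<subseteq> \<Union>(S ` I0)"
  proof
    fix g assume g: "g \<in> ?Z"
    have gG: "g \<in> groupoid G" by (rule subsetD [OF bisection_subset g])
    obtain w' \<mu>' \<nu>' where Z': "g \<in> bisection G w' \<mu>' \<nu>'" "length \<mu> \<le> length \<mu>'"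
      "\<And>h. h \<in> bisection G w' \<mu>' \<nu>' \<Longrightarrow> cmod (f h - f g) < e"
      by (rule Cc_local [OF f gG e, of "length \<mu>"], rule that)
    have "S (w', \<mu>', \<nu>') \<subseteq> ?Z" using bisection_nested [OF g Z'(1,2)] by (simp add: S_def)
    moreover have "\<exists>c. \<forall>h\<in>S (w', \<mu>', \<nu>'). cmod (f h - c) < e"
      unfolding S_def case_prod_conv by (intro exI [of _ "f g"] ballI Z'(3))
    ultimately have "(w', \<mu>', \<nu>') \<in> I0" by (simp add: I0_def)
    moreover have "g \<in> S (w', \<mu>', \<nu>')" using Z'(1) by (simp add: S_def)
    ultimately show "g \<in> \<Union>(S ` I0)" by blast
  qed
  have "Ball (S ` I0) (openin (groupoid_topology G))" by (auto simp: S_def openin_bisection)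
  then have "\<exists>\<F>. finite \<F> \<and> \<F> \<subseteq> S ` I0 \<and> ?Z \<subseteq> \<Union>\<F>"
    using compactin_bisection [OF rf wf, of w \<mu> \<nu>] cover unfolding compactin_def by blast
  then obtain \<F> where \<F>: "finite \<F>" "\<F> \<subseteq> S ` I0" "?Z \<subseteq> \<Union>\<F>" by blast
  obtain I where I: "I \<subseteq> I0" "finite I" "\<F> = S ` I" using finite_subset_image [OF \<F>(1,2)] by blast
  obtain J where J: "J \<subseteq> I" "pairwise (\<lambda>i j. S i \<inter> S j = {}) J" "(\<Union>i\<in>J. S i) = (\<Union>i\<in>I. S i)"
    using bisection_disjoint_refinement [OF I(2), of G] unfolding S_def by blast
  have JI0: "J \<subseteq> I0" using J I by blast
  define c where "c = (\<lambda>i. SOME c. \<forall>h\<in>S i. cmod (f h - c) < e)"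
  have c: "cmod (f h - c i) < e" if "i \<in> I0" "h \<in> S i" for i h
  proof -
    have "\<exists>c. \<forall>h\<in>S i. cmod (f h - c) < e" using that by (simp add: I0_def)
    then have "\<forall>h\<in>S i. cmod (f h - c i) < e" unfolding c_def by (rule someI_ex)
    then show ?thesis using that by blast
  qed
  have finJ: "finite J" using J I finite_subset by blast
  have est: "cmod (f h * indicator ?Z h - (\<Sum>j\<in>J. c j * indicator (S j) h)) \<le> e" for h
  proof (cases "h \<in> ?Z")
    case True
    then obtain j where j: "j \<in> J" "h \<in> S j" using \<F>(3) I(3) J(3) by blast
    have "(\<Sum>i\<in>J. c i * indicator (S i) h) = (\<Sum>i\<in>{j}. c i * indicator (S i) h)"
    proof (rule sum.mono_neutral_right [OF finJ])
      show "\<forall>i\<in>J - {j}. c i * indicator (S i) h = 0"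
        using J(2) j unfolding pairwise_def by (auto simp: indicator_def)
    qed (use j in auto)
    then have "(\<Sum>i\<in>J. c i * indicator (S i) h) = c j" using j by simp
    then show ?thesis using True c [OF subsetD [OF JI0 j(1)] j(2)] by (simp add: less_imp_le)
  next
    case False
    have "S j \<subseteq> ?Z" if "j \<in> J" for j using that JI0 by (auto simp: I0_def)
    then have "(\<Sum>j\<in>J. c j * indicator (S j) h) = 0"
      using False by (intro sum.neutral) (auto simp: indicator_def)
    then show ?thesis using False e by simp
  qed
  have "\<forall>(w', \<mu>', \<nu>')\<in>J. bisection G w' \<mu>' \<nu>' \<subseteq> ?Z" using JI0 by (auto simp: I0_def S_def)
  then show ?thesis using finJ est unfolding S_def by blast
qed

text \<open>
  Approximating uniformly in the supremum norm suffices here because a function supported in one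
  bisection acts by a weighted partial bijection, so that its operator norm is at most its supremum.
\<close>

lemma rep_Cc_bisection:
  assumes rf: "row_finite G" and wf: "wf_digraph G" and f: "f \<in> Cc (groupoid_topology G)"
  shows "\<exists>B. represents G (\<lambda>h. f h * indicator (bisection G w \<mu> \<nu>) h) B \<and> B \<in> closure (genspan G)"
proof -
  let ?Z = "bisection G w \<mu> \<nu>" and ?f = "\<lambda>h. f h * indicator (bisection G w \<mu> \<nu>) h"
  let ?S = "\<lambda>(w, \<mu>, \<nu>). bisection G w \<mu> \<nu>"
  define B where "B = comp_op (op_dom G w \<mu> \<nu>) (swap_prefix \<mu> \<nu>) (bisection_weight ?f \<mu> \<nu>)"
  have ap: "\<exists>s A. represents G s A \<and> A \<in> genspan G \<and> (\<forall>h. cmod (?f h - s h) \<le> e) \<and> (\<forall>h. s h \<noteq> 0 \<longrightarrow> h \<in> ?Z) \<and>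
      (\<exists>K. \<forall>h. cmod (s h) \<le> K)" if e: "e > 0" for e
  proof -
    obtain J c where J: "finite J" "\<forall>(w', \<mu>', \<nu>')\<in>J. bisection G w' \<mu>' \<nu>' \<subseteq> ?Z"
      "\<forall>h. cmod (?f h - (\<Sum>j\<in>J. c j * indicator (?S j) h)) \<le> e"
      using simple_approx [OF rf wf f e, of w \<mu> \<nu>] by blast
    define s where "s = (\<lambda>h. \<Sum>j\<in>J. c j * indicator (?S j) h)"
    define A where "A = (\<Sum>j\<in>J. op_scale (c j) ((\<lambda>(w, \<mu>, \<nu>). path_op G w \<mu> \<nu>) j))"
    have "represents G s A" unfolding s_def A_def
      by (intro rep_sum J rep_scale) (auto intro: rep_path_op split: prod.splits)
    moreover have "A \<in> genspan G" unfolding A_def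
      by (intro genspan_simps) (auto intro: path_op_in_genspan split: prod.splits)
    moreover have "h \<in> ?Z" if "s h \<noteq> 0" for h
    proof -
      obtain j where "j \<in> J" "c j * indicator (?S j) h \<noteq> 0" using \<open>s h \<noteq> 0\<close> unfolding s_def
        by (metis (no_types, lifting) sum.neutral)
      then show ?thesis using J(2) by (auto simp: indicator_def split: if_splits)
    qed
    moreover have "cmod (s h) \<le> (\<Sum>j\<in>J. cmod (c j))" for h
    proof -
      have "cmod (s h) \<le> (\<Sum>j\<in>J. cmod (c j * indicator (?S j) h))" unfolding s_def by (rule norm_sum)
      also have "\<dots> \<le> (\<Sum>j\<in>J. cmod (c j))" by (intro sum_mono) (simp add: indicator_def norm_mult)
      finally show ?thesis .
    qed
    ultimately show ?thesis using J(3) unfolding s_def by blast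
  qed
  have "\<exists>K. \<forall>h. cmod (?f h) \<le> K"
  proof -
    obtain s K where s: "\<forall>h. cmod (?f h - s h) \<le> 1" "\<forall>h. cmod (s h) \<le> K" using ap [of 1] by auto
    have "cmod (?f h) \<le> K + 1" for h
      using norm_triangle_sub [of "?f h" "s h"] s by (smt (verit))
    then show ?thesis by blast
  qed
  then obtain K where K: "\<And>h. cmod (?f h) \<le> K" by blast
  have supp: "?f h \<noteq> 0 \<Longrightarrow> h \<in> ?Z" for h by (auto simp: indicator_def split: if_splits)
  have repB: "represents G ?f B" unfolding B_def by (rule rep_bisection(1) [OF K supp])
  have "B \<in> closure (genspan G)" unfolding closure_approachable
  proof (intro allI impI)
    fix e :: real assume "e > 0"
    then obtain s A where s: "represents G s A" "A \<in> genspan G" "\<And>h. cmod (?f h - s h) \<le> e / 2" "\<And>h. s h \<noteq> 0 \<Longrightarrow> h \<in> ?Z"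
      using ap [of "e / 2"] by auto
    define f' where "f' = (\<lambda>h. ?f h - s h)"
    have f'1: "cmod (f' h) \<le> e / 2" for h unfolding f'_def by (rule s(3))
    have f'2: "h \<in> ?Z" if "f' h \<noteq> 0" for h
    proof (rule ccontr)
      assume "h \<notin> ?Z"
      then show False using that s(4) [of h] by (simp add: f'_def)
    qed
    note f' = f'1 f'2
    \<comment> \<open>The difference function is again supported in the bisection, and an operator
      is determined by the function that it represents, so the supremum bound applies to the
      difference of the operators.\<close>
    have "B - A = comp_op (op_dom G w \<mu> \<nu>) (swap_prefix \<mu> \<nu>) (bisection_weight f' \<mu> \<nu>)"
    proof (rule rep_unique)
      show "represents G f' (B - A)" unfolding f'_def by (rule rep_diff [OF repB s(1)])
      show "represents G f' (comp_op (op_dom G w \<mu> \<nu>) (swap_prefix \<mu> \<nu>) (bisection_weight f' \<mu> \<nu>))"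
        by (rule rep_bisection(1) [OF f'])
    qed
    then have "norm (B - A) \<le> e / 2" using rep_bisection(2) [OF f'] by simp
    then show "\<exists>y\<in>genspan G. dist y B < e"
      using s(2) \<open>e > 0\<close> by (intro bexI [of _ A]) (auto simp: dist_norm norm_minus_commute)
  qed
  then show ?thesis using repB by blast
qed

text \<open>The support is covered by finitely many bisections, which may be taken disjoint;
  \<open>f\<close> is then the sum of its restrictions, and each of these is already represented in
  the closed span.\<close>

lemma rep_Cc:
  fixes G :: "('v, 'e) pre_digraph"
  assumes rf: "row_finite G" and wf: "wf_digraph G" and f: "f \<in> Cc (groupoid_topology G)"
  shows "\<exists>B. represents G f B \<and> B \<in> closure (genspan G)"
proof -
  interpret cstar_subalgebra "closure (genspan G)" by (rule cstar_subalgebra_genspan)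
  define S where "S = (\<lambda>(w, \<mu>, \<nu>). bisection G w \<mu> \<nu>)"
  obtain I where I: "finite I" "\<And>g. f g \<noteq> 0 \<Longrightarrow> g \<in> (\<Union>(w, \<mu>, \<nu>)\<in>I. bisection G w \<mu> \<nu>)"
    by (rule Cc_support [OF f], rule that)
  obtain J where J: "J \<subseteq> I" "pairwise (\<lambda>i j. S i \<inter> S j = {}) J" "(\<Union>i\<in>J. S i) = (\<Union>i\<in>I. S i)"
    using bisection_disjoint_refinement [OF I(1), of G] unfolding S_def by blast
  have finJ: "finite J" using J I finite_subset by blast
  have "\<forall>j. \<exists>B. represents G (\<lambda>h. f h * indicator (S j) h) B \<and> B \<in> closure (genspan G)"
  proof
    fix j :: "'v \<times> 'e list \<times> 'e list"
    obtain w \<mu> \<nu> where "j = (w, \<mu>, \<nu>)" by (metis prod_cases3)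
    then show "\<exists>B. represents G (\<lambda>h. f h * indicator (S j) h) B \<and> B \<in> closure (genspan G)"
      using rep_Cc_bisection [OF rf wf f, of w \<mu> \<nu>] by (simp add: S_def)
  qed
  from choice [OF this] obtain B where B: "\<And>j. represents G (\<lambda>h. f h * indicator (S j) h) (B j)"
    "\<And>j. B j \<in> closure (genspan G)" by auto
  have "represents G (\<lambda>h. \<Sum>j\<in>J. f h * indicator (S j) h) (sum B J)" by (intro rep_sum finJ B)
  moreover have "(\<lambda>h. \<Sum>j\<in>J. f h * indicator (S j) h) = f"
  proof
    fix h
    show "(\<Sum>j\<in>J. f h * indicator (S j) h) = f h"
    proof (cases "f h = 0")
      case False
      then have "h \<in> (\<Union>i\<in>I. S i)" using I(2) [of h] by (simp add: S_def)
      then obtain j where j: "j \<in> J" "h \<in> S j" using J(3) by blast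
      have "(\<Sum>i\<in>J. f h * indicator (S i) h) = (\<Sum>i\<in>{j}. f h * indicator (S i) h)"
      proof (rule sum.mono_neutral_right [OF finJ])
        show "\<forall>i\<in>J - {j}. f h * indicator (S i) h = 0"
          using J(2) j unfolding pairwise_def by (auto simp: indicator_def)
      qed (use j in auto)
      then show ?thesis using j by simp
    qed simp
  qed
  moreover have "sum B J \<in> closure (genspan G)" by (intro sum B)
  ultimately show ?thesis by metis
qed

lemma genspan_rep:
  assumes rf: "row_finite G" and wf: "wf_digraph G" and a: "a \<in> genspan G"
  shows "\<exists>f\<in>Cc (groupoid_topology G). represents G f a"
  using a
proof (induction rule: genspan_induct)
  case zero
  show ?case by (intro bexI [where x = "\<lambda>h. 0"] rep_zero Cc_zero)
next
  case (add a b)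
  then obtain f f' where "f \<in> Cc (groupoid_topology G)" "represents G f a" "f' \<in> Cc (groupoid_topology G)" "represents G f' b"
    by blast
  then show ?case by (intro bexI [where x = "\<lambda>h. f h + f' h"] rep_add Cc_add)
next
  case (scale c a)
  then obtain f where "f \<in> Cc (groupoid_topology G)" "represents G f a" by blast
  then show ?case by (intro bexI [where x = "\<lambda>h. c * f h"] rep_scale Cc_cmult)
next
  case (T w \<mu> \<nu>)
  show ?case by (intro bexI [where x = "indicator (bisection G w \<mu> \<nu>)"] rep_path_op Cc_indicator_bisection [OF rf wf])
qed

lemma graph_Cstar_eq:
  assumes rf: "row_finite G" and wf: "wf_digraph G"
  shows "graph_Cstar G = closure (genspan G)"
proof
  have "reg_rep G ` Cc (groupoid_topology G) \<subseteq> closure (genspan G)"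
  proof (rule image_subsetI)
    fix f assume f: "f \<in> Cc (groupoid_topology G)"
    obtain B where "represents G f B" "B \<in> closure (genspan G)" using rep_Cc [OF rf wf f] by blast
    then show "reg_rep G f \<in> closure (genspan G)" by (simp add: rep_reg_rep)
  qed
  then show "graph_Cstar G \<subseteq> closure (genspan G)" unfolding graph_Cstar_def by (rule closure_minimal) simp
  have "genspan G \<subseteq> reg_rep G ` Cc (groupoid_topology G)"
  proof
    fix a assume a: "a \<in> genspan G"
    obtain f where "f \<in> Cc (groupoid_topology G)" "represents G f a" using genspan_rep [OF rf wf a] by blast
    then show "a \<in> reg_rep G ` Cc (groupoid_topology G)" using rep_reg_rep by (intro image_eqI) auto
  qed
  then show "closure (genspan G) \<subseteq> graph_Cstar G" unfolding graph_Cstar_def by (rule closure_mono)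
qed

section \<open>Vertex projections as an approximate unit\<close>

lemma path_op_zero_verts:
  assumes wf: "wf_digraph G" and "w \<notin> verts G" shows "path_op G w \<mu> \<nu> = 0"
proof -
  have "op_dom G w \<mu> \<nu> = {}"
  proof (rule ccontr)
    assume "op_dom G w \<mu> \<nu> \<noteq> {}"
    then obtain g where "g \<in> op_dom G w \<mu> \<nu>" by blast
    then obtain p where "tail G (p 0) = w" "p \<in> inf_paths G" by (rule op_dom_cases)
    then show False using assms wf_digraph.tail_in_verts [OF wf, of "p 0"] by (auto simp: inf_paths_def)
  qed
  then show ?thesis by (intro blinfun_eqI ell2_eqI) (simp add: path_op_apply)
qed

lemma start_in_verts: "wf_digraph G \<Longrightarrow> walk G \<mu> w \<Longrightarrow> w \<in> verts G \<Longrightarrow> start G \<mu> w \<in> verts G"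
  by (cases \<mu>) (auto simp: wf_digraph.tail_in_verts)

lemma approx_unit_genspan:
  assumes wf: "wf_digraph G"
  shows "approx_unit (closure (genspan G)) (\<lambda>v. path_op G v [] []) (verts G) (genspan G)"
proof -
  interpret cstar_subalgebra "closure (genspan G)" by (rule cstar_subalgebra_genspan)
  show ?thesis
  proof
    show "path_op G v [] [] \<in> closure (genspan G)" for v by (rule subsetD [OF closure_subset path_op_in_genspan])
    show "is_adj (path_op G v [] []) (path_op G v [] [])" for v by (rule is_adj_path_op)
    show "path_op G v [] [] o\<^sub>L path_op G w [] [] = (if v = w then path_op G v [] [] else 0)" for v w
      by (auto simp: path_op_vertex)
    fix a assume "a \<in> genspan G"
    then show "\<exists>F. finite F \<and> F \<subseteq> verts G \<and>
      (\<forall>F'. finite F' \<longrightarrow> F \<subseteq> F' \<longrightarrow> F' \<subseteq> verts G \<longrightarrow> (\<Sum>v\<in>F'. path_op G v [] []) o\<^sub>L a = a)"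
    proof (induction rule: genspan_induct)
      case zero
      show ?case by (intro exI [of _ "{}"]) auto
    next
      case (add a b)
      then obtain F1 F2 where F: "finite F1" "F1 \<subseteq> verts G" "finite F2" "F2 \<subseteq> verts G"
        "\<And>F'. finite F' \<Longrightarrow> F1 \<subseteq> F' \<Longrightarrow> F' \<subseteq> verts G \<Longrightarrow> (\<Sum>v\<in>F'. path_op G v [] []) o\<^sub>L a = a"
        "\<And>F'. finite F' \<Longrightarrow> F2 \<subseteq> F' \<Longrightarrow> F' \<subseteq> verts G \<Longrightarrow> (\<Sum>v\<in>F'. path_op G v [] []) o\<^sub>L b = b"
        by blast
      show ?case by (intro exI [of _ "F1 \<union> F2"]) (auto simp: F blinfun_compose_simps)
    next
      case (scale c a)
      then obtain F where F: "finite F" "F \<subseteq> verts G"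
        "\<And>F'. finite F' \<Longrightarrow> F \<subseteq> F' \<Longrightarrow> F' \<subseteq> verts G \<Longrightarrow> (\<Sum>v\<in>F'. path_op G v [] []) o\<^sub>L a = a" by blast
      have "(\<Sum>v\<in>F'. path_op G v [] []) o\<^sub>L op_scale c a = op_scale c ((\<Sum>v\<in>F'. path_op G v [] []) o\<^sub>L a)" for F'
        by (rule op_scale_compose_right, rule is_adj_sum, rule is_adj_path_op)
      then show ?case by (intro exI [of _ F]) (auto simp: F)
    next
      case (T w \<mu> \<nu>)
      show ?case
      proof (cases "walk G \<mu> w \<and> w \<in> verts G")
        case True
        have "(\<Sum>v\<in>F'. path_op G v [] []) o\<^sub>L path_op G w \<mu> \<nu> = path_op G w \<mu> \<nu>" if "finite F'" "start G \<mu> w \<in> F'" for F'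
          using that by (simp add: compose_sum_left path_op_vertex)
        then show ?thesis
          using True start_in_verts [OF wf] by (intro exI [of _ "{start G \<mu> w}"]) auto
      next
        case False
        have "path_op G w \<mu> \<nu> = 0"
        proof (cases "w \<in> verts G")
          case True
          then show ?thesis using False by (simp add: path_op_zero)
        next
          case False
          then show ?thesis by (rule path_op_zero_verts [OF wf])
        qed
        then show ?thesis by (intro exI [of _ "{}"]) auto
      qed
    qed
  qed simp
qed

section \<open>The gauge action\<close>

definition gauge_unitary :: "real \<Rightarrow> 'e garrow op" where
  "gauge_unitary t = comp_op UNIV id (\<lambda>(p, k, q). exp (\<i> * of_int k * of_real t))"

lemma gauge_unitary_apply:
  "ell2_apply (gauge_unitary t f) (p, k, q) = exp (\<i> * of_int k * of_real t) * ell2_apply f (p, k, q)"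
  unfolding gauge_unitary_def by (subst comp_op(1) [where C = 1]) auto

lemma norm_gauge_unitary: "norm (gauge_unitary t) \<le> 1"
  unfolding gauge_unitary_def by (rule comp_op(2)) auto

lemma gauge_unitary_add: "gauge_unitary (s + t) = gauge_unitary s o\<^sub>L gauge_unitary t"
proof (rule blinfun_eqI, rule ell2_eqI)
  fix f and x :: "'a garrow"
  obtain p k q where "x = (p, k, q)" by (metis prod_cases3)
  then show "ell2_apply (gauge_unitary (s + t) f) x = ell2_apply ((gauge_unitary s o\<^sub>L gauge_unitary t) f) x"
    by (simp add: gauge_unitary_apply algebra_simps exp_add)
qed

lemma gauge_unitary_0: "gauge_unitary 0 = id_blinfun"
proof (rule blinfun_eqI, rule ell2_eqI)
  fix f and x :: "'a garrow"
  obtain p k q where "x = (p, k, q)" by (metis prod_cases3)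
  then show "ell2_apply (gauge_unitary 0 f) x = ell2_apply (id_blinfun f) x"
    by (simp add: gauge_unitary_apply)
qed

lemma gauge_unitary_inverse: "gauge_unitary t o\<^sub>L gauge_unitary (- t) = id_blinfun"
  "gauge_unitary (- t) o\<^sub>L gauge_unitary t = id_blinfun"
  by (simp_all add: gauge_unitary_0 flip: gauge_unitary_add)

lemma is_adj_gauge_unitary: "is_adj (gauge_unitary t) (gauge_unitary (- t))"
  unfolding is_adj_def cinner_def
proof (intro allI infsum_cong)
  fix f g and x :: "'a garrow"
  obtain p k q where "x = (p, k, q)" by (metis prod_cases3)
  then show "cnj (ell2_apply (gauge_unitary t f) x) * ell2_apply g x
      = cnj (ell2_apply f x) * ell2_apply (gauge_unitary (- t) g) x"
    by (simp add: gauge_unitary_apply exp_cnj)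
qed

text \<open>The action is implemented spatially by a diagonal unitary, the phase at an arrow
  depending on its degree only. Multiplicativity, compatibility with adjoints and contractivity come
  with this form; what remains is to identify it with the description
  \<open>gauge_action\<close>.\<close>

definition gauge :: "real \<Rightarrow> 'e garrow op \<Rightarrow> 'e garrow op" where
  "gauge t a = gauge_unitary t o\<^sub>L (a o\<^sub>L gauge_unitary (- t))"

lemma gauge_simps:
  "gauge t (a + b) = gauge t a + gauge t b" "gauge t (a - b) = gauge t a - gauge t b"
  "gauge t (a o\<^sub>L b) = gauge t a o\<^sub>L gauge t b" "gauge t (op_scale c a) = op_scale c (gauge t a)"
  "gauge 0 a = a" "gauge (s + t) a = gauge s (gauge t a)" "gauge t 0 = 0"
proof -
  show "gauge t (a + b) = gauge t a + gauge t b" "gauge t (a - b) = gauge t a - gauge t b" "gauge t 0 = 0"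
    by (simp_all add: gauge_def blinfun_compose_simps)
  show "gauge t (op_scale c a) = op_scale c (gauge t a)"
    by (simp add: gauge_def op_scale_compose_left op_scale_compose_right [OF is_adj_gauge_unitary])
  have "gauge t a o\<^sub>L gauge t b = gauge_unitary t o\<^sub>L (a o\<^sub>L ((gauge_unitary (- t) o\<^sub>L gauge_unitary t) o\<^sub>L (b o\<^sub>L gauge_unitary (- t))))"
    by (simp only: gauge_def compose_assoc)
  also have "(gauge_unitary (- t) o\<^sub>L gauge_unitary t) o\<^sub>L (b o\<^sub>L gauge_unitary (- t)) = b o\<^sub>L gauge_unitary (- t)"
    unfolding gauge_unitary_inverse by (rule blinfun_eqI) simp
  finally show "gauge t (a o\<^sub>L b) = gauge t a o\<^sub>L gauge t b"
    by (simp only: gauge_def compose_assoc)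
  show "gauge 0 a = a" unfolding gauge_def minus_zero gauge_unitary_0 by (rule blinfun_eqI) simp
  have "- (s + t) = - t + - s" by simp
  then show "gauge (s + t) a = gauge s (gauge t a)"
    unfolding gauge_def by (simp only: gauge_unitary_add compose_assoc)
qed

lemma gauge_inverse: "gauge t (gauge (- t) a) = a" "gauge (- t) (gauge t a) = a"
  by (simp_all add: gauge_simps(5) flip: gauge_simps(6))

lemma is_adj_gauge: "is_adj a a' \<Longrightarrow> is_adj (gauge t a) (gauge t a')"
proof -
  assume "is_adj a a'"
  then have "is_adj (gauge t a) ((gauge_unitary (- (- t)) o\<^sub>L a') o\<^sub>L gauge_unitary (- t))"
    unfolding gauge_def by (intro is_adj_simps is_adj_gauge_unitary)
  then show ?thesis by (simp add: gauge_def compose_assoc)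
qed

lemma norm_gauge_le: "norm (gauge t a) \<le> norm a"
proof -
  have "norm (gauge t a) \<le> norm (gauge_unitary t :: 'a garrow op) * norm (a o\<^sub>L gauge_unitary (- t))"
    unfolding gauge_def by (rule norm_blinfun_compose)
  also have "\<dots> \<le> 1 * (norm a * norm (gauge_unitary (- t) :: 'a garrow op))"
    by (intro mult_mono norm_gauge_unitary norm_blinfun_compose) auto
  also have "\<dots> \<le> 1 * (norm a * 1)" by (intro mult_left_mono norm_gauge_unitary) auto
  finally show ?thesis by simp
qed

lemma rep_gauge:
  fixes G :: "('v, 'e) pre_digraph"
  assumes "represents G f B"
  shows "represents G (\<lambda>(p, k, q). exp (\<i> * of_int k * of_real t) * f (p, k, q)) (gauge t B)"
proof (rule repI)
  fix \<xi> :: "'e garrow ell2" and g :: "'e garrow"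
  obtain p k q where g: "g = (p, k, q)" by (metis prod_cases3)
  have val: "ell2_apply (gauge t B \<xi>) g = exp (\<i> * of_int k * of_real t) * ell2_apply (B (gauge_unitary (- t) \<xi>)) g"
    by (simp add: gauge_def g gauge_unitary_apply)
  show "ell2_apply (gauge t B \<xi>) g = 0" if "g \<notin> groupoid G"
    using repD(2) [OF assms that] by (simp add: val)
  assume "g \<in> groupoid G"
  have "((\<lambda>h. exp (\<i> * of_int k * of_real t) * (f h * ell2_apply (gauge_unitary (- t) \<xi>) (gmult (ginv h) g)))
      has_sum ell2_apply (gauge t B \<xi>) g) {h \<in> groupoid G. grange h = grange g}"
    unfolding val by (intro has_sum_cmult_right repD(1) [OF assms \<open>g \<in> groupoid G\<close>])
  then show "((\<lambda>h. (case h of (p, k, q) \<Rightarrow> exp (\<i> * of_int k * of_real t) * f (p, k, q)) * ell2_apply \<xi> (gmult (ginv h) g))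
      has_sum ell2_apply (gauge t B \<xi>) g) {h \<in> groupoid G. grange h = grange g}"
  proof (rule has_sum_cong [THEN iffD1, rotated])
    fix h :: "'e garrow"
    obtain p1 k1 q1 where h: "h = (p1, k1, q1)" by (metis prod_cases3)
    \<comment> \<open>The phase at \<open>g\<close> and the inverse phase at
      \<open>gmult (ginv h) g\<close>, whose degree is \<open>k - k1\<close>, combine to the phase
      of degree \<open>k1\<close> at \<open>h\<close>.\<close>
    define E where "E = exp (\<i> * of_int k * of_real t)"
    define E' where "E' = exp (\<i> * of_int (- k1 + k) * of_real (- t))"
    have EE: "E * E' = exp (\<i> * of_int k1 * of_real t)"
      by (simp add: E_def E'_def algebra_simps flip: exp_add)
    have "ell2_apply (gauge_unitary (- t) \<xi>) (gmult (ginv h) g) = E' * ell2_apply \<xi> (gmult (ginv h) g)"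
      unfolding h g ginv.simps gmult.simps gauge_unitary_apply E'_def ..
    then have "E * (f h * ell2_apply (gauge_unitary (- t) \<xi>) (gmult (ginv h) g))
        = (E * E') * f h * ell2_apply \<xi> (gmult (ginv h) g)"
      by (simp only: mult_ac)
    then show "exp (\<i> * of_int k * of_real t) * (f h * ell2_apply (gauge_unitary (- t) \<xi>) (gmult (ginv h) g))
      = (case h of (p, k, q) \<Rightarrow> exp (\<i> * of_int k * of_real t) * f (p, k, q)) * ell2_apply \<xi> (gmult (ginv h) g)"
      unfolding EE unfolding E_def by (simp only: h case_prod_conv)
  qed
qed

lemma gauge_path_op:
  fixes G :: "('v, 'e) pre_digraph"
  shows "gauge t (path_op G w \<mu> \<nu>) = op_scale (exp (\<i> * of_real (real (length \<mu>) - real (length \<nu>)) * of_real t)) (path_op G w \<mu> \<nu>)"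
proof (rule blinfun_eqI, rule ell2_eqI)
  fix f and x :: "'e garrow"
  obtain p k q where x: "x = (p, k, q)" by (metis prod_cases3)
  show "ell2_apply (gauge t (path_op G w \<mu> \<nu>) f) x =
    ell2_apply (op_scale (exp (\<i> * of_real (real (length \<mu>) - real (length \<nu>)) * of_real t)) (path_op G w \<mu> \<nu>) f) x"
  proof (cases "x \<in> op_dom G w \<mu> \<nu>")
    case True
    have m: "swap_prefix \<mu> \<nu> x = (conc \<nu> ((shift ^^ length \<mu>) p), k - int (length \<mu>) + int (length \<nu>), q)"
      by (simp add: x swap_prefix_def)
    define E where "E = exp (\<i> * of_int k * of_real t)"
    define E' where "E' = exp (\<i> * of_int (k - int (length \<mu>) + int (length \<nu>)) * of_real (- t))"
    have EE: "E * E' = exp (\<i> * of_real (real (length \<mu>) - real (length \<nu>)) * of_real t)"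
      by (simp add: E_def E'_def algebra_simps flip: exp_add)
    have "ell2_apply (gauge t (path_op G w \<mu> \<nu>) f) x = E * ell2_apply (path_op G w \<mu> \<nu> (gauge_unitary (- t) f)) x"
      by (simp add: gauge_def x gauge_unitary_apply E_def)
    also have "ell2_apply (path_op G w \<mu> \<nu> (gauge_unitary (- t) f)) x = ell2_apply (gauge_unitary (- t) f) (swap_prefix \<mu> \<nu> x)"
      using True by (simp add: path_op_apply)
    also have "\<dots> = E' * ell2_apply f (swap_prefix \<mu> \<nu> x)"
      unfolding m gauge_unitary_apply E'_def ..
    also have "ell2_apply f (swap_prefix \<mu> \<nu> x) = ell2_apply (path_op G w \<mu> \<nu> f) x"
      using True by (simp add: path_op_apply)
    finally show ?thesis by (simp only: mult.assoc [symmetric] EE op_scale_apply ell2_apply_scale)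
  next
    case False
    then show ?thesis by (simp add: gauge_def x gauge_unitary_apply path_op_apply)
  qed
qed

lemma gauge_genspan: "a \<in> genspan G \<Longrightarrow> gauge t a \<in> genspan G"
  by (induction rule: genspan_induct) (auto simp: gauge_simps gauge_path_op intro: genspan_simps path_op_in_genspan)

lemma tendsto_gauge: "X \<longlonglongrightarrow> a \<Longrightarrow> (\<lambda>n. gauge t (X n)) \<longlonglongrightarrow> gauge t a"
  unfolding gauge_def by (intro tendsto_compose_op tendsto_const)

lemma gauge_closure: assumes "a \<in> closure (genspan G)" shows "gauge t a \<in> closure (genspan G)"
proof -
  obtain X where X: "\<And>n. X n \<in> genspan G" "X \<longlonglongrightarrow> a" using assms unfolding closure_sequential by auto
  show ?thesis unfolding closure_sequential
    by (rule exI [of _ "\<lambda>n. gauge t (X n)"]) (simp add: gauge_genspan X tendsto_gauge)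
qed

lemma continuous_gauge:
  fixes G :: "('v, 'e) pre_digraph"
  assumes "a \<in> closure (genspan G)"
  shows "continuous_on UNIV (\<lambda>t. gauge t a)"
proof -
  have base: "continuous_on UNIV (\<lambda>t. gauge t b)" if "b \<in> genspan G" for b
    using that
  proof (induction rule: genspan_induct)
    case (add a b)
    then show ?case by (simp add: gauge_simps continuous_on_add)
  next
    case (scale c a)
    have "continuous_on UNIV (\<lambda>t. Blinfun (ell2_scale c) o\<^sub>L gauge t a)"
      by (intro continuous_intros scale)
    then show ?case by (simp only: gauge_simps(4)) (simp only: op_scale_def)
  next
    case (T w \<mu> \<nu>)
    \<comment> \<open>Operators form only a real normed space here, so continuity in a complex
      scalar is reduced to that of its real and imaginary parts.\<close>
    have op: "op_scale z S = Re z *\<^sub>R S + Im z *\<^sub>R op_scale \<i> S" for z and S :: "'e garrow op"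
      by (rule blinfun_eqI, rule ell2_eqI)
        (simp add: blinfun.add_left blinfun.scaleR_left scaleR_conv_of_real complex_eq_iff algebra_simps)
    define E where "E = (\<lambda>t. exp (\<i> * of_real (real (length \<mu>) - real (length \<nu>)) * of_real t))"
    have "gauge t (path_op G w \<mu> \<nu>) = Re (E t) *\<^sub>R path_op G w \<mu> \<nu> + Im (E t) *\<^sub>R op_scale \<i> (path_op G w \<mu> \<nu>)" for t
      unfolding gauge_path_op E_def by (rule op)
    moreover have "continuous_on UNIV (\<lambda>t. Re (E t) *\<^sub>R path_op G w \<mu> \<nu> + Im (E t) *\<^sub>R op_scale \<i> (path_op G w \<mu> \<nu>))"
      unfolding E_def by (intro continuous_intros)
    ultimately show ?case by presburger
  qed (simp add: gauge_simps)
  obtain X where X: "\<And>n. X n \<in> genspan G" "X \<longlonglongrightarrow> a" using assms unfolding closure_sequential by auto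
  have "uniform_limit UNIV (\<lambda>n t. gauge t (X n)) (\<lambda>t. gauge t a) sequentially"
  proof (rule uniform_limitI)
    fix e :: real assume "e > 0"
    have "\<forall>\<^sub>F n in sequentially. dist (X n) a < e" using X(2) \<open>e > 0\<close> by (rule tendstoD)
    then show "\<forall>\<^sub>F n in sequentially. \<forall>t\<in>UNIV. dist (gauge t (X n)) (gauge t a) < e"
    proof eventually_elim
      case (elim n)
      then show ?case using norm_gauge_le [of _ "X n - a"] by (auto simp: dist_norm gauge_simps intro: le_less_trans)
    qed
  qed
  then show ?thesis by (rule uniform_limit_theorem [rotated]) (use base X in auto)
qed

lemma star_automorphism_gauge: "star_automorphism (closure (genspan G)) (gauge t)"
proof -
  interpret cstar_subalgebra "closure (genspan G)" by (rule cstar_subalgebra_genspan)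
  have "bij_betw (gauge t) (closure (genspan G)) (closure (genspan G))"
    by (rule bij_betw_byWitness [where f' = "gauge (- t)"]) (auto simp: gauge_inverse intro: gauge_closure)
  moreover have "gauge t (op_adj a) = op_adj (gauge t a)" if "a \<in> closure (genspan G)" for a
    using op_adj_eq [OF is_adj_gauge [OF is_adj [OF that]]] by simp
  ultimately show ?thesis unfolding star_automorphism_def by (simp add: gauge_simps)
qed

text \<open>Uniqueness is the point: \<open>one_parameter_group\<close> requires continuity in
  \<open>t\<close>, whereas agreement on the represented functions must be extended in the algebra
  variable, and there the contractivity of automorphisms enters. The restriction accounts for the
  extensionality demanded in the description.\<close>

lemma gauge_action_eq:
  assumes rf: "row_finite G" and wf: "wf_digraph G"
  shows "gauge_action G = (\<lambda>t. restrict (gauge t) (graph_Cstar G))"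
proof -
  define A where "A = graph_Cstar G"
  have A: "A = closure (genspan G)" unfolding A_def by (rule graph_Cstar_eq [OF rf wf])
  interpret cstar_subalgebra A unfolding A by (rule cstar_subalgebra_genspan)
  let ?g = "\<lambda>t. restrict (gauge t) A"
  have gA: "gauge t a \<in> A" if "a \<in> A" for a t using that unfolding A by (rule gauge_closure)
  have sa: "star_automorphism A (?g t)" for t
  proof -
    have "star_automorphism A (gauge t)" unfolding A by (rule star_automorphism_gauge)
    then show ?thesis unfolding star_automorphism_def
      by (simp add: add mult scale adj bij_betw_cong [of A "?g t" "gauge t"])
  qed
  have cont: "continuous_on UNIV (\<lambda>t. gauge t a)" if "a \<in> A" for a
    using that unfolding A by (rule continuous_gauge)
  have one: "one_parameter_group A ?g"
    unfolding one_parameter_group_def using sa cont by (simp add: gauge_simps(5,6) gA)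
  have reg: "reg_rep G f \<in> A" if "f \<in> Cc (groupoid_topology G)" for f
    unfolding A_def graph_Cstar_def by (rule subsetD [OF closure_subset]) (use that in simp)
  have reps: "?g t (reg_rep G f) = reg_rep G (\<lambda>(p, k, q). exp (\<i> * of_int k * of_real t) * f (p, k, q))"
    if f: "f \<in> Cc (groupoid_topology G)" for t f
  proof -
    obtain B where B: "represents G f B" using rep_Cc [OF rf wf f] by (elim exE conjE)
    show ?thesis using reg [OF f] rep_reg_rep [OF B] rep_reg_rep [OF rep_gauge [OF B]] by simp
  qed
  show ?thesis unfolding gauge_action_def A_def [symmetric]
  proof (rule the_equality, goal_cases)
    case 1
    show ?case using one reps by auto
  next
    case (2 \<gamma>)
    show ?case
    proof
      fix t
      have st: "star_automorphism A (\<gamma> t)" using 2 unfolding one_parameter_group_def by blast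
      have eq: "\<gamma> t a = gauge t a" if a: "a \<in> A" for a
      proof -
        have "a \<in> closure (reg_rep G ` Cc (groupoid_topology G))" using a by (simp add: A_def graph_Cstar_def)
        then obtain X where X: "\<And>n. X n \<in> reg_rep G ` Cc (groupoid_topology G)" "X \<longlonglongrightarrow> a"
          unfolding closure_sequential by auto
        have XA: "X n \<in> A" for n using X(1) [of n] reg by auto
        have "\<gamma> t (X n) = gauge t (X n)" for n
        proof -
          obtain f where f: "f \<in> Cc (groupoid_topology G)" "X n = reg_rep G f" using X(1) [of n] by blast
          then have "\<gamma> t (X n) = ?g t (X n)" using 2 reps by simp
          then show ?thesis using XA by simp
        qed
        then have "(\<lambda>n. \<gamma> t (X n)) \<longlonglongrightarrow> gauge t a" using tendsto_gauge [OF X(2)] by simp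
        moreover have "(\<lambda>n. \<gamma> t (X n)) \<longlonglongrightarrow> \<gamma> t a"
        proof (rule LIM_zero_cancel, rule Lim_null_comparison)
          show "\<forall>\<^sub>F n in sequentially. norm (\<gamma> t (X n) - \<gamma> t a) \<le> norm (X n - a)"
            using star_automorphism_norm_le [OF st diff [OF XA a]] star_automorphism_simps(7) [OF st XA a]
            by (intro always_eventually allI) simp
          show "(\<lambda>n. norm (X n - a)) \<longlonglongrightarrow> 0" using X(2) by (simp add: LIM_zero tendsto_norm_zero)
        qed
        ultimately show ?thesis by (rule LIMSEQ_unique [symmetric])
      qed
      have "\<gamma> t \<in> extensional A" using 2 by blast
      then show "\<gamma> t = restrict (gauge t) A"
        using eq by (auto simp: extensional_def restrict_def fun_eq_iff)
    qed
  qed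
qed

section \<open>From KMS states to eigenvectors\<close>

text \<open>Positivity includes that the quadratic form is real, so \<open>a - a'\<close> has zero
  form.\<close>

lemma positive_self_adjoint:
  assumes "is_adj a a'" "op_le 0 a" shows "a' = a"
proof -
  have "is_adj (a - a') (a' - a)" by (intro is_adj_simps assms is_adj_sym)
  moreover have "cinner f ((a - a') f) = 0" for f
  proof -
    have "cinner f (a' f) = cnj (cinner f (a f))"
      using is_adjD [OF assms(1), of f f] cinner_commute [of "a f" f] by simp
    moreover have "cinner f (a f) \<in> \<real>" using assms(2) by (simp add: op_le_0_iff)
    ultimately show ?thesis by (simp add: blinfun.diff_left cinner_simps Reals_cnj_iff)
  qed
  ultimately have "a - a' = 0" by (rule quadratic_form_zero)
  then show ?thesis by simp
qed

lemma gauge_positive: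
  assumes "op_le 0 a" shows "op_le 0 (gauge t a)"
proof -
  have "cinner f (gauge t a f) = cinner (gauge_unitary (- t) f) (a (gauge_unitary (- t) f))" for f
    using is_adjD [OF is_adj_gauge_unitary [of "- t"], of f "a (gauge_unitary (- t) f)"] by (simp add: gauge_def)
  then show ?thesis using assms by (simp add: op_le_0_iff)
qed

text \<open>For equal lengths the letters cancel in pairs from the front; the first mismatch gives
  0.\<close>

lemma path_op_orthogonal:
  "length \<mu> = length \<nu> \<Longrightarrow> path_op G w [] \<nu> o\<^sub>L path_op G w \<mu> [] = (if \<mu> = \<nu> \<and> walk G \<mu> w then path_op G w [] [] else 0)"
proof (induction \<mu> \<nu> rule: list_induct2)
  case Nil
  show ?case by (simp add: path_op_vertex)
next
  case (Cons f \<mu> e \<nu>)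
  show ?case
  proof (cases "e \<in> arcs G")
    case True
    have "is_adj (path_op G (head G e) [e] [] o\<^sub>L path_op G w \<nu> []) (path_op G w [] \<nu> o\<^sub>L path_op G (head G e) [] [e])"
      by (intro is_adj_simps is_adj_path_op)
    then have eq: "path_op G w [] (e # \<nu>) = path_op G w [] \<nu> o\<^sub>L path_op G (head G e) [] [e]"
      unfolding path_op_Cons [OF True] by (rule is_adj_unique [OF is_adj_path_op])
    show ?thesis
      unfolding eq compose_assoc path_op_edge_adj_compose(1) [OF True] using Cons.IH by auto
  next
    case False
    then show ?thesis by (auto simp: path_op_zero)
  qed
qed

section \<open>The algebra of a fixed row-finite graph\<close>

locale graph_algebra =
  fixes G :: "('v, 'e) pre_digraph"
  assumes wf: "wf_digraph G" and rf: "row_finite G"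
begin

abbreviation "A \<equiv> graph_Cstar G"
abbreviation "P v \<equiv> path_op G v [] []"

lemma approx_unit: "approx_unit A P (verts G) (genspan G)"
  unfolding graph_Cstar_eq [OF rf wf] by (rule approx_unit_genspan [OF wf])

sublocale approx_unit A P "verts G" "genspan G"
  by (rule approx_unit)

lemma genspan_in: "a \<in> genspan G \<Longrightarrow> a \<in> A"
  unfolding graph_Cstar_eq [OF rf wf] using closure_subset by blast

lemma path_op_in: "path_op G w \<mu> \<nu> \<in> A"
  by (rule genspan_in [OF path_op_in_genspan])

lemma gauge_in: "a \<in> A \<Longrightarrow> gauge t a \<in> A"
  unfolding graph_Cstar_eq [OF rf wf] by (rule gauge_closure)

lemma gauge_action_apply: "a \<in> A \<Longrightarrow> gauge_action G t a = gauge t a"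
  by (simp add: gauge_action_eq [OF rf wf])

lemma P_pos: "v \<in> verts G \<Longrightarrow> P v \<in> positive_part A"
  using proj_pos [of "{v}"] by simp

lemma approx_seq: assumes "a \<in> A" obtains Y where "\<And>n. Y n \<in> genspan G" "Y \<longlonglongrightarrow> a"
  using assms unfolding graph_Cstar_eq [OF rf wf] closure_sequential by auto

end

locale graph_KMS_state = graph_algebra G for G :: "('v, 'e) pre_digraph" +
  fixes \<beta> :: real and \<psi>
  assumes state: "KMS_state (graph_Cstar G) (gauge_action G) \<beta> \<psi>"
begin

lemma weight: "weight A \<psi>"
  using state by (simp add: KMS_state_def KMS_weight_def proper_weight_def)

lemma sup_one: "(SUP a\<in>{a \<in> A. op_le 0 a \<and> op_le a id_blinfun}. \<psi> a) = 1"
  using state by (simp add: KMS_state_def)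

lemma le_one: assumes "a \<in> A" "op_le 0 a" "op_le a id_blinfun" shows "\<psi> a \<le> 1"
proof -
  have "\<psi> a \<le> (SUP a\<in>{a \<in> A. op_le 0 a \<and> op_le a id_blinfun}. \<psi> a)"
    by (rule SUP_upper) (use assms in simp)
  then show ?thesis by (simp add: sup_one)
qed

lemma le_norm: assumes a: "a \<in> positive_part A" shows "\<psi> a \<le> ennreal (norm a)"
proof (cases "a = 0")
  case True
  \<comment> \<open>A weight scales only by positive factors, so its value at 0 has to be found from
    additivity, and for that it must be finite.\<close>
  have "\<psi> 0 \<le> 1" by (rule le_one) (auto intro: zero op_le_0_simps op_le_norm)
  then have fin: "\<psi> 0 < \<infinity>" by (simp add: le_less_trans)
  have "\<psi> (0 + 0) = \<psi> 0 + \<psi> 0"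
    using weight positive_part_simps(3) unfolding weight_def by blast
  then have "\<psi> 0 = 0" using fin by (auto simp: ennreal_add_left_cancel)
  then show ?thesis using True by simp
next
  case False
  define b where "b = inverse (norm a) *\<^sub>R a"
  have b: "b \<in> positive_part A" unfolding b_def by (intro positive_part_simps a) simp
  have "norm b \<le> 1" using False by (simp add: b_def)
  then have "\<psi> b \<le> 1" using b by (intro le_one op_le_norm) (auto simp: positive_part_def)
  moreover have "a = norm a *\<^sub>R b" using False by (simp add: b_def)
  then have "\<psi> a = ennreal (norm a) * \<psi> b"
    using weight b False unfolding weight_def by (metis zero_less_norm_iff)
  ultimately show ?thesis by (simp add: mult_left_le)
qed

sublocale contractive_weight A \<psi> P "verts G" "genspan G"
proof
  show "weight A \<psi>" by (rule weight)
  show fin: "\<psi> a < \<infinity>" if "a \<in> positive_part A" for a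
    using le_norm [OF that] by (simp add: le_less_trans)
  interpret finite_weight A \<psi> by unfold_locales (use weight fin in auto)
  show "finite_weight.val \<psi> a \<le> norm a" if "a \<in> positive_part A" for a
    using le_norm [OF that] unfolding ennreal_val [OF that] by simp
qed

lemma KMS_eigen:
  assumes a: "a \<in> A" and b: "b \<in> A" and eig: "\<And>t. gauge t b = op_scale (exp (\<i> * of_real r * of_real t)) b"
  shows "ext (b o\<^sub>L a) = of_real (exp (- (\<beta> * r))) * ext (a o\<^sub>L b)"
proof -
  have "\<exists>F. KMS_fun \<beta> F \<and> (\<forall>t. F (of_real t) = weight_ext A \<psi> (a o\<^sub>L gauge_action G t b)) \<and>
          (\<forall>t. F (of_real t + \<i> * of_real \<beta>) = weight_ext A \<psi> (gauge_action G t b o\<^sub>L a))"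
  proof -
    have "KMS_weight A (gauge_action G) \<beta> \<psi>" using state by (simp add: KMS_state_def)
    then have "\<forall>a\<in>A. \<forall>b\<in>A. \<exists>F. continuous_on (KMS_strip \<beta>) F \<and> bounded (F ` KMS_strip \<beta>) \<and>
          F holomorphic_on interior (KMS_strip \<beta>) \<and>
          (\<forall>t. F (of_real t) = weight_ext A \<psi> (a o\<^sub>L gauge_action G t b)) \<and>
          (\<forall>t. F (of_real t + \<i> * of_real \<beta>) = weight_ext A \<psi> (gauge_action G t b o\<^sub>L a))"
      unfolding KMS_weight_def weight_N_adj by (elim conjE)
    then show ?thesis using a b unfolding KMS_fun_def by blast
  qed
  then obtain F where F: "KMS_fun \<beta> F" "\<And>t. F (of_real t) = weight_ext A \<psi> (a o\<^sub>L gauge_action G t b)"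
    "\<And>t. F (of_real t + \<i> * of_real \<beta>) = weight_ext A \<psi> (gauge_action G t b o\<^sub>L a)" by blast
  have F0: "F (of_real t) = exp (\<i> * of_real r * of_real t) * ext (a o\<^sub>L b)" for t
    by (simp add: F(2) gauge_action_apply b eig compose_scale a mult weight_ext_eq scale ext_scale)
  define H where "H = (\<lambda>z. F z - exp (\<i> * of_real r * z) * ext (a o\<^sub>L b))"
  have "KMS_fun \<beta> H" unfolding H_def by (intro KMS_fun_diff KMS_fun_mult KMS_fun_exp KMS_fun_const F)
  moreover have "H z = 0" if "Im z = 0" for z
  proof -
    have "z = of_real (Re z)" using that by (simp add: complex_eq_iff)
    then show ?thesis using F0 [of "Re z"] by (simp add: H_def)
  qed
  ultimately have "H (\<i> * of_real \<beta>) = 0" by (rule strip_unique) simp_all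
  moreover have "F (\<i> * of_real \<beta>) = ext (b o\<^sub>L a)"
    using F(3) [of 0] by (simp add: gauge_action_apply b gauge_simps a mult weight_ext_eq)
  moreover have "\<i> * of_real r * (\<i> * of_real \<beta>) = of_real (- (\<beta> * r))"
    by (simp add: complex_eq_iff)
  ultimately show ?thesis by (simp add: H_def exp_of_real [symmetric])
qed

lemma ext_gauge: assumes "a \<in> A" shows "ext (gauge t a) = ext a"
proof -
  obtain x1 x2 x3 x4 where x: "x1\<in>positive_part A" "x2\<in>positive_part A" "x3\<in>positive_part A"
    "x4\<in>positive_part A" "a = (x1 - x2) + op_scale \<i> (x3 - x4)"
    using dec_ext [OF assms] unfolding dec_def by blast
  note xA = x(1-4) [THEN positive_part_in]
  have g: "ext (gauge t y) = ext y" if y: "y \<in> positive_part A" for y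
  proof -
    have yA: "y \<in> A" using y by (rule positive_part_in)
    have gy: "gauge t y \<in> positive_part A"
      using y gauge_in [OF yA, of t] gauge_positive [of y t] by (simp add: positive_part_def)
    have "\<psi> (gauge_action G t y) = \<psi> y"
      using state y by (simp add: KMS_state_def KMS_weight_def)
    then have "val (gauge t y) = val y" by (simp add: gauge_action_apply yA val_def)
    then show ?thesis by (simp add: ext_pos y gy)
  qed
  show ?thesis unfolding x(5)
    by (simp add: gauge_simps ext_add ext_diff ext_scale diff scale xA gauge_in g x(1-4))
qed

lemma ext_path_op_unequal: assumes "length \<mu> \<noteq> length \<nu>" shows "ext (path_op G w \<mu> \<nu>) = 0"
proof -
  define r where "r = real (length \<mu>) - real (length \<nu>)"
  have r: "r \<noteq> 0" using assms by (simp add: r_def)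
  \<comment> \<open>At time \<open>pi / r\<close> the generator is multiplied by -1, so invariance
    alone forces the value 0, irrespective of \<beta>.\<close>
  have "ext (gauge (pi / r) (path_op G w \<mu> \<nu>)) = ext (path_op G w \<mu> \<nu>)" by (rule ext_gauge [OF path_op_in])
  moreover have "gauge (pi / r) (path_op G w \<mu> \<nu>) = op_scale (exp (\<i> * of_real r * of_real (pi / r))) (path_op G w \<mu> \<nu>)"
    unfolding gauge_path_op r_def ..
  moreover have "exp (\<i> * of_real r * of_real (pi / r)) = - 1"
  proof -
    have "\<i> * of_real r * of_real (pi / r) = \<i> * of_real pi" using r by simp
    then show ?thesis by (simp only: exp_pi_i')
  qed
  ultimately have "- ext (path_op G w \<mu> \<nu>) = ext (path_op G w \<mu> \<nu>)" by (simp add: ext_scale path_op_in del: op.scale_minus_left)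
  then show ?thesis by (simp add: complex_eq_iff)
qed

lemma ext_path_op:
  "ext (path_op G w \<mu> \<nu>) = (if \<mu> = \<nu> \<and> walk G \<mu> w then of_real (exp (- (\<beta> * real (length \<mu>)))) * ext (P w) else 0)"
proof (cases "length \<mu> = length \<nu>")
  case True
  \<comment> \<open>The KMS relation is applied to the first factor, which is homogeneous of degree
    \<open>length \<mu>\<close>; after the exchange the product is a vertex projection or 0 by
    orthogonality.\<close>
  have "ext (path_op G w \<mu> [] o\<^sub>L path_op G w [] \<nu>) = of_real (exp (- (\<beta> * real (length \<mu>)))) * ext (path_op G w [] \<nu> o\<^sub>L path_op G w \<mu> [])"
    by (rule KMS_eigen [OF path_op_in path_op_in]) (simp add: gauge_path_op)
  then show ?thesis using ext_scale [OF zero, of 0]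
    by (cases "\<mu> = \<nu> \<and> walk G \<mu> w") (auto simp: path_op_factor path_op_orthogonal True)
next
  case False
  then show ?thesis using ext_path_op_unequal [OF False] by auto
qed

definition mass :: "'v \<Rightarrow> real" where "mass v = val (P v)"

lemma ext_P: "v \<in> verts G \<Longrightarrow> ext (P v) = of_real (mass v)"
  by (simp add: ext_pos P_pos mass_def)

lemma ext_sum: "finite I \<Longrightarrow> (\<And>i. i \<in> I \<Longrightarrow> B i \<in> A) \<Longrightarrow> ext (sum B I) = (\<Sum>i\<in>I. ext (B i))"
proof (induction I rule: finite_induct)
  case empty
  show ?case using ext_scale [OF zero, of 0] by simp
next
  case (insert i I)
  then show ?case by (simp add: ext_add sum)
qed

lemma mass_eq: assumes v: "v \<in> verts G" shows "(\<Sum>e\<in>out_arcs G v. mass (head G e)) = exp \<beta> * mass v"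
proof -
  have fin: "finite (out_arcs G v)" using rf v by (simp add: row_finite_def)
  have "of_real (mass v) = ext (P v)" by (simp add: ext_P v)
  also have "\<dots> = (\<Sum>e\<in>out_arcs G v. ext (path_op G (head G e) [e] [e]))"
    unfolding path_op_vertex_sum [OF fin] by (intro ext_sum fin path_op_in)
  also have "\<dots> = (\<Sum>e\<in>out_arcs G v. of_real (exp (- \<beta>) * mass (head G e)))"
  proof (rule sum.cong [OF refl])
    fix e assume "e \<in> out_arcs G v"
    then have "e \<in> arcs G" by simp
    then have "ext (path_op G (head G e) [e] [e]) = of_real (exp (- \<beta>)) * ext (P (head G e))"
      using ext_path_op [of "head G e" "[e]" "[e]"] by simp
    then show "ext (path_op G (head G e) [e] [e]) = of_real (exp (- \<beta>) * mass (head G e))"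
      using wf_digraph.head_in_verts [OF wf \<open>e \<in> arcs G\<close>] by (simp only: ext_P of_real_mult)
  qed
  finally have "complex_of_real (mass v) = of_real (\<Sum>e\<in>out_arcs G v. exp (- \<beta>) * mass (head G e))"
    by simp
  then have "mass v = (\<Sum>e\<in>out_arcs G v. exp (- \<beta>) * mass (head G e))"
    by (simp only: of_real_eq_iff)
  then have "mass v = exp (- \<beta>) * (\<Sum>e\<in>out_arcs G v. mass (head G e))"
    by (simp add: sum_distrib_left)
  then show ?thesis by (simp add: exp_minus field_simps)
qed

lemma val_sum_P: "finite F \<Longrightarrow> F \<subseteq> verts G \<Longrightarrow> val (sum P F) = sum mass F"
proof -
  assume F: "finite F" "F \<subseteq> verts G"
  have "of_real (val (sum P F)) = ext (sum P F)" by (simp add: ext_pos proj_pos F)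
  also have "\<dots> = (\<Sum>v\<in>F. ext (P v))" by (intro ext_sum F path_op_in)
  also have "\<dots> = (\<Sum>v\<in>F. of_real (mass v))" using F by (intro sum.cong refl ext_P) auto
  finally have "complex_of_real (val (sum P F)) = of_real (sum mass F)" by simp
  then show ?thesis by (simp only: of_real_eq_iff)
qed

text \<open>Cutting \<open>a\<close> down by a finite sum \<open>p\<close> of vertex projections
  gives \<open>p a p\<close>, which lies below \<open>p\<close> in the operator order and close to
  \<open>a\<close> in norm; the weight is controlled in both respects.\<close>

lemma val_le_mass:
  assumes a: "a \<in> A" "op_le 0 a" "op_le a id_blinfun" and e: "e > 0"
  shows "\<exists>F. finite F \<and> F \<subseteq> verts G \<and> val a \<le> sum mass F + e"
proof -
  obtain F where F: "finite F" "F \<subseteq> verts G" "norm (a - (sum P F o\<^sub>L a)) < e / 2"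
    using proj_approx [OF a(1), of "e / 2"] e by auto
  define p where "p = sum P F"
  have p: "p \<in> A" "is_adj p p" "p o\<^sub>L p = p" "norm p \<le> 1"
    unfolding p_def using F by (auto intro: proj_in proj_adj proj_norm simp: proj_mult)
  have sa: "is_adj a a" using positive_self_adjoint [OF is_adj [OF a(1)] a(2)] is_adj [OF a(1)] by simp
  define b where "b = p o\<^sub>L (a o\<^sub>L p)"
  have bA: "b \<in> A" unfolding b_def by (intro mult p a)
  have quad: "cinner f (b f) = cinner (p f) (a (p f))" for f
    by (simp add: b_def is_adjD [OF p(2)])
  have bpos: "b \<in> positive_part A"
    using a(2) bA by (simp add: positive_part_def op_le_0_iff quad)
  have pquad: "cinner f (p f) = cinner (p f) (p f)" for f
    using is_adjD [OF p(2), of f "p f"] p(3) by (metis blinfun_apply_blinfun_compose)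
  \<comment> \<open>The difference is \<open>p (1 - a) p\<close>; the quadratic form states this
    without a unit in the algebra.\<close>
  have "op_le 0 (p - b)"
    using a(3) by (simp add: op_le_0_iff op_le_def blinfun.diff_left cinner_simps quad pquad)
  then have pb: "p - b \<in> positive_part A" using p bA by (simp add: positive_part_def diff)
  have "val p = val (p - b) + val b" using val_add [OF pb bpos] by simp
  then have vb: "val b \<le> sum mass F" using val_nonneg [of "p - b"] val_sum_P [OF F(1,2)] by (simp add: p_def)
  have "norm (a - b) \<le> norm (a - (p o\<^sub>L a)) + norm (p o\<^sub>L (a - (a o\<^sub>L p)))"
    using norm_triangle_ineq [of "a - (p o\<^sub>L a)" "p o\<^sub>L (a - (a o\<^sub>L p))"]
    by (simp add: b_def blinfun_compose_simps)
  also have "norm (p o\<^sub>L (a - (a o\<^sub>L p))) \<le> 1 * norm (a - (a o\<^sub>L p))"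
    using norm_blinfun_compose mult_right_mono [OF p(4) norm_ge_zero] by (rule order_trans)
  \<comment> \<open>As \<open>a\<close> and \<open>p\<close> are selfadjoint, the two one-sided
    errors are adjoint to each other.\<close>
  also have "norm (a - (a o\<^sub>L p)) = norm (a - (p o\<^sub>L a))"
    by (rule is_adj_norm) (intro is_adj_simps sa p)
  finally have ab: "norm (a - b) \<le> e" using F(3) by (simp add: p_def)
  have apos: "a \<in> positive_part A" using a by (simp add: positive_part_def)
  have "cmod (ext a - ext b) \<le> e"
    using ext_norm_le [OF diff [OF a(1) bA]] ab by (simp add: ext_diff a bA)
  then have "\<bar>val a - val b\<bar> \<le> e"
    unfolding ext_pos [OF apos] ext_pos [OF bpos] of_real_diff [symmetric] norm_of_real .
  then show ?thesis using vb F by (intro exI [of _ F]) auto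
qed

lemma mass_nonneg: "0 \<le> mass v"
  by (simp add: mass_def val_nonneg)

text \<open>Finite sums stay below 1 because sums of vertex projections have norm at most 1. They
  come close to 1 because an element that nearly attains the supremum is dominated by one of them up
  to a small error.\<close>

lemma mass_has_sum: "(mass has_sum 1) (verts G)"
  unfolding has_sum_def tendsto_iff eventually_finite_subsets_at_top
proof (intro allI impI)
  fix e :: real assume e: "e > 0"
  have le1: "sum mass F \<le> 1" if "finite F" "F \<subseteq> verts G" for F
    using contractive [OF proj_pos [OF that]] proj_norm [OF that] val_sum_P [OF that] by simp
  have "ennreal (1 - e / 2) < 1" using e by (simp add: ennreal_less_one_iff)
  then obtain a where a: "a \<in> A" "op_le 0 a" "op_le a id_blinfun" "ennreal (1 - e / 2) < \<psi> a"
    unfolding sup_one [symmetric] less_SUP_iff by blast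
  have "\<psi> a = ennreal (val a)" using a by (intro ennreal_val) (simp add: positive_part_def)
  then have va: "1 - e / 2 < val a" using a(4) val_nonneg [of a] by (cases "1 - e / 2 \<ge> 0") (auto simp: ennreal_less_iff)
  obtain F where F: "finite F" "F \<subseteq> verts G" "val a \<le> sum mass F + e / 2"
    using val_le_mass [OF a(1,2,3), of "e / 2"] e by auto
  show "\<exists>X. finite X \<and> X \<subseteq> verts G \<and> (\<forall>Y. finite Y \<and> X \<subseteq> Y \<and> Y \<subseteq> verts G \<longrightarrow> dist (sum mass Y) 1 < e)"
  proof (intro exI [of _ F] conjI allI impI F(1,2))
    fix Y assume Y: "finite Y \<and> F \<subseteq> Y \<and> Y \<subseteq> verts G"
    then have "sum mass F \<le> sum mass Y" by (intro sum_mono2) (auto simp: mass_nonneg)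
    then show "dist (sum mass Y) 1 < e"
      using le1 [of Y] Y F(3) va by (simp add: dist_real_def)
  qed
qed

end

lemma KMS_state_unique:
  assumes 1: "graph_KMS_state G \<beta> \<psi>" and 2: "graph_KMS_state G \<beta> \<psi>'"
    and eq: "\<And>v. v \<in> verts G \<Longrightarrow> enn2real (\<psi> (path_op G v [] [])) = enn2real (\<psi>' (path_op G v [] []))"
    and a: "a \<in> positive_part (graph_Cstar G)"
  shows "\<psi> a = \<psi>' a"
proof -
  interpret K1: graph_KMS_state G \<beta> \<psi> by (rule 1)
  interpret K2: graph_KMS_state G \<beta> \<psi>' by (rule 2)
  have T: "K1.ext (path_op G w \<mu> \<nu>) = K2.ext (path_op G w \<mu> \<nu>)" for w \<mu> \<nu>
  proof (cases "w \<in> verts G")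
    case True
    have "K1.mass w = K2.mass w"
      unfolding K1.mass_def K2.mass_def K1.val_def K2.val_def by (rule eq [OF True])
    then have "K1.ext (path_op G w [] []) = K2.ext (path_op G w [] [])"
      by (simp only: K1.ext_P [OF True] K2.ext_P [OF True])
    then show ?thesis
      using K1.ext_path_op [of w \<mu> \<nu>] K2.ext_path_op [of w \<mu> \<nu>] by presburger
  next
    case False
    then show ?thesis
      using path_op_zero_verts [OF K1.wf False] K1.ext_scale [OF K1.zero, of 0] K2.ext_scale [OF K1.zero, of 0] by simp
  qed
  note inA = K1.genspan_in
  have gen: "K1.ext b = K2.ext b" if "b \<in> genspan G" for b
    using that
  proof (induction rule: genspan_induct)
    case zero
    show ?case using K1.ext_scale [OF K1.zero, of 0] K2.ext_scale [OF K1.zero, of 0] by simp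
  qed (simp_all add: K1.ext_add K2.ext_add K1.ext_scale K2.ext_scale inA T)
  have aA: "a \<in> graph_Cstar G" by (rule K1.positive_part_in [OF a])
  obtain X where X: "\<And>n. X n \<in> genspan G" "X \<longlonglongrightarrow> a"
    by (rule K1.approx_seq [OF aA], rule that)
  have lim: "(\<lambda>n. norm (X n - a)) \<longlonglongrightarrow> 0" using X(2) by (simp add: LIM_zero tendsto_norm_zero)
  have l1: "(\<lambda>n. K1.ext (X n)) \<longlonglongrightarrow> K1.ext a"
  proof (rule LIM_zero_cancel, rule Lim_null_comparison [OF _ lim], rule always_eventually, rule allI)
    show "norm (K1.ext (X n) - K1.ext a) \<le> norm (X n - a)" for n
      using K1.ext_norm_le [OF K1.diff [OF inA [OF X(1)] aA]] by (simp add: K1.ext_diff inA X aA)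
  qed
  have l2: "(\<lambda>n. K2.ext (X n)) \<longlonglongrightarrow> K2.ext a"
  proof (rule LIM_zero_cancel, rule Lim_null_comparison [OF _ lim], rule always_eventually, rule allI)
    show "norm (K2.ext (X n) - K2.ext a) \<le> norm (X n - a)" for n
      using K2.ext_norm_le [OF K1.diff [OF inA [OF X(1)] aA]] by (simp add: K2.ext_diff inA X aA)
  qed
  have "K1.ext a = K2.ext a" using LIMSEQ_unique l1 l2 gen [OF X(1)] by simp
  then have "K1.val a = K2.val a" unfolding K1.ext_pos [OF a] K2.ext_pos [OF a] of_real_eq_iff .
  then show ?thesis by (simp add: K1.ennreal_val [OF a] K2.ennreal_val [OF a])
qed

section \<open>From eigenvectors to KMS states\<close>

text \<open>Grouping the outgoing edges by their range produces the multiplicities of the adjacency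
  matrix. Inside the proof the eigenvector equation is always used as a sum over edges.\<close>

lemma row_sum_has_sum:
  assumes "finite (out_arcs G v)" and wf: "wf_digraph G"
  shows "((\<lambda>w. real (adj_matrix G v w) * \<xi> w) has_sum (\<Sum>e\<in>out_arcs G v. \<xi> (head G e))) (verts G)"
proof (rule has_sum_finite_neutralI [where B = "head G ` out_arcs G v"])
  have set: "{e \<in> arcs G. tail G e = v \<and> head G e = w} = {e \<in> out_arcs G v. head G e = w}" for w
    by (auto simp: out_arcs_def)
  show "finite (head G ` out_arcs G v)" using assms by simp
  show "head G ` out_arcs G v \<subseteq> verts G" using wf by (auto simp: wf_digraph.head_in_verts)
  show "real (adj_matrix G v w) * \<xi> w = 0" if "w \<in> verts G - head G ` out_arcs G v" for w
  proof -
    have e: "{e \<in> out_arcs G v. head G e = w} = {}" using that by blast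
    show ?thesis unfolding adj_matrix_def set e by simp
  qed
  have "(\<Sum>e\<in>out_arcs G v. \<xi> (head G e))
      = (\<Sum>w\<in>head G ` out_arcs G v. \<Sum>e\<in>{e \<in> out_arcs G v. head G e = w}. \<xi> (head G e))"
    by (rule sum.image_gen [OF assms(1)])
  also have "\<dots> = (\<Sum>w\<in>head G ` out_arcs G v. real (adj_matrix G v w) * \<xi> w)"
    unfolding adj_matrix_def set by (intro sum.cong refl) simp
  finally show "(\<Sum>e\<in>out_arcs G v. \<xi> (head G e)) = (\<Sum>w\<in>head G ` out_arcs G v. real (adj_matrix G v w) * \<xi> w)" .
qed

lemma path_exists:
  assumes wf: "wf_digraph G" and ns: "no_sinks G" and v: "v \<in> verts G"
  shows "\<exists>p. p \<in> inf_paths G \<and> tail G (p 0) = v"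
proof -
  define nxt where "nxt = (\<lambda>w. SOME e. e \<in> out_arcs G w)"
  have nx: "nxt w \<in> arcs G" "tail G (nxt w) = w" if "w \<in> verts G" for w
  proof -
    have "out_arcs G w \<noteq> {}" using ns that unfolding no_sinks_def by blast
    then have "\<exists>e. e \<in> out_arcs G w" by blast
    then have "nxt w \<in> out_arcs G w" unfolding nxt_def by (rule someI_ex)
    then show "nxt w \<in> arcs G" "tail G (nxt w) = w" by auto
  qed
  define p where "p = rec_nat (nxt v) (\<lambda>_ e. nxt (head G e))"
  have p: "p 0 = nxt v" "p (Suc i) = nxt (head G (p i))" for i by (simp_all add: p_def)
  have arcs: "p i \<in> arcs G" for i
  proof (induction i)
    case 0 then show ?case using nx v by (simp add: p)
  next
    case (Suc i) then show ?case using nx wf_digraph.head_in_verts [OF wf] by (simp add: p)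
  qed
  have "p \<in> inf_paths G"
    using arcs nx wf_digraph.head_in_verts [OF wf] by (simp add: inf_paths_def p)
  moreover have "tail G (p 0) = v" using nx v by (simp add: p)
  ultimately show ?thesis by blast
qed

locale graph_eigenvector = graph_algebra G for G :: "('v, 'e) pre_digraph" +
  fixes \<beta> :: real and \<xi> :: "'v \<Rightarrow> real"
  assumes ns: "no_sinks G"
    and nonneg: "v \<in> verts G \<Longrightarrow> 0 \<le> \<xi> v"
    and eig: "v \<in> verts G \<Longrightarrow> (\<Sum>e\<in>out_arcs G v. \<xi> (head G e)) = exp \<beta> * \<xi> v"
    and total: "(\<xi> has_sum 1) (verts G)"
begin

text \<open>
  The measure with mass \<open>exp (- n \<beta>) \<xi>\<^sub>w\<close> on the cylinder of a path of length \<open>n\<close> ending at \<open>w\<close> is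
  approximated by concentrating this mass on the path that continues with a fixed path \<open>base w\<close>.
  The sets \<open>tail_paths n v\<close> are the supports of these approximations.
\<close>

definition base :: "'v \<Rightarrow> 'e path" where
  "base v = (SOME p. p \<in> inf_paths G \<and> tail G (p 0) = v)"

lemma base: assumes "v \<in> verts G" shows "base v \<in> inf_paths G \<and> tail G (base v 0) = v"
  unfolding base_def by (rule someI_ex [OF path_exists [OF wf ns assms]])

definition tail_paths :: "nat \<Rightarrow> 'v \<Rightarrow> 'e path set" where
  "tail_paths n v = {p \<in> inf_paths G. tail G (p 0) = v \<and> (\<lambda>i. p (n + i)) = base (tail G (p n))}"

definition path_mass :: "nat \<Rightarrow> 'e path \<Rightarrow> real" where
  "path_mass n p = exp (- (\<beta> * real n)) * \<xi> (tail G (p n))"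

lemma tail_in: "p \<in> inf_paths G \<Longrightarrow> tail G (p n) \<in> verts G"
  using wf_digraph.tail_in_verts [OF wf] by (simp add: inf_paths_def)

lemma tail_paths_0: assumes "v \<in> verts G" shows "tail_paths 0 v = {base v}"
proof
  show "tail_paths 0 v \<subseteq> {base v}"
  proof
    fix p assume "p \<in> tail_paths 0 v"
    then have "tail G (p 0) = v" "p = base (tail G (p 0))" by (auto simp only: tail_paths_def mem_Collect_eq add_0)
    then show "p \<in> {base v}" by (metis singletonI)
  qed
  show "{base v} \<subseteq> tail_paths 0 v" using base [OF assms] by (simp add: tail_paths_def)
qed

lemma tail_paths_conc:
  assumes "length \<mu> \<le> n"
  shows "conc \<mu> q \<in> tail_paths n v \<longleftrightarrow> walk G \<mu> (tail G (q 0)) \<and> start G \<mu> (tail G (q 0)) = v \<and> q \<in> tail_paths (n - length \<mu>) (tail G (q 0))"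
proof -
  have "conc \<mu> q (n + i) = q (n - length \<mu> + i)" for i using assms by (simp add: conc_nth)
  moreover have "conc \<mu> q n = q (n - length \<mu>)" using assms by (simp add: conc_nth)
  ultimately show ?thesis by (auto simp: tail_paths_def conc_inf_paths tail_conc)
qed

lemma path_mass_conc: "length \<mu> \<le> n \<Longrightarrow> path_mass n (conc \<mu> q) = exp (- (\<beta> * real (length \<mu>))) * path_mass (n - length \<mu>) q"
proof -
  assume le: "length \<mu> \<le> n"
  have "- (\<beta> * real n) = - (\<beta> * real (length \<mu>)) + - (\<beta> * real (n - length \<mu>))"
    using le by (simp add: of_nat_diff algebra_simps)
  then have "exp (- (\<beta> * real n)) = exp (- (\<beta> * real (length \<mu>))) * exp (- (\<beta> * real (n - length \<mu>)))"
    by (simp only: exp_add)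
  then show ?thesis using le by (simp add: path_mass_def conc_nth)
qed

lemma tail_paths_Suc: "v \<in> verts G \<Longrightarrow> tail_paths (Suc n) v = (\<Union>e\<in>out_arcs G v. case_nat e ` tail_paths n (head G e))"
proof
  assume v: "v \<in> verts G"
  show "tail_paths (Suc n) v \<subseteq> (\<Union>e\<in>out_arcs G v. case_nat e ` tail_paths n (head G e))"
  proof
    fix p assume p: "p \<in> tail_paths (Suc n) v"
    define q where "q = (\<lambda>i. p (Suc i))"
    have pq: "p = conc [p 0] q" by (auto simp: q_def fun_eq_iff split: nat.splits)
    have "conc [p 0] q \<in> tail_paths (Suc n) v" using p pq by simp
    then have "walk G [p 0] (tail G (q 0)) \<and> start G [p 0] (tail G (q 0)) = v \<and> q \<in> tail_paths n (tail G (q 0))"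
      by (subst (asm) tail_paths_conc) simp_all
    then have "p 0 \<in> out_arcs G v" "q \<in> tail_paths n (head G (p 0))" by auto
    then show "p \<in> (\<Union>e\<in>out_arcs G v. case_nat e ` tail_paths n (head G e))"
      using pq by (intro UN_I [of "p 0"] image_eqI [of _ _ q]) simp_all
  qed
  show "(\<Union>e\<in>out_arcs G v. case_nat e ` tail_paths n (head G e)) \<subseteq> tail_paths (Suc n) v"
  proof
    fix p assume "p \<in> (\<Union>e\<in>out_arcs G v. case_nat e ` tail_paths n (head G e))"
    then obtain e q where eq: "e \<in> out_arcs G v" "q \<in> tail_paths n (head G e)" "p = conc [e] q" by auto
    then have "tail G (q 0) = head G e" by (simp add: tail_paths_def)
    then show "p \<in> tail_paths (Suc n) v" unfolding eq(3) using eq by (subst tail_paths_conc) auto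
  qed
qed

text \<open>The eigenvector equation is exactly what keeps the total mass over \<open>v\<close>
  independent of \<open>n\<close>: prolonging paths at the front by one edge multiplies the sum of
  the \<xi> at the ranges by \<open>exp (- \<beta>)\<close>.\<close>

lemma tail_paths_sum: "v \<in> verts G \<Longrightarrow> finite (tail_paths n v) \<and> sum (path_mass n) (tail_paths n v) = \<xi> v"
proof (induction n arbitrary: v)
  case 0
  then show ?case using base [of v] by (simp add: tail_paths_0 path_mass_def)
next
  case (Suc n)
  have fin: "finite (out_arcs G v)" using rf Suc.prems by (simp add: row_finite_def)
  have IH: "finite (tail_paths n (head G e))" "sum (path_mass n) (tail_paths n (head G e)) = \<xi> (head G e)" if "e \<in> out_arcs G v" for e
    using Suc.IH [of "head G e"] that wf_digraph.head_in_verts [OF wf] by auto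
  have "sum (path_mass (Suc n)) (tail_paths (Suc n) v) = (\<Sum>e\<in>out_arcs G v. sum (path_mass (Suc n)) (case_nat e ` tail_paths n (head G e)))"
    unfolding tail_paths_Suc [OF Suc.prems]
    by (rule sum.UNION_disjoint [OF fin]) (use IH in auto)
  also have "\<dots> = (\<Sum>e\<in>out_arcs G v. \<Sum>q\<in>tail_paths n (head G e). exp (- \<beta>) * path_mass n q)"
  proof (rule sum.cong [OF refl])
    fix e
    have "sum (path_mass (Suc n)) (case_nat e ` tail_paths n (head G e)) = (\<Sum>q\<in>tail_paths n (head G e). path_mass (Suc n) (case_nat e q))"
      by (subst sum.reindex) (auto simp: inj_on_def)
    moreover have "path_mass (Suc n) (case_nat e q) = exp (- \<beta>) * path_mass n q" for q
      using path_mass_conc [of "[e]" "Suc n" q] by simp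
    ultimately show "sum (path_mass (Suc n)) (case_nat e ` tail_paths n (head G e)) = (\<Sum>q\<in>tail_paths n (head G e). exp (- \<beta>) * path_mass n q)"
      by simp
  qed
  also have "\<dots> = exp (- \<beta>) * (\<Sum>e\<in>out_arcs G v. \<xi> (head G e))"
    using IH by (simp add: sum_distrib_left [symmetric])
  also have "\<dots> = \<xi> v" by (simp add: eig Suc.prems exp_minus)
  finally show ?case
    unfolding tail_paths_Suc [OF Suc.prems] using fin IH by auto
qed

lemma path_mass_nonneg: "p \<in> inf_paths G \<Longrightarrow> 0 \<le> path_mass n p"
  by (simp add: path_mass_def nonneg tail_in)

section \<open>The approximating vector states and their limit\<close>

definition unit_support :: "nat \<Rightarrow> 'e garrow set" where
  "unit_support n = {(p, k, q). k = 0 \<and> p = q \<and> p \<in> tail_paths n (tail G (p 0))}"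

definition \<Omega>_fun :: "nat \<Rightarrow> 'e garrow \<Rightarrow> complex" where
  "\<Omega>_fun n g = (if g \<in> unit_support n then of_real (sqrt (path_mass n (fst g))) else 0)"

definition \<Omega> :: "nat \<Rightarrow> 'e garrow ell2" where "\<Omega> n = Abs_ell2 (\<Omega>_fun n)"

text \<open>The supports for different starting vertices are disjoint and carry the masses of \<xi>,
  so the normalisation of \<xi> bounds every finite sum.\<close>

lemma \<Omega>_bound:
  assumes F: "finite F"
  shows "(\<Sum>g\<in>F. (cmod (\<Omega>_fun n g))\<^sup>2) \<le> 1\<^sup>2"
proof -
  define V' where "V' = (\<lambda>g. tail G (fst g 0)) ` (F \<inter> unit_support n)"
  have V': "finite V'" "V' \<subseteq> verts G"
    using F by (auto simp: V'_def unit_support_def tail_paths_def intro: tail_in)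
  have finX: "finite (tail_paths n v)" if "v \<in> V'" for v using tail_paths_sum V' that by blast
  define B where "B = (\<Union>v\<in>V'. tail_paths n v)"
  have "(\<Sum>g\<in>F. (cmod (\<Omega>_fun n g))\<^sup>2) = (\<Sum>g\<in>F \<inter> unit_support n. path_mass n (fst g))"
    unfolding sum.inter_restrict [OF F]
    by (intro sum.cong refl) (auto simp: \<Omega>_fun_def unit_support_def tail_paths_def path_mass_nonneg)
  also have "\<dots> = sum (path_mass n) (fst ` (F \<inter> unit_support n))"
    by (subst sum.reindex) (auto simp: inj_on_def unit_support_def)
  also have "\<dots> \<le> sum (path_mass n) B"
  proof (rule sum_mono2)
    show "finite B" unfolding B_def using V' finX by blast
    show "fst ` (F \<inter> unit_support n) \<subseteq> B" by (auto simp: B_def V'_def unit_support_def)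
  qed (auto simp: B_def tail_paths_def path_mass_nonneg)
  also have "\<dots> = (\<Sum>v\<in>V'. sum (path_mass n) (tail_paths n v))"
    unfolding B_def by (rule sum.UNION_disjoint [OF V'(1)]) (use finX in \<open>auto simp: tail_paths_def\<close>)
  also have "\<dots> = sum \<xi> V'" using tail_paths_sum V' by (intro sum.cong refl) auto
  also have "\<dots> \<le> 1"
    by (rule has_sum_mono_neutral [OF has_sum_finiteI [OF V'(1) refl] total]) (use V' nonneg in auto)
  finally show ?thesis by simp
qed

lemma \<Omega>_apply: "ell2_apply (\<Omega> n) = \<Omega>_fun n" and \<Omega>_norm: "norm (\<Omega> n) \<le> 1"
  unfolding \<Omega>_def by (rule ell2_boundedI [OF \<Omega>_bound]; simp)+

definition Lam_approx :: "nat \<Rightarrow> 'e garrow op \<Rightarrow> complex" where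
  "Lam_approx n a = cinner (\<Omega> n) (a (\<Omega> n))"

lemma Lam_approx_simps:
  "Lam_approx n (a + b) = Lam_approx n a + Lam_approx n b" "Lam_approx n (a - b) = Lam_approx n a - Lam_approx n b"
  "Lam_approx n (op_scale c a) = c * Lam_approx n a" "Lam_approx n 0 = 0"
  by (simp_all add: Lam_approx_def blinfun.add_left blinfun.diff_left cinner_add_right cinner_simps cinner_scale_right)

lemma Lam_approx_norm: "cmod (Lam_approx n a) \<le> norm a"
proof -
  have "cmod (Lam_approx n a) \<le> norm (\<Omega> n) * norm (a (\<Omega> n))" unfolding Lam_approx_def by (rule norm_cinner_le)
  also have "\<dots> \<le> norm (\<Omega> n) * (norm a * norm (\<Omega> n))" by (intro mult_left_mono norm_blinfun) simp
  also have "\<dots> \<le> 1 * (norm a * 1)" by (intro mult_mono mult_left_mono \<Omega>_norm) auto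
  finally show ?thesis by simp
qed

text \<open>Membership of \<open>w\<close> in the vertex set is explicit because the empty word is a
  walk everywhere, while nothing is assumed about \<xi> off the vertices.\<close>

definition Lam_val :: "'v \<Rightarrow> 'e list \<Rightarrow> 'e list \<Rightarrow> real" where
  "Lam_val w \<mu> \<nu> = (if \<mu> = \<nu> \<and> walk G \<mu> w \<and> w \<in> verts G then exp (- (\<beta> * real (length \<mu>))) * \<xi> w else 0)"

text \<open>The vectors live on units. Exchanging a prefix preserves the source, so a unit becomes a
  unit again only if the lengths agree and the new range is the old one, which forces equal
  words.\<close>

lemma Lam_approx_path_op_terms:
  assumes g: "g \<in> unit_support n" and d: "g \<in> op_dom G w \<mu> \<nu>" and m: "swap_prefix \<mu> \<nu> g \<in> unit_support n"
  obtains q where "\<mu> = \<nu>" "g = (conc \<mu> q, 0, conc \<mu> q)" "tail G (q 0) = w" "walk G \<mu> w"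
    "conc \<mu> q \<in> tail_paths n (tail G (conc \<mu> q 0))" "swap_prefix \<mu> \<nu> g = g"
proof -
  obtain q k r where q: "g = (conc \<mu> q, k, r)" "tail G (q 0) = w" "walk G \<mu> w"
    using d by (rule op_dom_cases)
  have kr: "k = 0" "r = conc \<mu> q" "conc \<mu> q \<in> tail_paths n (tail G (conc \<mu> q 0))" using g by (auto simp: q(1) unit_support_def)
  have "int (length \<nu>) = int (length \<mu>)" "conc \<nu> q = conc \<mu> q"
    using m unfolding q(1) swap_prefix_conc kr by (auto simp: unit_support_def)
  then have len: "length \<nu> = length \<mu>" and eq: "\<And>i. conc \<nu> q i = conc \<mu> q i" by auto
  have "\<mu> = \<nu>"
  proof (rule nth_equalityI)
    show "\<mu> ! i = \<nu> ! i" if "i < length \<mu>" for i using eq [of i] that len by (simp add: conc_nth)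
  qed (simp add: len)
  then show ?thesis using that [of q] q kr by simp
qed

text \<open>As soon as \<open>n\<close> reaches the length of the word, the approximation is exact;
  limits on the span of the generators thus exist because the sequences become constant.\<close>

lemma Lam_approx_path_op: assumes "length \<mu> \<le> n" shows "Lam_approx n (path_op G w \<mu> \<nu>) = of_real (Lam_val w \<mu> \<nu>)"
proof -
  let ?f = "\<lambda>g. cnj (ell2_apply (\<Omega> n) g) * ell2_apply (path_op G w \<mu> \<nu> (\<Omega> n)) g"
  have f: "?f g = (if g \<in> unit_support n \<and> g \<in> op_dom G w \<mu> \<nu> \<and> swap_prefix \<mu> \<nu> g \<in> unit_support n then of_real (path_mass n (fst g)) else 0)" for g
  proof (cases "g \<in> unit_support n \<and> g \<in> op_dom G w \<mu> \<nu> \<and> swap_prefix \<mu> \<nu> g \<in> unit_support n")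
    case True
    then obtain q where q: "g = (conc \<mu> q, 0, conc \<mu> q)" "conc \<mu> q \<in> tail_paths n (tail G (conc \<mu> q 0))" "swap_prefix \<mu> \<nu> g = g"
      by (metis Lam_approx_path_op_terms)
    have "0 \<le> path_mass n (fst g)" using q(2) by (simp add: q(1) tail_paths_def path_mass_nonneg)
    then show ?thesis using True q(3) by (simp add: path_op_apply \<Omega>_apply \<Omega>_fun_def flip: of_real_mult)
  next
    case False
    then show ?thesis by (auto simp: path_op_apply \<Omega>_apply \<Omega>_fun_def)
  qed
  have hs: "(?f has_sum Lam_approx n (path_op G w \<mu> \<nu>)) UNIV"
    unfolding Lam_approx_def by (rule cinner_has_sum)
  have "(?f has_sum of_real (Lam_val w \<mu> \<nu>)) UNIV"
  proof (cases "\<mu> = \<nu> \<and> walk G \<mu> w \<and> w \<in> verts G")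
    case True
    \<comment> \<open>The arrows that contribute are the units at \<mu> followed by a support path
      of level \<open>n - length \<mu>\<close> starting at \<open>w\<close>. Those support paths
      have total mass \<open>\<xi> w\<close>, and the prefix contributes the factor
      \<open>exp (- (\<beta> * length \<mu>))\<close>.\<close>
    define B where "B = (\<lambda>q. (conc \<mu> q, 0::int, conc \<mu> q)) ` tail_paths (n - length \<mu>) w"
    have B: "g \<in> unit_support n \<and> g \<in> op_dom G w \<mu> \<nu> \<and> swap_prefix \<mu> \<nu> g \<in> unit_support n" if gB: "g \<in> B" for g
    proof -
      obtain q where q: "q \<in> tail_paths (n - length \<mu>) w" "g = (conc \<mu> q, 0, conc \<mu> q)" using gB by (auto simp: B_def)
      have q0: "tail G (q 0) = w" "q \<in> inf_paths G" using q(1) by (auto simp: tail_paths_def)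
      have "conc \<mu> q \<in> tail_paths n (tail G (conc \<mu> q 0))"
        unfolding tail_paths_conc [OF assms] tail_conc q0(1) using q(1) True by blast
      then have "g \<in> unit_support n" by (simp add: unit_support_def q(2))
      moreover have "g \<in> op_dom G w \<mu> \<nu>"
        unfolding q(2) op_dom_conc using q0 True by (auto simp: groupoid_iff conc_inf_paths intro!: exI [of _ 0])
      moreover have "swap_prefix \<mu> \<nu> g = g" using True by (simp add: q(2))
      ultimately show ?thesis by simp
    qed
    have fin: "finite (tail_paths (n - length \<mu>) w)" and sm: "sum (path_mass (n - length \<mu>)) (tail_paths (n - length \<mu>) w) = \<xi> w"
      using tail_paths_sum True by auto
    show ?thesis
    proof (rule has_sum_finite_neutralI [where B = B])
      show "finite B" unfolding B_def using fin by simp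
      show "?f g = 0" if "g \<in> UNIV - B" for g
      proof (rule ccontr)
        assume "?f g \<noteq> 0"
        then have "g \<in> unit_support n" "g \<in> op_dom G w \<mu> \<nu>" "swap_prefix \<mu> \<nu> g \<in> unit_support n" unfolding f by (auto split: if_splits)
        then obtain q where q: "g = (conc \<mu> q, 0, conc \<mu> q)" "tail G (q 0) = w"
          "conc \<mu> q \<in> tail_paths n (tail G (conc \<mu> q 0))"
          by (metis Lam_approx_path_op_terms)
        then have "q \<in> tail_paths (n - length \<mu>) w" using tail_paths_conc [OF assms] by blast
        then show False using that q(1) by (auto simp: B_def)
      qed
      have "sum ?f B = (\<Sum>g\<in>B. of_real (path_mass n (fst g)))" by (rule sum.cong [OF refl]) (simp only: f B simp_thms if_True)
      also have "\<dots> = (\<Sum>q\<in>tail_paths (n - length \<mu>) w. of_real (path_mass n (conc \<mu> q)))"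
        unfolding B_def by (subst sum.reindex) (auto simp: inj_on_def)
      also have "\<dots> = of_real (\<Sum>q\<in>tail_paths (n - length \<mu>) w. exp (- (\<beta> * real (length \<mu>))) * path_mass (n - length \<mu>) q)"
        by (simp add: path_mass_conc [OF assms])
      also have "\<dots> = of_real (Lam_val w \<mu> \<nu>)"
        unfolding Lam_val_def if_P [OF True] sum_distrib_left [symmetric] sm ..
      finally show "of_real (Lam_val w \<mu> \<nu>) = sum ?f B" by simp
    qed auto
  next
    case False
    have "?f g = 0" for g
    proof (rule ccontr)
      assume "?f g \<noteq> 0"
      then have gw: "g \<in> unit_support n" "g \<in> op_dom G w \<mu> \<nu>" "swap_prefix \<mu> \<nu> g \<in> unit_support n" unfolding f by (auto split: if_splits)
      then obtain q where q: "\<mu> = \<nu>" "tail G (q 0) = w" "walk G \<mu> w" "conc \<mu> q \<in> tail_paths n (tail G (conc \<mu> q 0))"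
        by (metis Lam_approx_path_op_terms)
      have "q \<in> inf_paths G" using q(4) by (simp add: tail_paths_def conc_inf_paths)
      then show False using False q tail_in [of q 0] by simp
    qed
    then have "(?f has_sum 0) UNIV" by (intro has_sum_0) simp
    then show ?thesis unfolding Lam_val_def if_not_P [OF False] of_real_0 .
  qed
  then show ?thesis by (rule has_sum_unique [OF hs])
qed

lemma Lam_approx_genspan: "a \<in> genspan G \<Longrightarrow> convergent (\<lambda>n. Lam_approx n a)"
proof (induction rule: genspan_induct)
  case (T w \<mu> \<nu>)
  have "(\<lambda>n. Lam_approx n (path_op G w \<mu> \<nu>)) \<longlonglongrightarrow> of_real (Lam_val w \<mu> \<nu>)"
    by (rule tendsto_eventually) (auto simp: eventually_sequentially Lam_approx_path_op intro!: exI [of _ "length \<mu>"])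
  then show ?case by (rule convergentI)
qed (auto simp: Lam_approx_simps intro: convergent_add convergent_mult convergent_const)

lemma Lam_approx_convergent: assumes "a \<in> A" shows "convergent (\<lambda>n. Lam_approx n a)"
proof -
  obtain Y where Y: "\<And>n. Y n \<in> genspan G" "Y \<longlonglongrightarrow> a" by (rule approx_seq [OF assms], rule that)
  have "Cauchy (\<lambda>n. Lam_approx n a)"
  proof (rule CauchyI)
    fix e :: real assume e: "e > 0"
    then have "e / 3 > 0" by simp
    then obtain k where k: "norm (Y k - a) < e / 3" using LIMSEQ_D [OF Y(2)] by blast
    have "Cauchy (\<lambda>n. Lam_approx n (Y k))" using Lam_approx_genspan [OF Y(1)] by (simp add: Cauchy_convergent_iff)
    then obtain M where M: "\<And>m n. m \<ge> M \<Longrightarrow> n \<ge> M \<Longrightarrow> norm (Lam_approx m (Y k) - Lam_approx n (Y k)) < e / 3"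
      using CauchyD [OF _ \<open>e / 3 > 0\<close>] by blast
    have d: "norm (Lam_approx n (Y k) - Lam_approx n a) < e / 3" for n
      using Lam_approx_norm [of n "Y k - a"] k by (simp add: Lam_approx_simps)
    have "norm (Lam_approx m a - Lam_approx n a) < e" if "m \<ge> M" "n \<ge> M" for m n
    proof -
      define x y z where "x = Lam_approx m (Y k) - Lam_approx m a" and "y = Lam_approx m (Y k) - Lam_approx n (Y k)"
        and "z = Lam_approx n (Y k) - Lam_approx n a"
      have "Lam_approx m a - Lam_approx n a = - x + y + z" by (simp add: x_def y_def z_def)
      then have "norm (Lam_approx m a - Lam_approx n a) \<le> norm x + norm y + norm z"
        using norm_triangle_ineq [of "- x + y" z] norm_triangle_ineq [of "- x" y] by simp
      then show ?thesis using d [of m] d [of n] M [OF that]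
        unfolding x_def y_def z_def by linarith
    qed
    then show "\<exists>M. \<forall>m\<ge>M. \<forall>n\<ge>M. norm (Lam_approx m a - Lam_approx n a) < e" by blast
  qed
  then show ?thesis by (simp add: Cauchy_convergent_iff)
qed

definition Lam :: "'e garrow op \<Rightarrow> complex" where "Lam a = lim (\<lambda>n. Lam_approx n a)"

lemma Lam_tendsto: "a \<in> A \<Longrightarrow> (\<lambda>n. Lam_approx n a) \<longlonglongrightarrow> Lam a"
  unfolding Lam_def using Lam_approx_convergent by (simp add: convergent_LIMSEQ_iff)

lemma Lam_eqI: "a \<in> A \<Longrightarrow> (\<lambda>n. Lam_approx n a) \<longlonglongrightarrow> z \<Longrightarrow> Lam a = z"
  using LIMSEQ_unique Lam_tendsto by blast

lemma Lam_add: "a \<in> A \<Longrightarrow> b \<in> A \<Longrightarrow> Lam (a + b) = Lam a + Lam b"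
  by (rule Lam_eqI) (auto simp: Lam_approx_simps add intro: tendsto_add Lam_tendsto)

lemma Lam_diff: "a \<in> A \<Longrightarrow> b \<in> A \<Longrightarrow> Lam (a - b) = Lam a - Lam b"
  by (rule Lam_eqI) (auto simp: Lam_approx_simps diff intro: tendsto_diff Lam_tendsto)

lemma Lam_scale: "a \<in> A \<Longrightarrow> Lam (op_scale c a) = c * Lam a"
  by (rule Lam_eqI) (auto simp: Lam_approx_simps scale intro: tendsto_mult_left Lam_tendsto)

lemma Lam_zero: "Lam 0 = 0"
  by (rule Lam_eqI) (auto simp: Lam_approx_simps zero)

lemma Lam_norm: "a \<in> A \<Longrightarrow> cmod (Lam a) \<le> norm a"
  using Lim_bounded [OF tendsto_norm [OF Lam_tendsto]] Lam_approx_norm by blast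

lemma Lam_path_op: "Lam (path_op G w \<mu> \<nu>) = of_real (Lam_val w \<mu> \<nu>)"
proof (rule Lam_eqI [OF path_op_in], rule tendsto_eventually)
  show "\<forall>\<^sub>F n in sequentially. Lam_approx n (path_op G w \<mu> \<nu>) = of_real (Lam_val w \<mu> \<nu>)"
    by (auto simp: eventually_sequentially Lam_approx_path_op intro!: exI [of _ "length \<mu>"])
qed

lemma Lam_adj: assumes "a \<in> A" shows "Lam (op_adj a) = cnj (Lam a)"
proof (rule Lam_eqI [OF adj [OF assms]])
  have "Lam_approx n (op_adj a) = cnj (Lam_approx n a)" for n
    using is_adjD [OF is_adj [OF assms], of "\<Omega> n" "\<Omega> n"] cinner_commute [of "a (\<Omega> n)" "\<Omega> n"]
    by (simp add: Lam_approx_def)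
  then show "(\<lambda>n. Lam_approx n (op_adj a)) \<longlonglongrightarrow> cnj (Lam a)" by (simp add: tendsto_cnj Lam_tendsto assms)
qed

lemma Lam_pos: assumes "a \<in> positive_part A" shows "Lam a = of_real (Re (Lam a))" "0 \<le> Re (Lam a)"
proof -
  have aA: "a \<in> A" using assms by (rule positive_part_in)
  have n: "Im (Lam_approx n a) = 0" "0 \<le> Re (Lam_approx n a)" for n
    using assms by (auto simp: positive_part_def op_le_0_iff Lam_approx_def complex_is_Real_iff)
  have "(\<lambda>n. Im (Lam_approx n a)) \<longlonglongrightarrow> Im (Lam a)" by (intro tendsto_Im Lam_tendsto aA)
  then have "Im (Lam a) = 0" by (simp add: n LIMSEQ_const_iff)
  then show "Lam a = of_real (Re (Lam a))" by (simp add: complex_eq_iff)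
  have "(\<lambda>n. Re (Lam_approx n a)) \<longlonglongrightarrow> Re (Lam a)" by (intro tendsto_Re Lam_tendsto aA)
  then show "0 \<le> Re (Lam a)" by (rule LIMSEQ_le_const) (simp add: n)
qed

lemma Lam_limit: assumes "\<And>n. Y n \<in> A" "Y \<longlonglongrightarrow> a" "a \<in> A" shows "(\<lambda>n. Lam (Y n)) \<longlonglongrightarrow> Lam a"
proof (rule LIM_zero_cancel, rule Lim_null_comparison, rule always_eventually, rule allI)
  show "norm (Lam (Y n) - Lam a) \<le> norm (Y n - a)" for n
    using Lam_norm [OF diff [OF assms(1,3)]] by (simp add: Lam_diff assms)
  show "(\<lambda>n. norm (Y n - a)) \<longlonglongrightarrow> 0" using assms(2) by (simp add: LIM_zero tendsto_norm_zero)
qed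

text \<open>Packages the density argument that \<open>twistedI\<close> and \<open>Lam_gauge\<close>
  share.\<close>

lemma A_eqI:
  assumes "\<And>w \<mu> \<nu>. f (path_op G w \<mu> \<nu>) = (h (path_op G w \<mu> \<nu>) :: complex)" "f 0 = h 0"
    "\<And>a b. a \<in> A \<Longrightarrow> b \<in> A \<Longrightarrow> f (a + b) = f a + f b" "\<And>a b. a \<in> A \<Longrightarrow> b \<in> A \<Longrightarrow> h (a + b) = h a + h b"
    "\<And>a c. a \<in> A \<Longrightarrow> f (op_scale c a) = c * f a" "\<And>a c. a \<in> A \<Longrightarrow> h (op_scale c a) = c * h a"
    "\<And>Y a. (\<And>n. Y n \<in> A) \<Longrightarrow> Y \<longlonglongrightarrow> a \<Longrightarrow> a \<in> A \<Longrightarrow> (\<lambda>n. f (Y n)) \<longlonglongrightarrow> f a"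
    "\<And>Y a. (\<And>n. Y n \<in> A) \<Longrightarrow> Y \<longlonglongrightarrow> a \<Longrightarrow> a \<in> A \<Longrightarrow> (\<lambda>n. h (Y n)) \<longlonglongrightarrow> h a"
    and a: "a \<in> A"
  shows "f a = h a"
proof -
  have g: "f b = h b" if "b \<in> genspan G" for b
    using that by (induction rule: genspan_induct) (simp_all add: assms genspan_in)
  obtain Y where Y: "\<And>n. Y n \<in> genspan G" "Y \<longlonglongrightarrow> a" by (rule approx_seq [OF a], rule that)
  have "(\<lambda>n. f (Y n)) \<longlonglongrightarrow> f a" "(\<lambda>n. h (Y n)) \<longlonglongrightarrow> h a"
    by (rule assms(7,8) [OF genspan_in [OF Y(1)] Y(2) a])+
  then show ?thesis using g [OF Y(1)] LIMSEQ_unique by auto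
qed

section \<open>The KMS condition for the limit functional\<close>

text \<open>For a gauge homogeneous \<open>b\<close> of degree \<open>r\<close> this is the KMS condition; it is multiplicative in \<open>b\<close>, so it is enough to check edges and vertices.\<close>

definition twisted :: "'e garrow op \<Rightarrow> real \<Rightarrow> bool" where
  "twisted b r \<longleftrightarrow> b \<in> A \<and> (\<forall>a\<in>A. Lam (b o\<^sub>L a) = of_real (exp (- (\<beta> * r))) * Lam (a o\<^sub>L b))"

lemma twistedI:
  assumes b: "b \<in> A" and T: "\<And>w \<mu> \<nu>. Lam (b o\<^sub>L path_op G w \<mu> \<nu>) = of_real (exp (- (\<beta> * r))) * Lam (path_op G w \<mu> \<nu> o\<^sub>L b)"
  shows "twisted b r"
  unfolding twisted_def
proof (intro conjI ballI b)
  fix a assume a: "a \<in> A"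
  show "Lam (b o\<^sub>L a) = of_real (exp (- (\<beta> * r))) * Lam (a o\<^sub>L b)"
  proof (rule A_eqI [of "\<lambda>a. Lam (b o\<^sub>L a)" "\<lambda>a. of_real (exp (- (\<beta> * r))) * Lam (a o\<^sub>L b)", OF T _ _ _ _ _ _ _ a])
    fix Y a assume Y: "\<And>n. Y n \<in> A" "Y \<longlonglongrightarrow> a" "a \<in> A"
    show "(\<lambda>n. Lam (b o\<^sub>L Y n)) \<longlonglongrightarrow> Lam (b o\<^sub>L a)"
      by (intro Lam_limit mult b tendsto_compose_op tendsto_const Y)
    show "(\<lambda>n. of_real (exp (- (\<beta> * r))) * Lam (Y n o\<^sub>L b)) \<longlonglongrightarrow> of_real (exp (- (\<beta> * r))) * Lam (a o\<^sub>L b)"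
      by (intro tendsto_mult Lam_limit mult b tendsto_compose_op tendsto_const Y)
  qed (simp_all add: blinfun_compose_simps Lam_add Lam_scale mult b compose_scale op_scale_compose_left
      algebra_simps Lam_zero)
qed

text \<open>The factors are carried around one after the other, and each contributes its own
  exponential.\<close>

lemma twisted_mult:
  assumes b: "twisted b r" and c: "twisted c s"
  shows "twisted (b o\<^sub>L c) (r + s)"
  unfolding twisted_def
proof (intro conjI ballI)
  have bA: "b \<in> A" and cA: "c \<in> A" using b c by (auto simp: twisted_def)
  then show "b o\<^sub>L c \<in> A" by (rule mult)
  fix a assume a: "a \<in> A"
  have "Lam (b o\<^sub>L (c o\<^sub>L a)) = of_real (exp (- (\<beta> * r))) * Lam ((c o\<^sub>L a) o\<^sub>L b)"
    using b mult [OF cA a] unfolding twisted_def by blast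
  also have "(c o\<^sub>L a) o\<^sub>L b = c o\<^sub>L (a o\<^sub>L b)" by (rule compose_assoc)
  also have "Lam \<dots> = of_real (exp (- (\<beta> * s))) * Lam ((a o\<^sub>L b) o\<^sub>L c)"
    using c mult [OF a bA] unfolding twisted_def by blast
  finally show "Lam ((b o\<^sub>L c) o\<^sub>L a) = of_real (exp (- (\<beta> * (r + s)))) * Lam (a o\<^sub>L (b o\<^sub>L c))"
    by (simp add: compose_assoc algebra_simps exp_add flip: mult.assoc of_real_mult) (simp add: mult.commute flip: exp_add)
qed

text \<open>Applying the relation to \<open>op_adj a\<close> and conjugating exchanges its two
  sides, so the exponential moves across and the degree changes sign.\<close>

lemma twisted_adj:
  assumes "twisted b r" shows "twisted (op_adj b) (- r)"
  unfolding twisted_def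
proof (intro conjI ballI)
  have b: "b \<in> A" using assms by (simp add: twisted_def)
  then show "op_adj b \<in> A" by (rule adj)
  fix a assume a: "a \<in> A"
  have "Lam (b o\<^sub>L op_adj a) = of_real (exp (- (\<beta> * r))) * Lam (op_adj a o\<^sub>L b)"
    using assms adj [OF a] unfolding twisted_def by blast
  moreover have "op_adj (a o\<^sub>L op_adj b) = b o\<^sub>L op_adj a" "op_adj (op_adj b o\<^sub>L a) = op_adj a o\<^sub>L b"
    using a b by (simp_all add: adj_simps adj)
  ultimately have "cnj (Lam (a o\<^sub>L op_adj b)) = of_real (exp (- (\<beta> * r))) * cnj (Lam (op_adj b o\<^sub>L a))"
    using Lam_adj [OF mult [OF a adj [OF b]]] Lam_adj [OF mult [OF adj [OF b] a]] by simp
  then have "Lam (a o\<^sub>L op_adj b) = of_real (exp (- (\<beta> * r))) * Lam (op_adj b o\<^sub>L a)"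
    by (metis complex_cnj_cnj complex_cnj_complex_of_real complex_cnj_mult)
  moreover have "of_real (exp (- (\<beta> * - r))) * (of_real (exp (- (\<beta> * r))) * z) = z" for z :: complex
    by (simp flip: of_real_mult exp_add mult.assoc)
  ultimately show "Lam (op_adj b o\<^sub>L a) = of_real (exp (- (\<beta> * - r))) * Lam (a o\<^sub>L op_adj b)" by metis
qed

lemma path_op_vertex_right: "path_op G w \<mu> \<nu> o\<^sub>L P v = (if start G \<nu> w = v then path_op G w \<mu> \<nu> else 0)"
proof -
  have "is_adj (P v o\<^sub>L path_op G w \<nu> \<mu>) (path_op G w \<mu> \<nu> o\<^sub>L P v)" by (intro is_adj_simps is_adj_path_op)
  moreover have "is_adj (P v o\<^sub>L path_op G w \<nu> \<mu>) (if start G \<nu> w = v then path_op G w \<mu> \<nu> else 0)"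
    unfolding path_op_vertex by (auto intro: is_adj_path_op is_adj_simps)
  ultimately show ?thesis by (rule is_adj_unique)
qed

lemma twisted_vertex: "twisted (P v) 0"
  by (rule twistedI [OF path_op_in]) (auto simp: path_op_vertex path_op_vertex_right Lam_path_op Lam_zero Lam_val_def)

text \<open>Multiplying by the edge on the left prepends it to \<mu>, on the right it strips it from
  \<nu>. If both resulting values are nonzero, the diagonal word on the left is longer by this one
  edge, which accounts for the factor \<open>exp (- \<beta>)\<close>; if \<nu> is empty, both values
  vanish since the words have no chance to be equal.\<close>

lemma twisted_edge: assumes e: "e \<in> arcs G" shows "twisted (path_op G (head G e) [e] []) 1"
proof (rule twistedI [OF path_op_in])
  fix w \<mu> \<nu>
  show "Lam (path_op G (head G e) [e] [] o\<^sub>L path_op G w \<mu> \<nu>)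
      = of_real (exp (- (\<beta> * 1))) * Lam (path_op G w \<mu> \<nu> o\<^sub>L path_op G (head G e) [e] [])"
  proof (cases \<nu>)
    case Nil
    have "Lam (path_op G w \<mu> [] o\<^sub>L path_op G (head G e) [e] []) = 0"
      unfolding path_op_compose_edge_Nil [OF e] by (simp add: Lam_path_op Lam_zero Lam_val_def)
    then show ?thesis unfolding Nil path_op_Cons [OF e] by (simp add: Lam_path_op Lam_val_def)
  next
    case (Cons f \<nu>')
    show ?thesis
    proof (cases "f = e \<and> walk G (e # \<nu>') w")
      case True
      have "path_op G w \<mu> (f # \<nu>') o\<^sub>L path_op G (head G e) [e] [] = path_op G w \<mu> \<nu>'"
        unfolding path_op_compose_edge_Cons [OF e] using True by simp
      moreover have "Lam_val w (e # \<mu>) (f # \<nu>') = exp (- (\<beta> * 1)) * Lam_val w \<mu> \<nu>'"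
        using True by (auto simp: Lam_val_def algebra_simps simp flip: exp_add mult.assoc)
      ultimately show ?thesis unfolding Cons path_op_Cons [OF e] by (simp only: Lam_path_op of_real_mult)
    next
      case False
      have "path_op G w \<mu> (f # \<nu>') o\<^sub>L path_op G (head G e) [e] [] = 0"
        unfolding path_op_compose_edge_Cons [OF e] using False by (simp only: if_False)
      moreover have "Lam_val w (e # \<mu>) (f # \<nu>') = 0"
        using False by (auto simp: Lam_val_def)
      ultimately show ?thesis unfolding Cons path_op_Cons [OF e] by (simp only: Lam_path_op Lam_zero of_real_0 mult_zero_right)
    qed
  qed
qed

lemma twisted_zero: "twisted 0 r"
  by (simp add: twisted_def zero Lam_zero)

lemma twisted_path_op: "twisted (path_op G w \<mu> \<nu>) (real (length \<mu>) - real (length \<nu>))"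
proof -
  have left: "twisted (path_op G w \<mu> []) (real (length \<mu>))" for \<mu>
  proof (induction \<mu>)
    case Nil
    show ?case by (simp add: twisted_vertex)
  next
    case (Cons e \<mu>)
    show ?case
    proof (cases "e \<in> arcs G")
      case True
      have "twisted (path_op G (head G e) [e] [] o\<^sub>L path_op G w \<mu> []) (1 + real (length \<mu>))"
        by (rule twisted_mult [OF twisted_edge [OF True] Cons])
      then show ?thesis unfolding path_op_Cons [OF True] by simp
    next
      case False
      then show ?thesis by (simp add: path_op_zero twisted_zero)
    qed
  qed
  have "twisted (path_op G w [] \<nu>) (- real (length \<nu>))"
    using twisted_adj [OF left [of \<nu>]] by (simp add: op_adj_path_op)
  then show ?thesis using twisted_mult [OF left] path_op_factor by (metis diff_conv_add_uminus)
qed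

text \<open>Only generators with equal words have a nonzero value, and these are fixed by the
  action.\<close>

lemma Lam_gauge: assumes "a \<in> A" shows "Lam (gauge t a) = Lam a"
proof (rule A_eqI [OF _ _ _ _ _ _ _ _ assms])
  show "Lam (gauge t (path_op G w \<mu> \<nu>)) = Lam (path_op G w \<mu> \<nu>)" for w \<mu> \<nu>
    unfolding gauge_path_op Lam_scale [OF path_op_in] Lam_path_op Lam_val_def by auto
qed (auto simp: gauge_simps Lam_add Lam_scale gauge_in intro!: Lam_limit tendsto_gauge)

lemma KMS_exists:
  assumes a: "a \<in> A" and b: "b \<in> A"
  shows "\<exists>F. KMS_fun \<beta> F \<and> (\<forall>t. F (of_real t) = Lam (a o\<^sub>L gauge t b)) \<and>
    (\<forall>t. F (of_real t + \<i> * of_real \<beta>) = Lam (gauge t b o\<^sub>L a))"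
proof -
  define good where "good = (\<lambda>b F. KMS_fun \<beta> F \<and> (\<forall>t. F (of_real t) = Lam (a o\<^sub>L gauge t b)) \<and>
    (\<forall>t. F (of_real t + \<i> * of_real \<beta>) = Lam (gauge t b o\<^sub>L a)))"
  have gen: "\<exists>F. good b F" if "b \<in> genspan G" for b
    using that
  proof (induction rule: genspan_induct)
    case zero
    have "good 0 (\<lambda>z. 0)" by (simp add: good_def KMS_fun_const gauge_simps Lam_zero)
    then show ?case by blast
  next
    case (add b c)
    then obtain F H where FH: "good b F" "good c H" by blast
    have bc: "gauge t b \<in> A" "gauge t c \<in> A" for t using add by (auto intro: gauge_in genspan_in)
    have "good (b + c) (\<lambda>z. F z + H z)"
      using FH unfolding good_def
      by (simp add: KMS_fun_add gauge_simps blinfun_compose_simps Lam_add mult a bc)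
    then show ?case by blast
  next
    case (scale c b)
    then obtain F where F: "good b F" by blast
    have bA: "gauge t b \<in> A" for t using scale by (auto intro: gauge_in genspan_in)
    have "good (op_scale c b) (\<lambda>z. c * F z)"
      using F unfolding good_def
      by (simp add: KMS_fun_mult KMS_fun_const gauge_simps compose_scale op_scale_compose_left Lam_scale mult a bA)
    then show ?case by blast
  next
    case (T w \<mu> \<nu>)
    define r where "r = real (length \<mu>) - real (length \<nu>)"
    let ?T = "path_op G w \<mu> \<nu>"
    have tw: "Lam (?T o\<^sub>L a) = of_real (exp (- (\<beta> * r))) * Lam (a o\<^sub>L ?T)"
      using twisted_path_op [of w \<mu> \<nu>] a unfolding twisted_def r_def by blast
    have g: "gauge t ?T = op_scale (exp (\<i> * of_real r * of_real t)) ?T" for t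
      unfolding gauge_path_op r_def ..
    have ex: "exp (\<i> * of_real r * (of_real t + \<i> * of_real \<beta>)) = exp (\<i> * of_real r * of_real t) * of_real (exp (- (\<beta> * r)))" for t
    proof -
      have "\<i> * of_real r * (of_real t + \<i> * of_real \<beta>) = \<i> * of_real r * of_real t + of_real (- (\<beta> * r))"
        by (simp add: complex_eq_iff)
      then show ?thesis by (simp only: exp_add exp_of_real)
    qed
    \<comment> \<open>The KMS function of a homogeneous element is explicit; at imaginary part
      \<beta> it acquires the factor \<open>exp (- (\<beta> * r))\<close>, which is the one in the
      relation \<open>tw\<close>.\<close>
    have "good ?T (\<lambda>z. exp (\<i> * of_real r * z) * Lam (a o\<^sub>L ?T))"
      unfolding good_def
    proof (intro conjI allI KMS_fun_mult KMS_fun_exp KMS_fun_const)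
      fix t
      show "exp (\<i> * of_real r * of_real t) * Lam (a o\<^sub>L ?T) = Lam (a o\<^sub>L gauge t ?T)"
        by (simp only: g compose_scale [OF a] Lam_scale [OF mult [OF a path_op_in]])
      show "exp (\<i> * of_real r * (of_real t + \<i> * of_real \<beta>)) * Lam (a o\<^sub>L ?T) = Lam (gauge t ?T o\<^sub>L a)"
        unfolding g op_scale_compose_left Lam_scale [OF mult [OF path_op_in a]] tw ex by (rule mult.assoc)
    qed
    then show ?case by blast
  qed
  obtain Y where Y: "\<And>n. Y n \<in> genspan G" "Y \<longlonglongrightarrow> b" by (rule approx_seq [OF b], rule that)
  have YA: "Y n \<in> A" for n by (rule genspan_in [OF Y(1)])
  have "\<forall>n. \<exists>F. good (Y n) F" using gen [OF Y(1)] by blast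
  from choice [OF this] obtain F where F: "\<And>n. good (Y n) (F n)" by auto
  have Fs: "KMS_fun \<beta> (F n)" "F n (of_real t) = Lam (a o\<^sub>L gauge t (Y n))"
    "F n (of_real t + \<i> * of_real \<beta>) = Lam (gauge t (Y n) o\<^sub>L a)" for n t
    using F [of n] by (simp_all add: good_def)
  \<comment> \<open>On both boundary lines the difference is a value of \<open>Lam\<close> at a
    product of \<open>a\<close> with a gauge translate of \<open>Y m - Y n\<close>. The bound is
    therefore uniform in the real part, as \<open>strip_limit\<close> demands.\<close>
  have bd: "cmod (F m z - F n z) \<le> norm a * norm (Y m - Y n)" if "Im z = 0 \<or> Im z = \<beta>" for m n z
    using that
  proof
    assume "Im z = 0"
    then have z: "z = of_real (Re z)" by (simp add: complex_eq_iff)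
    have "F m z - F n z = Lam (a o\<^sub>L gauge (Re z) (Y m - Y n))"
      by (subst (1 2) z) (simp add: Fs gauge_simps blinfun_compose_simps Lam_diff mult a gauge_in YA)
    also have "cmod \<dots> \<le> norm (a o\<^sub>L gauge (Re z) (Y m - Y n))" by (intro Lam_norm mult a gauge_in diff YA)
    also have "\<dots> \<le> norm a * norm (gauge (Re z) (Y m - Y n))" by (rule norm_blinfun_compose)
    also have "\<dots> \<le> norm a * norm (Y m - Y n)" by (intro mult_left_mono norm_gauge_le) simp
    finally show ?thesis .
  next
    assume "Im z = \<beta>"
    then have z: "z = of_real (Re z) + \<i> * of_real \<beta>" by (simp add: complex_eq_iff)
    have "F m z - F n z = Lam (gauge (Re z) (Y m - Y n) o\<^sub>L a)"
      by (subst (1 2) z) (simp only: Fs gauge_simps blinfun_compose_simps Lam_diff [OF mult [OF gauge_in [OF YA] a] mult [OF gauge_in [OF YA] a]])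
    also have "cmod \<dots> \<le> norm (gauge (Re z) (Y m - Y n) o\<^sub>L a)" by (intro Lam_norm mult a gauge_in diff YA)
    also have "\<dots> \<le> norm (gauge (Re z) (Y m - Y n)) * norm a" by (rule norm_blinfun_compose)
    also have "\<dots> \<le> norm (Y m - Y n) * norm a" by (intro mult_right_mono norm_gauge_le) simp
    finally show ?thesis by (simp add: mult.commute)
  qed
  obtain H where H: "KMS_fun \<beta> H" "\<And>z. z \<in> KMS_strip \<beta> \<Longrightarrow> (\<lambda>n. F n z) \<longlonglongrightarrow> H z"
  proof (rule strip_limit [of \<beta> F])
    show "KMS_fun \<beta> (F n)" for n by (rule Fs)
    fix e :: real assume e: "e > 0"
    define d where "d = e / (norm a + 1)"
    have n: "0 < norm a + 1" by (simp add: add_nonneg_pos)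
    have d: "d > 0" "norm a * d \<le> e" using e n by (simp_all add: d_def pos_divide_le_eq mult.commute [of _ e])
    obtain N where N: "\<And>m n. m \<ge> N \<Longrightarrow> n \<ge> N \<Longrightarrow> norm (Y m - Y n) < d"
      using CauchyD [OF LIMSEQ_imp_Cauchy [OF Y(2)] d(1)] by blast
    have "cmod (F m z - F n z) \<le> e" if "m \<ge> N" "n \<ge> N" "Im z = 0 \<or> Im z = \<beta>" for m n z
    proof -
      have "cmod (F m z - F n z) \<le> norm a * norm (Y m - Y n)" by (rule bd [OF that(3)])
      also have "\<dots> \<le> norm a * d" by (intro mult_left_mono less_imp_le [OF N] that) simp
      finally show ?thesis using d(2) by simp
    qed
    then show "\<exists>N. \<forall>m\<ge>N. \<forall>n\<ge>N. \<forall>z. Im z = 0 \<or> Im z = \<beta> \<longrightarrow> cmod (F m z - F n z) \<le> e" by blast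
  qed (rule that)
  have "H (of_real t) = Lam (a o\<^sub>L gauge t b)" for t
  proof (rule LIMSEQ_unique)
    show "(\<lambda>n. F n (of_real t)) \<longlonglongrightarrow> H (of_real t)" by (rule H) (simp add: KMS_strip_iff linear)
    show "(\<lambda>n. F n (of_real t)) \<longlonglongrightarrow> Lam (a o\<^sub>L gauge t b)"
      unfolding Fs by (intro Lam_limit mult a gauge_in YA b tendsto_compose_op tendsto_const tendsto_gauge Y)
  qed
  moreover have "H (of_real t + \<i> * of_real \<beta>) = Lam (gauge t b o\<^sub>L a)" for t
  proof (rule LIMSEQ_unique)
    show "(\<lambda>n. F n (of_real t + \<i> * of_real \<beta>)) \<longlonglongrightarrow> H (of_real t + \<i> * of_real \<beta>)"
      by (rule H) (simp add: KMS_strip_iff linear)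
    show "(\<lambda>n. F n (of_real t + \<i> * of_real \<beta>)) \<longlonglongrightarrow> Lam (gauge t b o\<^sub>L a)"
      unfolding Fs by (intro Lam_limit mult a gauge_in YA b tendsto_compose_op tendsto_const tendsto_gauge Y)
  qed
  ultimately show ?thesis using H(1) by blast
qed

section \<open>The KMS state of an eigenvector\<close>

definition state :: "'e garrow op \<Rightarrow> ennreal" where
  "state = (\<lambda>a\<in>positive_part A. ennreal (Re (Lam a)))"

lemma state_apply: "a \<in> positive_part A \<Longrightarrow> state a = ennreal (Re (Lam a))"
  by (simp add: state_def)

lemma state_P: "v \<in> verts G \<Longrightarrow> state (P v) = ennreal (\<xi> v)"
  using proj_pos [of "{v}"] by (simp add: state_apply Lam_path_op Lam_val_def)

lemma state_weight: "weight A state"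
  unfolding weight_def
proof (intro conjI ballI allI impI)
  fix a b assume ab: "a \<in> positive_part A" "b \<in> positive_part A"
  then show "state (a + b) = state a + state b"
    by (simp add: state_apply positive_part_simps Lam_add positive_part_in Lam_pos(2))
next
  fix a and r :: real assume a: "a \<in> positive_part A" "r > 0"
  have "Lam (r *\<^sub>R a) = of_real r * Lam a"
    using Lam_scale [OF positive_part_in [OF a(1)], of "of_real r"] by (simp add: op_scale_of_real)
  then show "state (r *\<^sub>R a) = ennreal r * state a"
    using a by (simp add: state_apply positive_part_simps Lam_pos(2) ennreal_mult)
qed

text \<open>Gives access to the uniqueness of the linear extension, by which
  \<open>weight_ext\<close> is recognised as \<open>Lam\<close>.\<close>

sublocale st: finite_weight_approx A state P "verts G" "genspan G"
  by unfold_locales (auto simp: state_weight state_apply)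

lemma st_ext: "a \<in> A \<Longrightarrow> weight_ext A state a = Lam a"
  by (rule st.weight_ext_eqI)
    (simp_all add: Lam_add Lam_scale st.val_def state_apply Lam_pos(2) Lam_pos(1) [symmetric])

lemma state_proper: "proper_weight A state"
  unfolding proper_weight_def
proof (intro conjI allI impI state_weight)
  have "\<exists>v\<in>verts G. \<xi> v \<noteq> 0"
  proof (rule ccontr)
    assume "\<not> ?thesis"
    then have "(\<xi> has_sum 0) (verts G)" by (intro has_sum_0) auto
    then show False using total has_sum_unique by fastforce
  qed
  then obtain v where v: "v \<in> verts G" "\<xi> v \<noteq> 0" by blast
  then show "\<exists>a\<in>positive_part A. state a \<noteq> 0"
    using proj_pos [of "{v}"] nonneg [of v] by (intro bexI [of _ "P v"]) (auto simp: state_P ennreal_eq_0_iff)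
  have "{a \<in> positive_part A. state a < \<infinity>} = positive_part A" by (auto simp: state_apply)
  then show "positive_part A \<subseteq> closure {a \<in> positive_part A. state a < \<infinity>}" by (simp add: closure_subset)
  fix r :: real assume r: "0 \<le> r"
  have "continuous_on (positive_part A) (\<lambda>a. Re (Lam a))"
  proof (rule continuous_on_sequentiallyI)
    fix u a assume u: "\<forall>n. u n \<in> positive_part A" "a \<in> positive_part A" "u \<longlonglongrightarrow> a"
    show "(\<lambda>n. Re (Lam (u n))) \<longlonglongrightarrow> Re (Lam a)"
      using u by (intro tendsto_Re Lam_limit) (auto intro: positive_part_in)
  qed
  then have "closedin (top_of_set (positive_part A)) (positive_part A \<inter> (\<lambda>a. Re (Lam a)) -` {..r})"
    by (rule continuous_closedin_preimage) simp
  moreover have "positive_part A \<inter> (\<lambda>a. Re (Lam a)) -` {..r} = {a \<in> positive_part A. state a \<le> ennreal r}"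
    using r by (auto simp: state_apply)
  ultimately show "closedin (top_of_set (positive_part A)) {a \<in> positive_part A. state a \<le> ennreal r}" by simp
qed

lemma state_sup: "(SUP a\<in>{a \<in> A. op_le 0 a \<and> op_le a id_blinfun}. state a) = 1"
proof (rule antisym)
  show "(SUP a\<in>{a \<in> A. op_le 0 a \<and> op_le a id_blinfun}. state a) \<le> 1"
  proof (rule SUP_least)
    fix a assume a: "a \<in> {a \<in> A. op_le 0 a \<and> op_le a id_blinfun}"
    then have ap: "a \<in> positive_part A" by (simp add: positive_part_def)
    have "Re (Lam_approx n a) \<le> 1" for n
    proof -
      have "0 \<le> Re (cinner (\<Omega> n) ((id_blinfun - a) (\<Omega> n)))" using a by (simp add: op_le_def)
      then have "Re (Lam_approx n a) \<le> (norm (\<Omega> n))\<^sup>2"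
        by (simp add: blinfun.diff_left cinner_simps Lam_approx_def cinner_self)
      also have "\<dots> \<le> 1" using \<Omega>_norm by (simp add: power_le_one)
      finally show ?thesis .
    qed
    then have "Re (Lam a) \<le> 1"
      using a by (intro LIMSEQ_le_const2 [OF tendsto_Re [OF Lam_tendsto]]) auto
    then show "state a \<le> 1" by (simp add: state_apply ap)
  qed
  show "1 \<le> (SUP a\<in>{a \<in> A. op_le 0 a \<and> op_le a id_blinfun}. state a)" (is "1 \<le> ?S")
  proof -
    \<comment> \<open>Finite sums of vertex projections are contractions, so they compete in the
      supremum, and their values are the partial sums of \<xi>.\<close>
    have F: "ennreal (sum \<xi> F) \<le> ?S" if F: "finite F" "F \<subseteq> verts G" for F
    proof -
      have p: "sum P F \<in> positive_part A" by (rule proj_pos [OF F])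
      have "Lam (sum P F) = (\<Sum>v\<in>F. Lam (P v))"
        using F(1) by (induction F rule: finite_induct) (simp_all add: Lam_zero Lam_add path_op_in sum)
      also have "\<dots> = of_real (sum \<xi> F)" using F(2) by (auto simp: Lam_path_op Lam_val_def intro!: sum.cong)
      finally have "state (sum P F) = ennreal (sum \<xi> F)" by (simp add: state_apply p)
      moreover have "state (sum P F) \<le> ?S"
        using p proj_norm [OF F] by (intro SUP_upper) (auto simp: positive_part_def op_le_norm)
      ultimately show ?thesis by simp
    qed
    show ?thesis
    proof (cases "?S = \<infinity>")
      case False
      then obtain r where r: "r \<ge> 0" "?S = ennreal r" by (cases ?S) auto
      have "1 \<le> r"
        by (rule has_sum_le_finite_sums [OF total]) (use F r in simp)
      then show ?thesis using r by simp
    next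
      case True
      show ?thesis unfolding True by simp
    qed
  qed
qed

lemma state_KMS: "state \<in> KMS_states A (gauge_action G) \<beta>"
proof -
  have "\<exists>F. continuous_on (KMS_strip \<beta>) F \<and> bounded (F ` KMS_strip \<beta>) \<and> F holomorphic_on interior (KMS_strip \<beta>) \<and>
     (\<forall>t. F (of_real t) = weight_ext A state (a o\<^sub>L gauge_action G t b)) \<and>
     (\<forall>t. F (of_real t + \<i> * of_real \<beta>) = weight_ext A state (gauge_action G t b o\<^sub>L a))"
    if ab: "a \<in> A" "b \<in> A" for a b
  proof -
    have "weight_ext A state (a o\<^sub>L gauge_action G t b) = Lam (a o\<^sub>L gauge t b)"
      "weight_ext A state (gauge_action G t b o\<^sub>L a) = Lam (gauge t b o\<^sub>L a)" for t
      by (simp_all add: gauge_action_apply ab st_ext mult gauge_in)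
    then show ?thesis using KMS_exists [OF ab] unfolding KMS_fun_def by auto
  qed
  moreover have "state (gauge_action G t a) = state a" if a: "a \<in> positive_part A" for a t
  proof -
    have aA: "a \<in> A" using a by (rule positive_part_in)
    have "gauge t a \<in> positive_part A"
      using a gauge_in [OF aA, of t] gauge_positive [of a t] by (simp add: positive_part_def)
    then show ?thesis by (simp add: gauge_action_apply aA state_apply a Lam_gauge)
  qed
  ultimately have "KMS_weight A (gauge_action G) \<beta> state"
    unfolding KMS_weight_def st.weight_N_adj using state_proper by blast
  then show ?thesis
    unfolding KMS_states_def KMS_state_def using state_sup by (simp add: state_def)
qed

end

section \<open>The correspondence between states and eigenvectors\<close>

theorem corollary4p7:
  fixes G :: "('v, 'e) pre_digraph" and \<beta> :: real
  assumes "wf_digraph G" and "countable (verts G)" and "countable (arcs G)"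
    and "row_finite G" and "no_sinks G"
  shows "(\<forall>\<psi>\<in>KMS_states (graph_Cstar G) (gauge_action G) \<beta>.
      \<forall>v\<in>verts G. \<psi> (vertex_proj G v) < \<infinity>) \<and>
    bij_betw (\<lambda>\<psi>. \<lambda>v\<in>verts G. enn2real (\<psi> (vertex_proj G v)))
      (KMS_states (graph_Cstar G) (gauge_action G) \<beta>)
      {\<xi> \<in> verts G \<rightarrow>\<^sub>E (UNIV :: real set). (\<exists>v\<in>verts G. \<xi> v \<noteq> 0) \<and>
        (\<forall>v\<in>verts G. 0 \<le> \<xi> v) \<and>
        (\<forall>v\<in>verts G. ((\<lambda>w. real (adj_matrix G v w) * \<xi> w) has_sum exp \<beta> * \<xi> v) (verts G)) \<and>
        (\<xi> has_sum 1) (verts G)}"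
proof -
  note wf = assms(1) and rf = assms(4) and ns = assms(5)
  let ?S = "KMS_states (graph_Cstar G) (gauge_action G) \<beta>"
    and ?f = "(\<lambda>\<psi>. \<lambda>v\<in>verts G. enn2real (\<psi> (vertex_proj G v)))"
    and ?E = "{\<xi> \<in> verts G \<rightarrow>\<^sub>E (UNIV :: real set). (\<exists>v\<in>verts G. \<xi> v \<noteq> 0) \<and>
        (\<forall>v\<in>verts G. 0 \<le> \<xi> v) \<and>
        (\<forall>v\<in>verts G. ((\<lambda>w. real (adj_matrix G v w) * \<xi> w) has_sum exp \<beta> * \<xi> v) (verts G)) \<and>
        (\<xi> has_sum 1) (verts G)}"
  have fin: "finite (out_arcs G v)" if "v \<in> verts G" for v using rf that by (simp add: row_finite_def)
  have st: "graph_KMS_state G \<beta> \<psi>" if "\<psi> \<in> ?S" for \<psi>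
    using that by (intro graph_KMS_state.intro graph_algebra.intro graph_KMS_state_axioms.intro wf rf)
      (simp add: KMS_states_def)
  have fini: "\<psi> (vertex_proj G v) < \<infinity>" if \<psi>: "\<psi> \<in> ?S" and v: "v \<in> verts G" for \<psi> v
  proof -
    interpret graph_KMS_state G \<beta> \<psi> by (rule st [OF \<psi>])
    show ?thesis unfolding vertex_proj_eq by (rule finite [OF P_pos [OF v]])
  qed
  have inj: "inj_on ?f ?S"
  proof (rule inj_onI)
    fix \<psi> \<psi>' assume \<psi>: "\<psi> \<in> ?S" "\<psi>' \<in> ?S"
      and eq: "(\<lambda>v\<in>verts G. enn2real (\<psi> (vertex_proj G v))) = (\<lambda>v\<in>verts G. enn2real (\<psi>' (vertex_proj G v)))"
    have "enn2real (\<psi> (path_op G v [] [])) = enn2real (\<psi>' (path_op G v [] []))" if "v \<in> verts G" for v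
      using fun_cong [OF eq, of v] that by (simp add: vertex_proj_eq)
    then have "\<psi> a = \<psi>' a" if "a \<in> positive_part (graph_Cstar G)" for a
      using KMS_state_unique [OF st [OF \<psi>(1)] st [OF \<psi>(2)]] that by blast
    moreover have "\<psi> \<in> extensional (positive_part (graph_Cstar G))" "\<psi>' \<in> extensional (positive_part (graph_Cstar G))"
      using \<psi> by (auto simp: KMS_states_def PiE_def)
    \<comment> \<open>The two weights are compared as functions: they agree on the positive part and
      have the same default value outside it.\<close>
    ultimately show "\<psi> = \<psi>'" by (intro extensionalityI)
  qed
  have into: "(\<lambda>v\<in>verts G. enn2real (\<psi> (vertex_proj G v))) \<in> ?E" (is "?x \<in> _") if \<psi>: "\<psi> \<in> ?S" for \<psi>
  proof -
    interpret graph_KMS_state G \<beta> \<psi> by (rule st [OF \<psi>])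
    have x: "?x v = mass v" if "v \<in> verts G" for v
      using that by (simp add: mass_def val_def vertex_proj_eq)
    have tot: "(?x has_sum 1) (verts G)"
      using mass_has_sum by (rule has_sum_cong [THEN iffD1, rotated]) (simp add: mass_def val_def vertex_proj_eq)
    have nz: "\<exists>v\<in>verts G. ?x v \<noteq> 0"
    proof (rule ccontr)
      assume "\<not> ?thesis"
      then have "(?x has_sum 0) (verts G)" by (intro has_sum_0) blast
      then show False using has_sum_unique [OF tot] by fastforce
    qed
    have eig: "((\<lambda>w. real (adj_matrix G v w) * ?x w) has_sum exp \<beta> * ?x v) (verts G)" if v: "v \<in> verts G" for v
    proof -
      have "((\<lambda>w. real (adj_matrix G v w) * mass w) has_sum exp \<beta> * mass v) (verts G)"
        using row_sum_has_sum [OF fin [OF v] wf, of mass] by (simp only: mass_eq [OF v])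
      then show ?thesis unfolding x [OF v]
        by (rule has_sum_cong [THEN iffD1, rotated]) (simp only: x)
    qed
    have "?x \<in> verts G \<rightarrow>\<^sub>E (UNIV :: real set)" by simp
    moreover have "\<forall>v\<in>verts G. 0 \<le> ?x v" by simp
    ultimately show ?thesis using tot nz eig by blast
  qed
  have onto: "\<exists>\<psi>\<in>?S. \<xi> = (\<lambda>v\<in>verts G. enn2real (\<psi> (vertex_proj G v)))"
    if ext: "\<xi> \<in> verts G \<rightarrow>\<^sub>E (UNIV :: real set)" and nn: "\<forall>v\<in>verts G. 0 \<le> \<xi> v"
      and eig: "\<forall>v\<in>verts G. ((\<lambda>w. real (adj_matrix G v w) * \<xi> w) has_sum exp \<beta> * \<xi> v) (verts G)"
      and tot: "(\<xi> has_sum 1) (verts G)" for \<xi>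
  proof -
    \<comment> \<open>The vertex sum of b') is turned into a sum over outgoing edges, the form in
      which the locale takes the eigenvector equation.\<close>
    interpret graph_eigenvector G \<beta> \<xi>
    proof (intro graph_eigenvector.intro graph_algebra.intro graph_eigenvector_axioms.intro wf rf ns)
      show "(\<Sum>e\<in>out_arcs G v. \<xi> (head G e)) = exp \<beta> * \<xi> v" if "v \<in> verts G" for v
        using row_sum_has_sum [OF fin [OF that] wf, of \<xi>] eig that has_sum_unique by blast
    qed (use nn tot in auto)
    have "\<xi> = (\<lambda>v\<in>verts G. enn2real (state (vertex_proj G v)))"
    proof (rule extensionalityI [of _ "verts G"])
      show "\<xi> \<in> extensional (verts G)" using ext by (simp add: PiE_def)
      show "\<xi> v = (\<lambda>v\<in>verts G. enn2real (state (vertex_proj G v))) v" if "v \<in> verts G" for v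
        using that nn by (simp add: vertex_proj_eq state_P)
    qed simp
    then show ?thesis using state_KMS by blast
  qed
  show ?thesis
  proof (intro conjI ballI)
    show "\<psi> (vertex_proj G v) < \<infinity>" if "\<psi> \<in> ?S" "v \<in> verts G" for \<psi> v by (rule fini [OF that])
    show "bij_betw ?f ?S ?E"
      unfolding bij_betw_def
    proof (rule conjI [OF inj], rule equalityI)
      show "?f ` ?S \<subseteq> ?E"
        by (rule image_subsetI) (rule into)
      show "?E \<subseteq> ?f ` ?S"
      proof
        fix \<xi> assume "\<xi> \<in> ?E"
        then have "\<exists>\<psi>\<in>?S. \<xi> = (\<lambda>v\<in>verts G. enn2real (\<psi> (vertex_proj G v)))"
          by (intro onto) simp_all
        then show "\<xi> \<in> ?f ` ?S" by blast
      qed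
    qed
  qed
qed

end
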